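(* Let $\zeta=\sqrt{(e-\frac12)^2+\tilde t}$. For all achievable $(e,\tilde t)$ with $\zeta$ sufficiently small, the entropy-maximizing graphon with parameters $(e,\tilde t)$ is unique and bipodal, with parameters $$a=1-e-2\zeta+O(\zeta^2),\qquad b=1-e+2\zeta+O(\zeta^2),\qquad d=1-e+O(\zeta^2),\qquad c=\frac12\left(1-\frac{e-\frac12}{\zeta}\right)+O(\zeta)$$ that are analytic functions of $(e,\tilde t)$ everywhere (in this region of small $\zeta$) except at the singular point $e=\frac12$, $\tilde t=0$.
   Context: A graphon is a symmetric measurable function $g:[0,1]^2\to[0,1]$. Uniqueness is meant in the space of reduced graphons, i.e. up to measure-preserving rearrangements of $[0,1]$ (cut distance zero). The degree function of $g$ is $d(x)=\int_0^1 g(x,y)\,dy$ (not to be confused with the parameter $d$ below). The edge density is $e=\int_0^1\int_0^1 g(x,y)\,dx\,dy$, the 2star density is $t=\int_0^1 d(x)^2\,dx$, and the reduced 2star density is $\tilde t=t-e^2=\int_0^1(d(x)-e)^2\,dx\ge 0$. A pair $(e,\tilde t)$ is achievable if some graphon has these densities. The Shannon entropy of $g$ is $S(g)=\int_0^1\int_0^1 H(g(x,y))\,dx\,dy$ with $H(u)=-\frac12\left(u\ln u+(1-u)\ln(1-u)\right)$ (and $0\ln0=0$). The entropy-maximizing graphon with parameters $(e,\tilde t)$ is a graphon maximizing $S$ among all graphons with edge density $e$ and reduced 2star density $\tilde t$. A bipodal graphon with parameters $(a,b,c,d)\in[0,1]^4$ is (up to rearrangement) the graphon with $g(x,y)=a$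 if $x,y<c$, $g(x,y)=b$ if $x,y>c$, and $g(x,y)=d$ if $x<c<y$ or $y<c<x$. The $O(\cdot)$ estimates are as $\zeta\to0$. *)

theory Defs
  imports "HOL-Probability.Probability" "HOL-Library.Landau_Symbols"
begin

definition unit_measure :: "real measure" where
  "unit_measure = restrict_space lborel {0..1}"

text \<open>Kernels are total functions; only their values on the unit square matter.\<close>

definition graphon :: "(real \<Rightarrow> real \<Rightarrow> real) \<Rightarrow> bool" where
  "graphon g \<longleftrightarrow>
     case_prod g \<in> borel_measurable (unit_measure \<Otimes>\<^sub>M unit_measure) \<and>
     (\<forall>x\<in>{0..1}. \<forall>y\<in>{0..1}. g x y = g y x \<and> g x y \<in> {0..1})"

definition degree_fun :: "(real \<Rightarrow> real \<Rightarrow> real) \<Rightarrow> real \<Rightarrow> real" where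
  "degree_fun g x = (LINT y|unit_measure. g x y)"

definition edge_density :: "(real \<Rightarrow> real \<Rightarrow> real) \<Rightarrow> real" where
  "edge_density g = (LINT x|unit_measure. LINT y|unit_measure. g x y)"

definition two_star_density :: "(real \<Rightarrow> real \<Rightarrow> real) \<Rightarrow> real" where
  "two_star_density g = (LINT x|unit_measure. (degree_fun g x)\<^sup>2)"

definition reduced_two_star_density :: "(real \<Rightarrow> real \<Rightarrow> real) \<Rightarrow> real" where
  "reduced_two_star_density g = two_star_density g - (edge_density g)\<^sup>2"

text \<open>The convention \<open>0 ln 0 = 0\<close> holds automatically because \<open>0 * x = 0\<close>.\<close>

definition entropy_density :: "real \<Rightarrow> real" where
  "entropy_density u = - (1 / 2) * (u * ln u + (1 - u) * ln (1 - u))"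

definition shannon_entropy :: "(real \<Rightarrow> real \<Rightarrow> real) \<Rightarrow> real" where
  "shannon_entropy g = (LINT x|unit_measure. LINT y|unit_measure. entropy_density (g x y))"

definition has_densities :: "(real \<Rightarrow> real \<Rightarrow> real) \<Rightarrow> real \<Rightarrow> real \<Rightarrow> bool" where
  "has_densities g e t \<longleftrightarrow>
     graphon g \<and> edge_density g = e \<and> reduced_two_star_density g = t"

definition achievable :: "(real \<times> real) set" where
  "achievable = {(e, t). \<exists>g. has_densities g e t}"

definition entropy_maximizer :: "(real \<Rightarrow> real \<Rightarrow> real) \<Rightarrow> real \<Rightarrow> real \<Rightarrow> bool" where
  "entropy_maximizer g e t \<longleftrightarrow>
     has_densities g e t \<and> (\<forall>h. has_densities h e t \<longrightarrow> shannon_entropy h \<le> shannon_entropy g)"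

definition cut_norm :: "(real \<Rightarrow> real \<Rightarrow> real) \<Rightarrow> real" where
  "cut_norm f =
     (SUP (A, B) \<in> sets unit_measure \<times> sets unit_measure.
        \<bar>LINT x:A|unit_measure. LINT y:B|unit_measure. f x y\<bar>)"

definition rearrangement :: "(real \<Rightarrow> real) \<Rightarrow> bool" where
  "rearrangement \<sigma> \<longleftrightarrow>
     bij_betw \<sigma> {0..1} {0..1} \<and> \<sigma> \<in> measurable unit_measure unit_measure \<and>
     distr unit_measure unit_measure \<sigma> = unit_measure"

definition cut_distance :: "(real \<Rightarrow> real \<Rightarrow> real) \<Rightarrow> (real \<Rightarrow> real \<Rightarrow> real) \<Rightarrow> real" where
  "cut_distance g h =
     (INF \<sigma> \<in> {\<sigma>. rearrangement \<sigma>}. cut_norm (\<lambda>x y. g x y - h (\<sigma> x) (\<sigma> y)))"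

text \<open>The null set where a coordinate equals \<open>c\<close> is assigned to the second block.\<close>

definition bipodal :: "real \<Rightarrow> real \<Rightarrow> real \<Rightarrow> real \<Rightarrow> real \<Rightarrow> real \<Rightarrow> real" where
  "bipodal a b c d x y =
     (if x < c \<and> y < c then a else if c \<le> x \<and> c \<le> y then b else d)"

definition zeta :: "real \<times> real \<Rightarrow> real" where
  "zeta = (\<lambda>(e, t). sqrt ((e - 1 / 2)\<^sup>2 + t))"

text \<open>The filter \<open>\<zeta> \<rightarrow> 0\<close> (through positive values) on achievable pairs.\<close>

definition zeta_to_0 :: "(real \<times> real) filter" where
  "zeta_to_0 = inf (filtercomap zeta (at_right 0)) (principal achievable)"

text \<open>
  Real analyticity in two variables on a set that need not be open: near each point of \<open>S\<close>,
  the function agrees on \<open>S\<close> with a power series converging in a full neighbourhood.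
  This matters at the boundary points \<open>t = 0\<close> of the achievable region.
\<close>

definition real_analytic2_on :: "(real \<times> real \<Rightarrow> real) \<Rightarrow> (real \<times> real) set \<Rightarrow> bool" where
  "real_analytic2_on f S \<longleftrightarrow>
     (\<forall>(x0, y0)\<in>S. \<exists>r>0. \<exists>\<alpha> :: nat \<Rightarrow> nat \<Rightarrow> real.
        (\<forall>u v. \<bar>u\<bar> < r \<and> \<bar>v\<bar> < r \<longrightarrow> (\<lambda>(i, j). \<alpha> i j * u ^ i * v ^ j) summable_on UNIV) \<and>
        (\<forall>(x, y)\<in>S. \<bar>x - x0\<bar> < r \<and> \<bar>y - y0\<bar> < r \<longrightarrow>
           ((\<lambda>(i, j). \<alpha> i j * (x - x0) ^ i * (y - y0) ^ j) has_sum f (x, y)) UNIV))"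

end

theory Submission
  imports Defs "HOL-Complex_Analysis.Complex_Analysis" "HOL-Real_Asymp.Real_Asymp"
begin

text \<open>Write \<open>F = ln \<circ> cosh\<close>, \<open>T = tanh\<close>, and let \<open>\<phi>\<close> be the degree function of a graphon minus \<open>1/2\<close>.
The densities \<open>(e, t)\<close> prescribe exactly the mean \<open>e - 1/2\<close> and the second moment \<open>\<zeta>\<^sup>2\<close> of \<open>\<phi>\<close>.

The entropy problem reduces to a problem about the law of \<open>\<phi>\<close> by convex duality. The Gibbs inequality says
\<open>H u \<le> ln 2 / 2 + F p / 2 - (u - 1/2) p\<close> for every real \<open>p\<close>, with equality only at \<open>u = (1 + T p) / 2\<close>
(\<open>entropy_density_dual\<close>). Use it at each point \<open>(x, y)\<close> with \<open>p = X x + X y\<close>, where \<open>X = \<alpha> + \<beta> \<phi>\<close> is an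
affine image of the degree function. The linear term then integrates to \<open>2 \<integral> \<phi> X\<close>, which depends on the two
prescribed moments only, and what remains to be bounded is \<open>\<integral>\<integral> F (X x + X y)\<close> for a function \<open>X\<close> whose first two
moments are prescribed as well.

For small arguments \<open>F p\<close> is close to \<open>p\<^sup>2/2 - p\<^sup>4/12\<close>, so the double integral is governed by the fourth moment of
\<open>X x + X y\<close>, and with two moments of \<open>X\<close> given this is smallest for a law with two atoms. Precisely, let \<open>\<nu>\<close> put mass \<open>c\<close>
at \<open>q1\<close> and \<open>1 - c\<close> at \<open>q2\<close>, let \<open>h u\<close> be the \<open>\<nu>\<close>-average of \<open>F (u + q)\<close>, and suppose that a quadratic
polynomial touches \<open>h\<close> at both atoms (\<open>double_contact\<close>). It then stays above \<open>h\<close>, with a gap of order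
\<open>(u - q1)\<^sup>2 (u - q2)\<^sup>2\<close> (\<open>double_contact_gap\<close>). The gap is the first-order loss when \<open>\<nu>\<close> is replaced by another law with
the same two moments; the second-order term is smaller by a factor \<open>O(\<zeta>\<^sup>2)\<close>, because \<open>F (s + s')\<close> minus its quadratic
interpolants in both variables is bounded by a product of two cubic remainders. Hence \<open>\<nu>\<close> is the unique maximiser
(\<open>two_point_law_maximises\<close>), and this gives the entropy bound together with its case of equality
(\<open>entropy_bound\<close>): the graphon is almost everywhere a two-block function over some set \<open>A\<close> of measure \<open>c\<close>.
Approximating \<open>A\<close> by a union of grid cells and permuting the cells shows that the cut distance to the bipodal
graphon is zero (\<open>cut_distance_two_block\<close>).

It remains to solve for the parameters. Put \<open>q1 = w (x - 2) / 2\<close> and \<open>q2 = w (x + 2) / 2\<close>. The contact condition is linear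
in \<open>c\<close> and determines \<open>c\<close> as a function of \<open>(w, x)\<close>. After division by powers of \<open>w\<close> the two moment equations extend
holomorphically to \<open>w = 0\<close>, where they reduce to \<open>w = 2 \<zeta>\<close> and \<open>x = - \<kappa>\<close> with \<open>\<kappa> = (e - 1/2) / \<zeta>\<close>. They are a
fixed-point problem for a contraction depending holomorphically on the complex parameters \<open>(\<zeta>, \<kappa>)\<close>
(\<open>picard_step_contracts\<close>); its solution is holomorphic (\<open>sol_holomorphic\<close>), real for real parameters, and satisfies
the stated asymptotics (\<open>sol_asymptotics\<close>). Away from the singular point \<open>\<zeta>\<close> and \<open>\<kappa>\<close> are analytic in \<open>(e, t)\<close>, also
across the boundary \<open>t = 0\<close>, and a bounded separately holomorphic function has a double power series
(\<open>double_power_series\<close>).\<close>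

section \<open>Derivatives of ln cosh\<close>

definition lncosh :: "real \<Rightarrow> real" where
  "lncosh x = ln (cosh x)"

text \<open>The successive derivatives of \<open>tanh\<close>, written as polynomials in \<open>tanh\<close>. They are used on the real line and, for
complex arguments, in the Taylor expansions behind the parameter equations.\<close>

definition tanh_tower :: "nat \<Rightarrow> 'a \<Rightarrow> 'a :: {real_normed_field, banach}" where
  "tanh_tower n =
    (if n = 0 then tanh
     else if n = 1 then (\<lambda>x. 1 - tanh x ^ 2)
     else if n = 2 then (\<lambda>x. - 2 * tanh x + 2 * tanh x ^ 3)
     else if n = 3 then (\<lambda>x. - 2 + 8 * tanh x ^ 2 - 6 * tanh x ^ 4)
     else if n = 4 then (\<lambda>x. 16 * tanh x - 40 * tanh x ^ 3 + 24 * tanh x ^ 5)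
     else (\<lambda>x. 16 - 136 * tanh x ^ 2 + 240 * tanh x ^ 4 - 120 * tanh x ^ 6))"

lemma tanh_tower_derivative:
  fixes z :: "'a :: {real_normed_field, banach}"
  assumes "n < 5" "cosh z \<noteq> 0"
  shows "(tanh_tower n has_field_derivative tanh_tower (Suc n) z) (at z within S)"
proof -
  define T where "T = tanh z"
  have T: "tanh z = T" by (simp add: T_def)
  have d1: "(tanh has_field_derivative 1 - tanh z ^ 2) (at z within S)"
    using assms(2) by (auto intro!: derivative_eq_intros)
  have d2: "((\<lambda>x. 1 - tanh x ^ 2) has_field_derivative - 2 * tanh z + 2 * tanh z ^ 3) (at z within S)"
    by (rule derivative_eq_intros d1 refl)+ (unfold T, simp, algebra)
  have d3: "((\<lambda>x. - 2 * tanh x + 2 * tanh x ^ 3) has_field_derivative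
      - 2 + 8 * tanh z ^ 2 - 6 * tanh z ^ 4) (at z within S)"
    by (rule derivative_eq_intros d1 refl)+ (unfold T, simp, algebra)
  have d4: "((\<lambda>x. - 2 + 8 * tanh x ^ 2 - 6 * tanh x ^ 4) has_field_derivative
      16 * tanh z - 40 * tanh z ^ 3 + 24 * tanh z ^ 5) (at z within S)"
    by (rule derivative_eq_intros d1 refl)+ (unfold T, simp, algebra)
  have d5: "((\<lambda>x. 16 * tanh x - 40 * tanh x ^ 3 + 24 * tanh x ^ 5) has_field_derivative
      16 - 136 * tanh z ^ 2 + 240 * tanh z ^ 4 - 120 * tanh z ^ 6) (at z within S)"
    by (rule derivative_eq_intros d1 refl)+ (unfold T, simp, algebra)
  have "n = 0 \<or> n = 1 \<or> n = 2 \<or> n = 3 \<or> n = 4"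
    using assms by auto
  then show ?thesis
    using d1 d2 d3 d4 d5 by (elim disjE) (simp_all add: tanh_tower_def)
qed

definition lncosh_tower :: "nat \<Rightarrow> real \<Rightarrow> real" where
  "lncosh_tower n = (case n of 0 \<Rightarrow> lncosh | Suc m \<Rightarrow> tanh_tower m)"

lemma lncosh_tower_simps [simp]:
  "lncosh_tower 0 = lncosh" "lncosh_tower (Suc 0) = tanh" "lncosh_tower 1 = tanh"
  "lncosh_tower 2 = (\<lambda>x. 1 - tanh x ^ 2)"
  "lncosh_tower 3 = (\<lambda>x. - 2 * tanh x + 2 * tanh x ^ 3)"
  "lncosh_tower 4 = (\<lambda>x. - 2 + 8 * tanh x ^ 2 - 6 * tanh x ^ 4)"
  "lncosh_tower 6 = (\<lambda>x. 16 - 136 * tanh x ^ 2 + 240 * tanh x ^ 4 - 120 * tanh x ^ 6)"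
  by (simp_all add: lncosh_tower_def tanh_tower_def eval_nat_numeral)

lemma lncosh_has_derivative: "(lncosh has_real_derivative tanh x) (at x)"
  unfolding lncosh_def tanh_def
  by (auto intro!: derivative_eq_intros simp: field_simps)

lemma lncosh_tower_derivative:
  assumes "n < 6"
  shows "(lncosh_tower n has_real_derivative lncosh_tower (Suc n) x) (at x)"
proof (cases n)
  case 0
  thus ?thesis using lncosh_has_derivative by simp
next
  case (Suc m)
  have "cosh x \<noteq> 0" by simp
  from tanh_tower_derivative[OF _ this, of m] show ?thesis
    using Suc assms by (simp add: lncosh_tower_def)
qed

lemma tanh_sq_le_1: "tanh (x::real) ^ 2 \<le> 1"
  by (metis abs_square_le_1 abs_le_iff less_eq_real_def minus_less_iff tanh_real_bounds greaterThanLessThan_iff)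

text \<open>The sixth derivative controls the mixed remainder of order three in each variable of \<open>lncosh (s + s')\<close>.\<close>

lemma lncosh_tower_6_bound: "\<bar>lncosh_tower 6 x\<bar> \<le> 16"
proof -
  define s where "s = tanh x ^ 2"
  have s: "0 \<le> s" "s \<le> 1"
    by (auto simp: s_def tanh_sq_le_1)
  have eq: "lncosh_tower 6 x = (16 - 120 * s + 120 * s\<^sup>2) * (1 - s)"
    unfolding s_def lncosh_tower_simps by algebra
  have "s * (1 - s) \<ge> 0" using s by simp
  hence up: "16 - 120 * s + 120 * s\<^sup>2 \<le> 16"
    by (simp add: power2_eq_square algebra_simps)
  have "(s - 1/2)\<^sup>2 \<ge> 0" by simp
  hence lo: "16 - 120 * s + 120 * s\<^sup>2 \<ge> - 16"
    by (simp add: power2_eq_square algebra_simps)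
  have "\<bar>(16 - 120 * s + 120 * s\<^sup>2) * (1 - s)\<bar> \<le> 16 * 1"
    unfolding abs_mult using up lo s by (intro mult_mono) auto
  thus ?thesis unfolding eq by simp
qed

lemma tanh_le_self: "0 \<le> x \<Longrightarrow> tanh x \<le> (x::real)"
proof -
  assume "0 \<le> x"
  have "(\<lambda>x. x - tanh x) 0 \<le> (\<lambda>x. x - tanh x) x"
    by (rule DERIV_nonneg_imp_nondecreasing[OF \<open>0 \<le> x\<close>])
      (auto intro!: derivative_eq_intros)
  thus ?thesis by simp
qed

lemma abs_tanh_le: "\<bar>tanh x\<bar> \<le> \<bar>x :: real\<bar>"
  using tanh_le_self[of x] tanh_le_self[of "- x"] tanh_real_nonneg_iff[of x] tanh_real_nonpos_iff[of x]
  by (cases "x \<ge> 0") auto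

lemma lncosh_lipschitz: "\<bar>lncosh x - lncosh y\<bar> \<le> \<bar>x - y\<bar>"
proof -
  have "norm (lncosh x - lncosh y) \<le> 1 * norm (x - y)"
    by (rule field_differentiable_bound[where S = UNIV and f' = tanh])
      (auto intro: DERIV_subset[OF lncosh_has_derivative] simp: abs_le_iff less_imp_le
        tanh_real_gt_neg1 less_imp_le[OF tanh_real_lt_1] minus_le_iff)
  thus ?thesis by simp
qed

text \<open>Near the origin the fourth derivative is close to \<open>-2\<close>. This sign is the reason why two-point laws win.\<close>

lemma lncosh_tower_4_le:
  assumes "\<bar>x\<bar> \<le> 3/10"
  shows "lncosh_tower 4 x \<le> - 1"
proof -
  have "\<bar>tanh x\<bar> \<le> 3/10" using abs_tanh_le[of x] assms by linarith
  hence "tanh x ^ 2 \<le> (3/10)^2" by (metis abs_le_square_iff abs_of_nonneg divide_nonneg_nonneg zero_le_numeral)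
  moreover have "(3/10)^2 = (9/100::real)" by (simp add: power2_eq_square)
  moreover have "tanh x ^ 4 \<ge> 0" by simp
  ultimately show ?thesis unfolding lncosh_tower_simps by linarith
qed

lemma lncosh_even: "lncosh (- x) = lncosh x"
  by (simp add: lncosh_def)

text \<open>Away from the origin a fixed amount separates \<open>lncosh\<close> from the parabola. At \<open>1/4\<close> it is a Taylor expansion of order
four, since \<open>(1/4)\<^sup>4 / 24 = 1/6144\<close>, and \<open>u\<^sup>2/2 - lncosh u\<close> increases in \<open>\<bar>u\<bar>\<close>.\<close>

lemma lncosh_gap:
  assumes "1/4 \<le> \<bar>u\<bar>"
  shows "lncosh u \<le> u\<^sup>2 / 2 - 1 / 6144"
proof -
  have "\<exists>t>0. t < 1/4 \<and> lncosh (1/4) =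
     (\<Sum>m<4. lncosh_tower m 0 / fact m * (1/4) ^ m) + lncosh_tower 4 t / fact 4 * (1/4) ^ 4"
    by (rule Maclaurin) (auto intro!: lncosh_tower_derivative simp del: lncosh_tower_simps(2-))
  then obtain t where t: "0 < t" "t < 1/4" and eq: "lncosh (1/4) =
     (\<Sum>m<4. lncosh_tower m 0 / fact m * (1/4) ^ m) + lncosh_tower 4 t / fact 4 * (1/4) ^ 4"
    by blast
  have s: "(\<Sum>m<4. lncosh_tower m 0 / fact m * (1/4) ^ m) = 1/32"
    by (simp add: numeral_eq_Suc lncosh_def lncosh_tower_def tanh_tower_def)
  have "lncosh_tower 4 t \<le> - 1"
    using t by (intro lncosh_tower_4_le) auto
  hence base: "lncosh (1/4) \<le> (1/4)^2/2 - 1/6144"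
    using eq unfolding s by (simp add: fact_numeral power_divide del: lncosh_tower_simps)
  define v where "v = \<bar>u\<bar>"
  have v: "1/4 \<le> v" using assms by (simp add: v_def)
  have "(\<lambda>x. x^2/2 - lncosh x) (1/4) \<le> (\<lambda>x. x^2/2 - lncosh x) v"
  proof (rule DERIV_nonneg_imp_nondecreasing[OF v])
    fix x :: real assume "1/4 \<le> x" "x \<le> v"
    have "((\<lambda>x. x^2/2 - lncosh x) has_real_derivative x - tanh x) (at x)"
      by (auto intro!: derivative_eq_intros lncosh_has_derivative)
    thus "\<exists>y. ((\<lambda>x. x^2/2 - lncosh x) has_real_derivative y) (at x) \<and> 0 \<le> y"
      using tanh_le_self[of x] \<open>1/4 \<le> x\<close> by force
  qed
  hence "lncosh v \<le> v^2/2 - 1/6144" using base by simp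
  thus ?thesis by (cases "u \<ge> 0") (auto simp: v_def lncosh_even)
qed

section \<open>Interpolation errors\<close>

text \<open>The zeros of the derivative are found outside \<open>Z\<close>. Double zeros of \<open>f\<close> lie in \<open>Z\<close>, so they can be added to the new
zeros without being counted twice.\<close>

lemma rolle_finite_zeros:
  fixes f f' :: "real \<Rightarrow> real"
  assumes "\<And>x. (f has_real_derivative f' x) (at x)"
  shows "finite Z \<Longrightarrow> card Z = Suc n \<Longrightarrow> Z \<subseteq> {l..r} \<Longrightarrow> (\<And>z. z \<in> Z \<Longrightarrow> f z = 0) \<Longrightarrow>
    \<exists>Z'. finite Z' \<and> card Z' = n \<and> Z' \<inter> Z = {} \<and> Z' \<subseteq> {l..r} \<and> (\<forall>z\<in>Z'. f' z = 0)"
proof (induction n arbitrary: Z r)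
  case 0
  then show ?case by (intro exI[of _ "{}"]) auto
next
  case (Suc n)
  define m where "m = Max Z"
  define Z0 where "Z0 = Z - {m}"
  have ne: "Z \<noteq> {}" using Suc.prems by auto
  have mZ: "m \<in> Z" unfolding m_def using Suc.prems ne by auto
  have Z0: "finite Z0" "card Z0 = Suc n" "Z = insert m Z0" "m \<notin> Z0"
    using Suc.prems mZ by (auto simp: Z0_def)
  have ne0: "Z0 \<noteq> {}" using Z0 by auto
  define M where "M = Max Z0"
  have M: "M \<in> Z0" unfolding M_def using Z0 ne0 by auto
  have le_m: "z \<le> m" if "z \<in> Z" for z using that Suc.prems by (simp add: m_def)
  have le_M: "z \<le> M" if "z \<in> Z0" for z using that Z0 by (simp add: M_def)
  have Mm: "M < m" using M Z0 le_m[of M] by (metis insert_iff order_le_less)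
  have "Z0 \<subseteq> {l..M}" using Suc.prems(3) Z0 le_M by auto
  from Suc.IH[OF Z0(1,2) this] obtain Z' where Z': "finite Z'" "card Z' = n" "Z' \<inter> Z0 = {}"
    "Z' \<subseteq> {l..M}" "\<forall>z\<in>Z'. f' z = 0" using Suc.prems(4) Z0 by auto
  have "\<exists>z. M < z \<and> z < m \<and> f' z = 0"
  proof -
    have "continuous_on {M..m} f"
      using assms by (meson DERIV_isCont continuous_at_imp_continuous_on)
    moreover have "f M = f m" using Suc.prems(4) M mZ Z0 by auto
    ultimately obtain z where "M < z" "z < m" "(\<lambda>h. f' z * h) = (\<lambda>v. 0)"
      using Rolle_deriv[OF Mm, of f "\<lambda>x h. f' x * h"] assms
      by (auto simp: has_field_derivative_def)
    thus ?thesis by (metis mult.right_neutral)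
  qed
  then obtain z where z: "M < z" "z < m" "f' z = 0" by blast
  show ?case
  proof (intro exI[of _ "insert z Z'"] conjI)
    show "card (insert z Z') = Suc n" using Z' z by (subst card_insert_disjoint) auto
    show "insert z Z' \<inter> Z = {}" using Z' z Z0 le_M Mm by force
    show "insert z Z' \<subseteq> {l..r}" using Z' z Suc.prems(3) M mZ Z0 by force
  qed (use Z' z in auto)
qed

text \<open>Subtract the multiple of \<open>(s - a)\<^sup>2 (s - b)\<close> that makes the function vanish at \<open>u\<close> too, and apply Rolle's theorem three
times; the double zero at \<open>a\<close> supplies one more zero of the first derivative.\<close>

lemma hermite_error_3:
  fixes f0 f1 f2 f3 :: "real \<Rightarrow> real"
  assumes d0: "\<And>x. (f0 has_real_derivative f1 x) (at x)"
    and d1: "\<And>x. (f1 has_real_derivative f2 x) (at x)"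
    and d2: "\<And>x. (f2 has_real_derivative f3 x) (at x)"
    and ab: "a \<noteq> b" and z: "f0 a = 0" "f1 a = 0" "f0 b = 0"
  shows "\<exists>\<xi>. f0 u = f3 \<xi> / 6 * ((u - a)\<^sup>2 * (u - b))"
proof (cases "u = a \<or> u = b")
  case True
  then show ?thesis using z by auto
next
  case False
  define K where "K = f0 u / ((u - a)\<^sup>2 * (u - b))"
  define l where "l = min u (min a b)"
  define r where "r = max u (max a b)"
  define g0 where "g0 s = f0 s - K * ((s - a)\<^sup>2 * (s - b))" for s
  define g1 where "g1 s = f1 s - K * (2 * (s - a) * (s - b) + (s - a)\<^sup>2)" for s
  define g2 where "g2 s = f2 s - K * (2 * (s - b) + 4 * (s - a))" for s
  define g3 where "g3 s = f3 s - K * 6" for s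
  have e0: "(g0 has_real_derivative g1 x) (at x)" for x
    unfolding g0_def g1_def by (auto intro!: derivative_eq_intros d0 simp: algebra_simps power2_eq_square)
  have e1: "(g1 has_real_derivative g2 x) (at x)" for x
    unfolding g1_def g2_def by (auto intro!: derivative_eq_intros d1 simp: algebra_simps)
  have e2: "(g2 has_real_derivative g3 x) (at x)" for x
    unfolding g2_def g3_def by (auto intro!: derivative_eq_intros d2 simp: algebra_simps)
  have gu: "g0 u = 0" using False by (simp add: g0_def K_def)
  have "card {u, a, b} = Suc 2" using False ab by auto
  from rolle_finite_zeros[OF e0 _ this, of l r] obtain Z1 where Z1:
    "finite Z1" "card Z1 = 2" "Z1 \<inter> {u, a, b} = {}" "Z1 \<subseteq> {l..r}" "\<forall>z\<in>Z1. g1 z = 0"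
    using gu z by (force simp: l_def r_def g0_def)
  have "card (insert a Z1) = Suc 2" using Z1 by (subst card_insert_disjoint) auto
  from rolle_finite_zeros[OF e1 _ this, of l r] obtain Z2 where Z2:
    "finite Z2" "card Z2 = 2" "Z2 \<subseteq> {l..r}" "\<forall>z\<in>Z2. g2 z = 0"
    using Z1 z by (force simp: l_def r_def g1_def)
  have "card Z2 = Suc 1" using Z2 by simp
  from rolle_finite_zeros[OF e2 Z2(1) this, of l r] obtain Z3 where Z3:
    "finite Z3" "card Z3 = 1" "\<forall>z\<in>Z3. g3 z = 0"
    using Z2 by auto
  then obtain \<xi> where "g3 \<xi> = 0" by (metis card_1_singletonE insertI1)
  hence "f3 \<xi> / 6 = K" by (simp add: g3_def)
  thus ?thesis using False by (intro exI[of _ \<xi>]) (simp add: K_def)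
qed

lemma hermite_error_4:
  fixes f0 f1 f2 f3 f4 :: "real \<Rightarrow> real"
  assumes d0: "\<And>x. (f0 has_real_derivative f1 x) (at x)"
    and d1: "\<And>x. (f1 has_real_derivative f2 x) (at x)"
    and d2: "\<And>x. (f2 has_real_derivative f3 x) (at x)"
    and d3: "\<And>x. (f3 has_real_derivative f4 x) (at x)"
    and ab: "a \<noteq> b" and z: "f0 a = 0" "f1 a = 0" "f0 b = 0" "f1 b = 0"
    and lr: "{a, b, u} \<subseteq> {l..r}"
  shows "\<exists>\<xi>\<in>{l..r}. f0 u = f4 \<xi> / 24 * ((u - a)\<^sup>2 * (u - b)\<^sup>2)"
proof (cases "u = a \<or> u = b")
  case True
  then show ?thesis using z lr by auto
next
  case False
  define K where "K = f0 u / ((u - a)\<^sup>2 * (u - b)\<^sup>2)"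
  define g0 where "g0 s = f0 s - K * ((s - a)\<^sup>2 * (s - b)\<^sup>2)" for s
  define g1 where "g1 s = f1 s - K * (2 * (s - a) * (s - b)\<^sup>2 + 2 * (s - a)\<^sup>2 * (s - b))" for s
  define g2 where "g2 s = f2 s - K * (2 * (s - b)\<^sup>2 + 8 * (s - a) * (s - b) + 2 * (s - a)\<^sup>2)" for s
  define g3 where "g3 s = f3 s - K * (12 * (s - b) + 12 * (s - a))" for s
  define g4 where "g4 s = f4 s - K * 24" for s
  have e0: "(g0 has_real_derivative g1 x) (at x)" for x
    unfolding g0_def g1_def by (auto intro!: derivative_eq_intros d0 simp: algebra_simps power2_eq_square)
  have e1: "(g1 has_real_derivative g2 x) (at x)" for x
    unfolding g1_def g2_def by (auto intro!: derivative_eq_intros d1 simp: algebra_simps power2_eq_square)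
  have e2: "(g2 has_real_derivative g3 x) (at x)" for x
    unfolding g2_def g3_def by (auto intro!: derivative_eq_intros d2 simp: algebra_simps)
  have e3: "(g3 has_real_derivative g4 x) (at x)" for x
    unfolding g3_def g4_def by (auto intro!: derivative_eq_intros d3 simp: algebra_simps)
  have gu: "g0 u = 0" using False by (simp add: g0_def K_def)
  have "card {u, a, b} = Suc 2" using False ab by auto
  from rolle_finite_zeros[OF e0 _ this, of l r] obtain Z1 where Z1:
    "finite Z1" "card Z1 = 2" "Z1 \<inter> {u, a, b} = {}" "Z1 \<subseteq> {l..r}" "\<forall>z\<in>Z1. g1 z = 0"
    using gu z lr by (force simp: g0_def)
  have "card (insert a (insert b Z1)) = Suc 3"
    using Z1 ab by (subst card_insert_disjoint; simp)+
  from rolle_finite_zeros[OF e1 _ this, of l r] obtain Z2 where Z2: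
    "finite Z2" "card Z2 = Suc 2" "Z2 \<subseteq> {l..r}" "\<forall>z\<in>Z2. g2 z = 0"
    using Z1 z lr by (force simp: g1_def)
  from rolle_finite_zeros[OF e2 Z2(1,2), of l r] obtain Z3 where Z3:
    "finite Z3" "card Z3 = Suc 1" "Z3 \<subseteq> {l..r}" "\<forall>z\<in>Z3. g3 z = 0"
    using Z2 by auto
  from rolle_finite_zeros[OF e3 Z3(1,2), of l r] obtain Z4 where Z4:
    "finite Z4" "card Z4 = 1" "Z4 \<subseteq> {l..r}" "\<forall>z\<in>Z4. g4 z = 0"
    using Z3 by auto
  then obtain \<xi> where "g4 \<xi> = 0" "\<xi> \<in> {l..r}" by (metis card_1_singletonE insertI1 subsetD)
  hence "f4 \<xi> / 24 = K" by (simp add: g4_def)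
  thus ?thesis using False \<open>\<xi> \<in> {l..r}\<close> by (intro bexI[of _ \<xi>]) (simp_all add: K_def)
qed

text \<open>The quadratic polynomial with value \<open>v\<close> and slope \<open>d\<close> at \<open>a\<close> and value \<open>w\<close> at \<open>b\<close>.\<close>

definition hermite_interp :: "real \<Rightarrow> real \<Rightarrow> real \<Rightarrow> real \<Rightarrow> real \<Rightarrow> real \<Rightarrow> real" where
  "hermite_interp a b v d w s = v + d * (s - a) + (w - v - d * (b - a)) / (b - a)\<^sup>2 * (s - a)\<^sup>2"

lemma hermite_interp_at_nodes:
  assumes "a \<noteq> b"
  shows "hermite_interp a b v d w a = v" "hermite_interp a b v d w b = w"
  using assms by (auto simp: hermite_interp_def)

lemma hermite_interp_derivative:
  "(hermite_interp a b v d w has_real_derivative d + 2 * ((w - v - d * (b - a)) / (b - a)\<^sup>2) * (s - a)) (at s)"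
  unfolding hermite_interp_def by (rule derivative_eq_intros refl)+ (simp add: algebra_simps)

lemma hermite_interp_error:
  fixes f0 f1 f2 f3 :: "real \<Rightarrow> real"
  assumes d0: "\<And>x. (f0 has_real_derivative f1 x) (at x)"
    and d1: "\<And>x. (f1 has_real_derivative f2 x) (at x)"
    and d2: "\<And>x. (f2 has_real_derivative f3 x) (at x)"
    and ab: "a \<noteq> b" and M: "\<And>x. \<bar>f3 x\<bar> \<le> M"
  shows "\<bar>f0 u - hermite_interp a b (f0 a) (f1 a) (f0 b) u\<bar> \<le> M / 6 * ((u - a)\<^sup>2 * \<bar>u - b\<bar>)"
proof -
  define q where "q = (f0 b - f0 a - f1 a * (b - a)) / (b - a)\<^sup>2"
  have "\<exists>\<xi>. f0 u - hermite_interp a b (f0 a) (f1 a) (f0 b) u = f3 \<xi> / 6 * ((u - a)\<^sup>2 * (u - b))"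
  proof (rule hermite_error_3[where ?f1.0 = "\<lambda>s. f1 s - (f1 a + 2 * q * (s - a))" 
        and ?f2.0 = "\<lambda>s. f2 s - 2 * q"])
    show "((\<lambda>u. f0 u - hermite_interp a b (f0 a) (f1 a) (f0 b) u) has_real_derivative
          f1 x - (f1 a + 2 * q * (x - a))) (at x)" for x
      unfolding q_def by (intro DERIV_diff d0 hermite_interp_derivative)
  qed (use ab in \<open>auto intro!: derivative_eq_intros d1 d2 simp: hermite_interp_at_nodes\<close>)
  then obtain \<xi> where "f0 u - hermite_interp a b (f0 a) (f1 a) (f0 b) u = f3 \<xi> / 6 * ((u - a)\<^sup>2 * (u - b))"
    by blast
  thus ?thesis using M[of \<xi>]
    by (auto simp: abs_mult simp del: times_divide_eq_left intro!: mult_right_mono divide_right_mono)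
qed

section \<open>The two-point law maximises the expectation of ln cosh\<close>

text \<open>The average of \<open>f (u + q)\<close> over the law with mass \<open>c\<close> at \<open>q1\<close> and \<open>1 - c\<close> at \<open>q2\<close>.\<close>

definition mixture :: "real \<Rightarrow> real \<Rightarrow> real \<Rightarrow> (real \<Rightarrow> real) \<Rightarrow> real \<Rightarrow> real" where
  "mixture c q1 q2 f u = c * f (u + q1) + (1 - c) * f (u + q2)"

lemma mixture_derivative:
  assumes "\<And>x. (f has_real_derivative f' x) (at x)"
  shows "(mixture c q1 q2 f has_real_derivative mixture c q1 q2 f' u) (at u)"
proof -
  have "((\<lambda>u. f (u + q)) has_real_derivative f' (u + q)) (at u)" for q
    using assms[of "u + q"] by (simp add: DERIV_shift)
  thus ?thesis unfolding mixture_def by (auto intro!: derivative_eq_intros)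
qed

lemma mixture_le:
  assumes "0 \<le> c" "c \<le> 1" "f (u + q1) \<le> K" "f (u + q2) \<le> K"
  shows "mixture c q1 q2 f u \<le> K"
proof -
  have "c * f (u + q1) \<le> c * K" "(1 - c) * f (u + q2) \<le> (1 - c) * K"
    using assms by (auto intro!: mult_left_mono)
  thus ?thesis by (simp add: mixture_def algebra_simps)
qed

lemma mixture_ge:
  assumes "0 \<le> c" "c \<le> 1" "K \<le> f (u + q1)" "K \<le> f (u + q2)"
  shows "K \<le> mixture c q1 q2 f u"
proof -
  have "c * K \<le> c * f (u + q1)" "(1 - c) * K \<le> (1 - c) * f (u + q2)"
    using assms by (auto intro!: mult_left_mono)
  thus ?thesis by (simp add: mixture_def algebra_simps)
qed

text \<open>A quadratic polynomial with the values of \<open>h = mixture c q1 q2 lncosh\<close> at both atoms and its slope at \<open>q1\<close> also has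
its slope at \<open>q2\<close>. This expresses that the two-point law is stationary among the laws with the same first two
moments.\<close>

definition double_contact :: "real \<Rightarrow> real \<Rightarrow> real \<Rightarrow> bool" where
  "double_contact c q1 q2 \<longleftrightarrow>
     (mixture c q1 q2 tanh q1 + mixture c q1 q2 tanh q2) * (q2 - q1)
       = 2 * (mixture c q1 q2 lncosh q2 - mixture c q1 q2 lncosh q1)"

text \<open>Close to the atoms the Hermite remainder of order four applies, and the fourth derivative is negative. Further out the
fourth derivative changes sign, but there \<open>h\<close> is within \<open>O(q)\<close> of \<open>lncosh\<close> and the polynomial within \<open>O(q)\<close> of
\<open>u\<^sup>2/2\<close>, so that \<open>lncosh_gap\<close> decides; atoms of size \<open>1/100000\<close> keep these errors below \<open>1/6144\<close>. The range \<open>3/2\<close> for \<open>u\<close>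
suffices because a degree differs from \<open>1/2\<close> by at most \<open>1/2\<close> and is stretched by at most \<open>5/2\<close>.\<close>

lemma double_contact_gap:
  fixes q1 q2 c :: real
  assumes q: "q1 < q2" "\<bar>q1\<bar> \<le> 1/100000" "\<bar>q2\<bar> \<le> 1/100000" and c: "0 \<le> c" "c \<le> 1"
    and contact: "double_contact c q1 q2" and u: "\<bar>u\<bar> \<le> 3/2"
  defines "h \<equiv> mixture c q1 q2 lncosh"
  shows "h u \<le> hermite_interp q1 q2 (h q1) (mixture c q1 q2 tanh q1) (h q2) u
               - 1/100000 * ((u - q1)\<^sup>2 * (u - q2)\<^sup>2)"
proof -
  define h1 where "h1 = mixture c q1 q2 tanh"
  define h2 where "h2 = mixture c q1 q2 (lncosh_tower 2)"
  define h3 where "h3 = mixture c q1 q2 (lncosh_tower 3)"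
  define h4 where "h4 = mixture c q1 q2 (lncosh_tower 4)"
  \<comment> \<open>The leading coefficient of the interpolating quadratic; it is close to \<open>1/2\<close>.\<close>
  define k where "k = (h q2 - h q1 - h1 q1 * (q2 - q1)) / (q2 - q1)\<^sup>2"
  define r where "r = hermite_interp q1 q2 (h q1) (h1 q1) (h q2)"
  define P where "P = (u - q1)\<^sup>2 * (u - q2)\<^sup>2"
  have d0: "(h has_real_derivative h1 x) (at x)" for x
    unfolding h_def h1_def by (intro mixture_derivative lncosh_has_derivative)
  have d1: "(h1 has_real_derivative h2 x) (at x)" for x
    unfolding h1_def h2_def by (intro mixture_derivative) (use lncosh_tower_derivative[of 1] in \<open>simp add: numeral_2_eq_2[symmetric]\<close>)
  have d2: "(h2 has_real_derivative h3 x) (at x)" for x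
    unfolding h2_def h3_def by (intro mixture_derivative) (use lncosh_tower_derivative[of 2] in simp)
  have d3: "(h3 has_real_derivative h4 x) (at x)" for x
    unfolding h3_def h4_def by (intro mixture_derivative) (use lncosh_tower_derivative[of 3] in simp)
  have dr: "(r has_real_derivative h1 q1 + 2 * k * (x - q1)) (at x)" for x
    unfolding r_def k_def by (rule hermite_interp_derivative)
  have ct: "(h1 q1 + h1 q2) * (q2 - q1) = 2 * (h q2 - h q1)"
    using contact by (simp add: double_contact_def h_def h1_def)
  have k2: "h1 q2 = h1 q1 + 2 * k * (q2 - q1)"
  proof -
    define D where "D = q2 - q1"
    have "D \<noteq> 0" using q by (simp add: D_def)
    hence "2 * k * D = 2 * (h q2 - h q1 - h1 q1 * D) / D"
      unfolding k_def D_def[symmetric] by (simp add: power2_eq_square)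
    hence "2 * k * (q2 - q1) = (2 * (h q2 - h q1) - 2 * h1 q1 * (q2 - q1)) / (q2 - q1)"
      by (simp add: D_def algebra_simps)
    also have "\<dots> = (h1 q2 - h1 q1) * (q2 - q1) / (q2 - q1)"
      unfolding ct[symmetric] by (simp add: algebra_simps)
    finally show ?thesis using q by simp
  qed
  have rnode: "r q1 = h q1" "r q2 = h q2"
    unfolding r_def using q by (simp_all add: hermite_interp_at_nodes)
  show ?thesis
  proof (cases "\<bar>u\<bar> \<le> 1/4")
    case True
    have "\<exists>\<xi>\<in>{-26/100..26/100}. h u - r u = h4 \<xi> / 24 * ((u - q1)\<^sup>2 * (u - q2)\<^sup>2)"
    proof (rule hermite_error_4[where ?f1.0 = "\<lambda>x. h1 x - (h1 q1 + 2 * k * (x - q1))"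
          and ?f2.0 = "\<lambda>x. h2 x - 2 * k" and ?f3.0 = h3])
      show "((\<lambda>u. h u - r u) has_real_derivative h1 x - (h1 q1 + 2 * k * (x - q1))) (at x)" for x
        by (intro DERIV_diff d0 dr)
      show "((\<lambda>x. h1 x - (h1 q1 + 2 * k * (x - q1))) has_real_derivative h2 x - 2 * k) (at x)" for x
        by (auto intro!: derivative_eq_intros d1)
      show "((\<lambda>x. h2 x - 2 * k) has_real_derivative h3 x) (at x)" for x
        by (auto intro!: derivative_eq_intros d2)
      show "{q1, q2, u} \<subseteq> {-26/100..26/100}" using q True by auto
    qed (use q k2 d3 rnode in auto)
    then obtain \<xi> where \<xi>: "\<xi> \<in> {-26/100..26/100}" "h u - r u = h4 \<xi> / 24 * P"
      unfolding P_def by blast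
    have "\<bar>\<xi> + q\<bar> \<le> 3/10" if "\<bar>q\<bar> \<le> 1/100000" for q
      using \<xi>(1) that unfolding atLeastAtMost_iff by linarith
    hence "h4 \<xi> \<le> - 1"
      unfolding h4_def using q by (intro mixture_le c lncosh_tower_4_le)
    hence "h4 \<xi> / 24 * P \<le> - (1/100000) * P"
      by (intro mult_right_mono) (auto simp: P_def)
    thus ?thesis using \<xi>(2) unfolding P_def r_def h1_def by linarith
  next
    case False
    have h_u: "h u \<le> lncosh u + 1/100000"
    proof -
      have "lncosh (u + q) \<le> lncosh u + 1/100000" if "\<bar>q\<bar> \<le> 1/100000" for q
        using lncosh_lipschitz[of "u + q" u] that by auto
      thus ?thesis unfolding h_def using q by (intro mixture_le c) auto
    qed
    have h_q: "0 \<le> h q1"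
      unfolding h_def by (intro mixture_ge c) (auto simp: lncosh_def cosh_real_ge_1)
    have h1_q: "\<bar>h1 q1\<bar> \<le> 2/100000"
    proof -
      have "\<bar>tanh (q1 + q)\<bar> \<le> 2/100000" if "\<bar>q\<bar> \<le> 1/100000" for q
        using abs_tanh_le[of "q1 + q"] that q by linarith
      note * = this[OF q(2)] this[OF q(3)]
      have "h1 q1 \<le> 2/100000" unfolding h1_def using * by (intro mixture_le c) linarith+
      moreover have "- (2/100000) \<le> h1 q1" unfolding h1_def using * by (intro mixture_ge c) linarith+
      ultimately show ?thesis by linarith
    qed
    have k_ge: "k \<ge> 1/2 - 1/10^9"
    proof -
      obtain z where z: "q1 < z" "z < q2" "h1 q2 - h1 q1 = (q2 - q1) * h2 z"
        using MVT2[OF q(1), of h1 h2] d1 by blast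
      hence "2 * k * (q2 - q1) = h2 z * (q2 - q1)" using k2 by simp
      hence "2 * k = h2 z" using q by simp
      moreover have "h2 z \<ge> 1 - 4/10^10"
      proof -
        have "1 - 4/10^10 \<le> lncosh_tower 2 (z + q)" if "\<bar>q\<bar> \<le> 1/100000" for q
        proof -
          have "\<bar>tanh (z + q)\<bar> \<le> 2/100000"
            using abs_tanh_le[of "z + q"] z q that by linarith
          hence "tanh (z + q) ^ 2 \<le> (2/100000) ^ 2"
            by (metis abs_le_square_iff abs_of_nonneg divide_nonneg_nonneg zero_le_numeral)
          thus ?thesis by (simp add: power_divide)
        qed
        thus ?thesis unfolding h2_def using q by (intro mixture_ge c) auto
      qed
      ultimately show ?thesis by simp
    qed
    have uq: "\<bar>u - q1\<bar> \<le> 151/100" "\<bar>u - q2\<bar> \<le> 151/100" using u q by linarith+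
    have P_le: "P \<le> 6"
    proof -
      have "(u - q1)\<^sup>2 \<le> (151/100)\<^sup>2" "(u - q2)\<^sup>2 \<le> (151/100)\<^sup>2"
        using uq by (metis abs_le_square_iff abs_of_nonneg divide_nonneg_nonneg zero_le_numeral)+
      hence "P \<le> (151/100)\<^sup>2 * (151/100)\<^sup>2" unfolding P_def by (intro mult_mono) auto
      thus ?thesis by (simp add: power2_eq_square)
    qed
    have lin: "\<bar>h1 q1 * (u - q1)\<bar> \<le> 2/100000 * (151/100)"
      unfolding abs_mult using h1_q uq by (intro mult_mono) auto
    have sq: "(u - q1)\<^sup>2 \<ge> u\<^sup>2 - 3/100000"
    proof -
      have "\<bar>u * q1\<bar> \<le> 3/2 * (1/100000)"
        unfolding abs_mult using u q by (intro mult_mono) auto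
      moreover have "(u - q1)\<^sup>2 = u\<^sup>2 - 2 * (u * q1) + q1\<^sup>2" by (simp add: power2_eq_square algebra_simps)
      moreover have "q1\<^sup>2 \<ge> 0" by simp
      ultimately show ?thesis by linarith
    qed
    have sq_le: "(u - q1)\<^sup>2 \<le> 3"
    proof -
      have "(u - q1)\<^sup>2 \<le> (151/100)\<^sup>2"
        using uq by (metis abs_le_square_iff abs_of_nonneg divide_nonneg_nonneg zero_le_numeral)
      thus ?thesis by (simp add: power2_eq_square)
    qed
    have quad: "k * (u - q1)\<^sup>2 \<ge> u\<^sup>2 / 2 - 2/100000"
    proof -
      have "k * (u - q1)\<^sup>2 \<ge> (1/2 - 1/10^9) * (u - q1)\<^sup>2"
        using k_ge by (intro mult_right_mono) auto
      moreover have "(1/2 - 1/10^9) * (u - q1)\<^sup>2 = (u - q1)\<^sup>2 / 2 - 1/10^9 * (u - q1)\<^sup>2"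
        by (simp add: algebra_simps)
      ultimately show ?thesis using sq sq_le by simp
    qed
    have "r u = h q1 + h1 q1 * (u - q1) + k * (u - q1)\<^sup>2"
      by (simp add: r_def hermite_interp_def k_def)
    hence "r u \<ge> u\<^sup>2 / 2 - 6/100000" using h_q lin quad by linarith
    moreover have "lncosh u \<le> u\<^sup>2 / 2 - 1 / 6144" using False by (intro lncosh_gap) auto
    ultimately have "h u \<le> r u - 1/100000 * P" using h_u P_le by simp
    thus ?thesis unfolding P_def r_def h1_def .
  qed
qed


lemma shifted_tower_derivative:
  assumes "n < 6"
  shows "((\<lambda>s. lncosh_tower n (s + q)) has_real_derivative lncosh_tower (Suc n) (s + q)) (at s)"
  using lncosh_tower_derivative[OF assms, of "s + q"] by (simp add: DERIV_shift)

lemma shifted_tower_derivative':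
  assumes "n < 6"
  shows "((\<lambda>s. lncosh_tower n (q + s)) has_real_derivative lncosh_tower (Suc n) (q + s)) (at s)"
  using shifted_tower_derivative[OF assms, of q s] by (simp only: add.commute)

text \<open>Interpolation is linear in the data, hence commutes with differentiation in a parameter.\<close>

lemma hermite_interp_derivative_data:
  assumes "(v has_real_derivative v') (at x)" "(d has_real_derivative d') (at x)"
    "(w has_real_derivative w') (at x)"
  shows "((\<lambda>x. hermite_interp a b (v x) (d x) (w x) s) has_real_derivative hermite_interp a b v' d' w' s) (at x)"
proof -
  define k where "k = inverse ((b - a)\<^sup>2) * (s - a)\<^sup>2"
  have eq: "hermite_interp a b p q r s = p * (1 - k) + q * (s - a - (b - a) * k) + r * k" for p q r
    by (simp add: hermite_interp_def k_def divide_inverse algebra_simps)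
  show ?thesis unfolding eq by (intro DERIV_add DERIV_cmult_right assms)
qed

text \<open>The interpolation error in the second variable of the \<open>n\<close>-th derivative of \<open>lncosh\<close> at \<open>s + s'\<close>. Its derivative in \<open>s\<close>
is the residual with \<open>Suc n\<close>, which allows the same interpolation to be repeated in the first variable.\<close>

definition row_residual :: "real \<Rightarrow> real \<Rightarrow> nat \<Rightarrow> real \<Rightarrow> real \<Rightarrow> real" where
  "row_residual a b n s s' = lncosh_tower n (s + s') -
     hermite_interp a b (lncosh_tower n (s + a)) (lncosh_tower (Suc n) (s + a)) (lncosh_tower n (s + b)) s'"

lemma row_residual_derivative:
  assumes "n < 5"
  shows "((\<lambda>s. row_residual a b n s s') has_real_derivative row_residual a b (Suc n) s s') (at s)"
proof -
  have "n < 6" "Suc n < 6" using assms by auto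
  note D = this[THEN shifted_tower_derivative] \<open>n < 6\<close>[THEN shifted_tower_derivative, of s']
  show ?thesis
    unfolding row_residual_def by (intro DERIV_diff D hermite_interp_derivative_data)
qed

lemma row_residual_3_bound:
  assumes "a \<noteq> b"
  shows "\<bar>row_residual a b 3 s s'\<bar> \<le> 16 / 6 * ((s' - a)\<^sup>2 * \<bar>s' - b\<bar>)"
proof -
  have "\<bar>lncosh_tower 3 (s + s') - hermite_interp a b (lncosh_tower 3 (s + a)) (lncosh_tower 4 (s + a))
           (lncosh_tower 3 (s + b)) s'\<bar> \<le> 16 / 6 * ((s' - a)\<^sup>2 * \<bar>s' - b\<bar>)"
    by (rule hermite_interp_error[where ?f2.0 = "\<lambda>x. lncosh_tower 5 (s + x)" and ?f3.0 = "\<lambda>x. lncosh_tower 6 (s + x)"])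
      (use assms shifted_tower_derivative'[of 3 s] shifted_tower_derivative'[of 4 s]
        shifted_tower_derivative'[of 5 s] lncosh_tower_6_bound in 
        \<open>simp_all del: lncosh_tower_simps\<close>)
  thus ?thesis by (simp add: row_residual_def del: lncosh_tower_simps)
qed

text \<open>If a signed measure annihilates quadratic polynomials, its product with itself gives \<open>lncosh (s + s')\<close> and this
residual the same integral.\<close>

definition cross_residual :: "real \<Rightarrow> real \<Rightarrow> real \<Rightarrow> real \<Rightarrow> real" where
  "cross_residual a b s s' = row_residual a b 0 s s' -
     hermite_interp a b (row_residual a b 0 a s') (row_residual a b 1 a s') (row_residual a b 0 b s') s"

lemma cross_residual_bound:
  assumes "a \<noteq> b"
  shows "\<bar>cross_residual a b s s'\<bar> \<le> 4 / 9 * (((s - a)\<^sup>2 * \<bar>s - b\<bar>) * ((s' - a)\<^sup>2 * \<bar>s' - b\<bar>))"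
proof -
  have "\<bar>row_residual a b 0 s s' - hermite_interp a b (row_residual a b 0 a s') (row_residual a b 1 a s')
          (row_residual a b 0 b s') s\<bar> \<le> (16 / 6 * ((s' - a)\<^sup>2 * \<bar>s' - b\<bar>)) / 6 * ((s - a)\<^sup>2 * \<bar>s - b\<bar>)"
    by (rule hermite_interp_error[where ?f0.0 = "\<lambda>s. row_residual a b 0 s s'" and ?f1.0 = "\<lambda>s. row_residual a b 1 s s'" and ?f2.0 = "\<lambda>s. row_residual a b 2 s s'" and ?f3.0 = "\<lambda>s. row_residual a b 3 s s'"])
      (use assms row_residual_derivative[of 0 a b s'] row_residual_derivative[of 1 a b s']
        row_residual_derivative[of 2 a b s'] row_residual_3_bound in \<open>simp_all add: numeral_2_eq_2[symmetric]\<close>)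
  thus ?thesis unfolding cross_residual_def by (simp add: mult_ac)
qed

text \<open>The arithmetic-geometric mean inequality gives each term one factor that is small on average and one factor
\<open>(s - a)\<^sup>2 (s - b)\<^sup>2\<close>, the quantity gained at first order.\<close>

lemma cross_residual_bound':
  assumes "a \<noteq> b"
  shows "\<bar>cross_residual a b s s'\<bar> \<le> 2 / 9 *
     ((s - a)\<^sup>2 * ((s' - a)\<^sup>2 * (s' - b)\<^sup>2) + (s' - a)\<^sup>2 * ((s - a)\<^sup>2 * (s - b)\<^sup>2))"
proof -
  define x where "x = \<bar>s - a\<bar> * (\<bar>s' - a\<bar> * \<bar>s' - b\<bar>)"
  define y where "y = \<bar>s' - a\<bar> * (\<bar>s - a\<bar> * \<bar>s - b\<bar>)"
  have "0 \<le> (x - y)\<^sup>2" by simp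
  hence "2 * (x * y) \<le> x\<^sup>2 + y\<^sup>2" by (simp add: power2_eq_square algebra_simps)
  moreover have "x * y = ((s - a)\<^sup>2 * \<bar>s - b\<bar>) * ((s' - a)\<^sup>2 * \<bar>s' - b\<bar>)"
  proof -
    have "x * y = (\<bar>s - a\<bar> * \<bar>s - a\<bar>) * \<bar>s - b\<bar> * ((\<bar>s' - a\<bar> * \<bar>s' - a\<bar>) * \<bar>s' - b\<bar>)"
      unfolding x_def y_def by (simp only: mult_ac)
    thus ?thesis by (simp only: abs_mult_self_eq power2_eq_square)
  qed
  moreover have "x\<^sup>2 = (s - a)\<^sup>2 * ((s' - a)\<^sup>2 * (s' - b)\<^sup>2)" "y\<^sup>2 = (s' - a)\<^sup>2 * ((s - a)\<^sup>2 * (s - b)\<^sup>2)"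
    by (simp_all add: x_def y_def power_mult_distrib)
  ultimately show ?thesis using cross_residual_bound[OF assms, of s s'] by simp
qed

lemma (in prob_space) integrable_continuous_bounded:
  fixes X :: "'a \<Rightarrow> real" and f :: "real \<Rightarrow> real"
  assumes "X \<in> borel_measurable M" "\<And>x. x \<in> space M \<Longrightarrow> \<bar>X x\<bar> \<le> B" "continuous_on UNIV f"
  shows "integrable M (\<lambda>x. f (X x))"
proof -
  have "compact (f ` {-B..B})"
    using assms(3) by (intro compact_continuous_image) (auto intro: continuous_on_subset)
  then obtain K where "\<And>y. y \<in> {-B..B} \<Longrightarrow> norm (f y) \<le> K"
    using compact_imp_bounded bounded_iff by (metis imageI)
  hence "\<And>x. x \<in> space M \<Longrightarrow> norm (f (X x)) \<le> K"
    using assms(2) by (force simp: abs_le_iff)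
  moreover have "(\<lambda>x. f (X x)) \<in> borel_measurable M"
    using assms(1,3) by (intro measurable_compose[OF assms(1)] borel_measurable_continuous_onI)
  ultimately show ?thesis by (intro integrable_const_bound[of _ K]) auto
qed

text \<open>With \<open>\<nu>\<close> the two-point law, \<open>h\<close> its mixture and \<open>V\<close>, \<open>V0\<close> the double integrals for the law of \<open>X\<close> and for \<open>\<nu>\<close>,
integration of the cross residual gives \<open>V = V0 + 2 (\<integral> h X - V0) + \<integral>\<integral> cross_residual\<close>: quadratic polynomials have the
same integral under both laws, and the interpolants agree with the function at the atoms. The middle term is
at most \<open>- 2\<close> times the gap in \<open>double_contact_gap\<close>, and the last one is a small multiple of the same integral.\<close>

lemma two_point_law_maximises:
  fixes X :: "'a \<Rightarrow> real" and q1 q2 c :: real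
  assumes "prob_space M" and X: "X \<in> borel_measurable M" "\<And>x. x \<in> space M \<Longrightarrow> \<bar>X x\<bar> \<le> 3/2"
    and m1: "(LINT x|M. X x) = c * q1 + (1 - c) * q2"
    and m2: "(LINT x|M. (X x)\<^sup>2) = c * q1\<^sup>2 + (1 - c) * q2\<^sup>2"
    and q: "q1 < q2" "\<bar>q1\<bar> \<le> 1/100000" "\<bar>q2\<bar> \<le> 1/100000" and c: "0 \<le> c" "c \<le> 1"
    and contact: "double_contact c q1 q2"
  shows "(LINT x|M. LINT y|M. lncosh (X x + X y))
    \<le> c\<^sup>2 * lncosh (2 * q1) + 2 * c * (1 - c) * lncosh (q1 + q2) + (1 - c)\<^sup>2 * lncosh (2 * q2)
      - 1/100000 * (LINT x|M. (X x - q1)\<^sup>2 * (X x - q2)\<^sup>2)"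
proof -
  interpret prob_space M by fact
  note I = integrable_continuous_bounded[OF X]
  have cF [continuous_intros]: "continuous_on UNIV lncosh"
    using lncosh_has_derivative by (meson DERIV_isCont continuous_at_imp_continuous_on)
  have cL: "continuous_on A (\<lambda>x. lncosh (f x))" if "continuous_on A f" for A and f :: "real \<Rightarrow> real"
    using continuous_on_compose2[OF cF that] by auto
  have cT: "continuous_on A (\<lambda>x. tanh (f x))" if "continuous_on A f" for A and f :: "real \<Rightarrow> real"
    using that by (intro continuous_intros) auto
  have I1: "integrable M X" using I[of "\<lambda>x. x"] by simp
  have I2: "integrable M (\<lambda>x. (X x)\<^sup>2)" by (rule I[of "\<lambda>x. x\<^sup>2"]) (auto intro!: continuous_intros)
  have E_quad: "(LINT x|M. u0 + u1 * (X x - q1) + u2 * (X x - q1)\<^sup>2) =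
      u0 + u1 * ((1 - c) * (q2 - q1)) + u2 * ((1 - c) * (q2 - q1)\<^sup>2)" for u0 u1 u2
  proof -
    have "(LINT x|M. u0 + u1 * (X x - q1) + u2 * (X x - q1)\<^sup>2) =
       (LINT x|M. (u0 - u1 * q1 + u2 * q1\<^sup>2) + (u1 - 2 * u2 * q1) * X x + u2 * (X x)\<^sup>2)"
      by (intro Bochner_Integration.integral_cong) (auto simp: power2_eq_square algebra_simps)
    also have "\<dots> = (u0 - u1 * q1 + u2 * q1\<^sup>2) + (u1 - 2 * u2 * q1) * (LINT x|M. X x)
         + u2 * (LINT x|M. (X x)\<^sup>2)"
      using I1 I2 by (simp add: prob_space)
    also have "\<dots> = u0 + u1 * ((1 - c) * (q2 - q1)) + u2 * ((1 - c) * (q2 - q1)\<^sup>2)"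
      unfolding m1 m2 by (simp add: power2_eq_square algebra_simps)
    finally show ?thesis .
  qed
  have E_interp: "(LINT x|M. hermite_interp q1 q2 v d w (X x)) = c * v + (1 - c) * w" for v d w
  proof -
    have "(LINT x|M. hermite_interp q1 q2 v d w (X x)) = v + d * ((1 - c) * (q2 - q1)) +
       (w - v - d * (q2 - q1)) / (q2 - q1)\<^sup>2 * ((1 - c) * (q2 - q1)\<^sup>2)"
      unfolding hermite_interp_def by (rule E_quad)
    also have "\<dots> = v + d * ((1 - c) * (q2 - q1)) + (w - v - d * (q2 - q1)) * (1 - c)"
      using q by (auto simp: mult.commute)
    finally show ?thesis by (simp add: algebra_simps)
  qed
  have I_interp: "integrable M (\<lambda>x. hermite_interp q1 q2 v d w (X x))" for v d w
    by (rule I[of "hermite_interp q1 q2 v d w"]) (auto simp: hermite_interp_def[abs_def] divide_inverse intro!: continuous_intros)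
  define h where "h = mixture c q1 q2 lncosh"
  define U where "U s = (LINT y|M. lncosh (s + X y))" for s
  define V where "V = (LINT x|M. U (X x))"
  define V0 where "V0 = c * h q1 + (1 - c) * h q2"
  define P where "P = (LINT x|M. (X x - q1)\<^sup>2 * (X x - q2)\<^sup>2)"
  have I_P: "integrable M (\<lambda>x. (X x - q1)\<^sup>2 * (X x - q2)\<^sup>2)"
    by (rule I[of "\<lambda>s. (s - q1)\<^sup>2 * (s - q2)\<^sup>2"]) (auto intro!: continuous_intros)
  have P0: "0 \<le> P" unfolding P_def by (intro integral_nonneg_AE) auto
  have I_F: "integrable M (\<lambda>y. lncosh (s + X y))" for s
    by (rule I[of "\<lambda>x. lncosh (s + x)"]) (auto intro!: continuous_intros cL)
  have I_T: "integrable M (\<lambda>y. tanh (s + X y))" for s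
    by (rule I[of "\<lambda>x. tanh (s + x)"]) (auto intro!: continuous_intros cT)
  have I_row: "integrable M (\<lambda>y. row_residual q1 q2 0 s (X y))" 
              "integrable M (\<lambda>y. row_residual q1 q2 1 s (X y))" for s
    unfolding row_residual_def using I_F I_T I_interp by auto
  have E_row: "(LINT y|M. row_residual q1 q2 0 s (X y)) = U s - h s" for s
    unfolding row_residual_def U_def h_def mixture_def using I_interp I_F by (simp add: E_interp)
  have "1-lipschitz_on UNIV U"
  proof (rule lipschitz_onI)
    fix s t :: real
    have "\<bar>U s - U t\<bar> = \<bar>LINT y|M. lncosh (s + X y) - lncosh (t + X y)\<bar>"
      unfolding U_def using I_F by simp
    also have "\<dots> \<le> (LINT y|M. \<bar>lncosh (s + X y) - lncosh (t + X y)\<bar>)"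
      using integral_norm_bound[of M "\<lambda>y. lncosh (s + X y) - lncosh (t + X y)"] by simp
    also have "\<dots> \<le> (LINT y|M. \<bar>s - t\<bar>)"
      using I_F by (intro integral_mono) (auto intro: order_trans[OF lncosh_lipschitz])
    finally show "dist (U s) (U t) \<le> 1 * dist s t" by (simp add: dist_real_def prob_space)
  qed simp
  hence contU: "continuous_on UNIV U" by (rule lipschitz_on_continuous_on)
  have conth: "continuous_on UNIV h"
    unfolding h_def mixture_def by (intro continuous_intros cL)
  have I_U: "integrable M (\<lambda>x. U (X x))" and I_h: "integrable M (\<lambda>x. h (X x))"
    using I contU conth by auto
  have UEh: "c * U q1 + (1 - c) * U q2 = (LINT x|M. h (X x))"
    unfolding h_def mixture_def U_def using I_F by (simp add: add.commute)
  \<comment> \<open>In the second variable the interpolant integrates as under the two-point law, which leaves \<open>U s - h s\<close>.\<close>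
  define B1 where "B1 = (LINT y|M. row_residual q1 q2 1 q1 (X y))"
  have E_cross: "(LINT y|M. cross_residual q1 q2 s (X y)) =
     U s - h s - hermite_interp q1 q2 (U q1 - h q1) B1 (U q2 - h q2) s" for s
  proof -
    define k where "k = inverse ((q2 - q1)\<^sup>2) * (s - q1)\<^sup>2"
    have eq: "hermite_interp q1 q2 p q r s = p * (1 - k) + q * (s - q1 - (q2 - q1) * k) + r * k" for p q r
      by (simp add: hermite_interp_def k_def divide_inverse algebra_simps)
    show ?thesis unfolding cross_residual_def eq B1_def E_row[symmetric] using I_row by simp
  qed
  have EE_cross: "(LINT x|M. LINT y|M. cross_residual q1 q2 (X x) (X y)) = V - 2 * (LINT x|M. h (X x)) + V0"
  proof -
    have "(LINT x|M. LINT y|M. cross_residual q1 q2 (X x) (X y)) =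
       V - (LINT x|M. h (X x)) - (c * (U q1 - h q1) + (1 - c) * (U q2 - h q2))"
      unfolding E_cross V_def using I_U I_h I_interp by (simp add: E_interp)
    also have "\<dots> = V - (LINT x|M. h (X x)) - (c * U q1 + (1 - c) * U q2) + V0"
      by (simp add: V0_def algebra_simps)
    finally show ?thesis unfolding UEh by simp
  qed
  have cross_small: "(LINT x|M. LINT y|M. cross_residual q1 q2 (X x) (X y)) \<le> 1/100000 * P"
  proof -
    define A where "A = (LINT x|M. (X x - q1)\<^sup>2)"
    have A: "A = (1 - c) * (q2 - q1)\<^sup>2" unfolding A_def using E_quad[of 0 0 1] by simp
    have I_A: "integrable M (\<lambda>x. (X x - q1)\<^sup>2)"
      by (rule I[of "\<lambda>s. (s - q1)\<^sup>2"]) (auto intro!: continuous_intros)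
    have I_cross: "integrable M (\<lambda>y. cross_residual q1 q2 s (X y))" for s
    proof -
      define k where "k = inverse ((q2 - q1)\<^sup>2) * (s - q1)\<^sup>2"
      have eq: "hermite_interp q1 q2 p q r s = p * (1 - k) + q * (s - q1 - (q2 - q1) * k) + r * k" for p q r
        by (simp add: hermite_interp_def k_def divide_inverse algebra_simps)
      show ?thesis unfolding cross_residual_def eq using I_row by auto
    qed
    have inner: "(LINT y|M. cross_residual q1 q2 s (X y)) \<le>
        2/9 * ((s - q1)\<^sup>2 * P + A * ((s - q1)\<^sup>2 * (s - q2)\<^sup>2))" for s
    proof -
      have "(LINT y|M. cross_residual q1 q2 s (X y)) \<le> (LINT y|M. 2/9 * ((s - q1)\<^sup>2 * ((X y - q1)\<^sup>2 * (X y - q2)\<^sup>2) + (X y - q1)\<^sup>2 * ((s - q1)\<^sup>2 * (s - q2)\<^sup>2)))"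
        using I_cross I_P I_A q abs_le_D1[OF cross_residual_bound'[of q1 q2 s]]
        by (intro integral_mono) auto
      also have "\<dots> = 2/9 * ((s - q1)\<^sup>2 * P + A * ((s - q1)\<^sup>2 * (s - q2)\<^sup>2))"
        using I_P I_A by (simp add: P_def A_def)
      finally show ?thesis .
    qed
    have "(LINT x|M. LINT y|M. cross_residual q1 q2 (X x) (X y)) \<le>
       (LINT x|M. 2/9 * ((X x - q1)\<^sup>2 * P + A * ((X x - q1)\<^sup>2 * (X x - q2)\<^sup>2)))"
      using I_A I_P I_U I_h I_interp inner unfolding E_cross by (intro integral_mono) auto
    also have "\<dots> = 4/9 * (A * P)" using I_P I_A by (simp add: P_def A_def)
    also have "\<dots> \<le> 4/9 * (1/100000 * P)"
    proof -
      have "\<bar>q2 - q1\<bar> \<le> 2/100000" using q by linarith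
      hence "(q2 - q1)\<^sup>2 \<le> (2/100000)\<^sup>2"
        by (metis abs_le_square_iff abs_of_nonneg divide_nonneg_nonneg zero_le_numeral)
      hence "(1 - c) * (q2 - q1)\<^sup>2 \<le> 1 * (2/100000)\<^sup>2" using c by (intro mult_mono) auto
      also have "\<dots> \<le> 1/100000" by (simp add: power2_eq_square)
      finally show ?thesis using P0 unfolding A by (intro mult_left_mono mult_right_mono) auto
    qed
    finally show ?thesis using P0 by simp
  qed
  have h_le: "(LINT x|M. h (X x)) \<le> V0 - 1/100000 * P"
  proof -
    have "(LINT x|M. h (X x)) \<le> (LINT x|M. hermite_interp q1 q2 (h q1) (mixture c q1 q2 tanh q1) (h q2) (X x)
        - 1/100000 * ((X x - q1)\<^sup>2 * (X x - q2)\<^sup>2))"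
      using I_h I_interp I_P double_contact_gap[OF q c contact X(2)]
      by (intro integral_mono) (auto simp: h_def)
    also have "\<dots> = V0 - 1/100000 * P"
      using I_interp I_P by (simp add: E_interp V0_def P_def)
    finally show ?thesis .
  qed
  have "V0 = c\<^sup>2 * lncosh (2 * q1) + 2 * c * (1 - c) * lncosh (q1 + q2) + (1 - c)\<^sup>2 * lncosh (2 * q2)"
    by (simp add: V0_def h_def mixture_def power2_eq_square algebra_simps mult_2[symmetric])
  moreover have "V \<le> V0 - 1/100000 * P"
    using cross_small h_le unfolding EE_cross by linarith
  ultimately show ?thesis by (simp add: V_def U_def P_def)
qed

section \<open>The Gibbs inequality\<close>

lemma gibbs_term:
  fixes u v :: real
  assumes "0 \<le> u" "0 < v"
  shows "u * ln v - u * ln u \<le> v - u"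
    and "u * ln v - u * ln u = v - u \<Longrightarrow> u = v"
proof -
  have "u * ln v - u * ln u \<le> v - u \<and> (u * ln v - u * ln u = v - u \<longrightarrow> u = v)"
  proof (cases "u = 0")
    case False
    hence u: "u > 0" using assms by simp
    have eq: "u * ln v - u * ln u = u * ln (v / u)" "v - u = u * (v / u - 1)"
      using u assms by (simp_all add: ln_div algebra_simps)
    have "ln (v / u) \<le> v / u - 1" using u assms by (intro ln_le_minus_one) auto
    moreover have "ln (v / u) = v / u - 1 \<Longrightarrow> v / u = 1"
      using u assms by (intro ln_eq_minus_one) auto
    ultimately show ?thesis unfolding eq using u by auto
  qed (use assms in auto)
  thus "u * ln v - u * ln u \<le> v - u" "u * ln v - u * ln u = v - u \<Longrightarrow> u = v" by auto
qed

definition logistic :: "real \<Rightarrow> real" where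
  "logistic p = (1 + tanh p) / 2"

lemma logistic_bounds: "0 < logistic p" "logistic p < 1"
  using tanh_real_bounds[of p] by (auto simp: logistic_def)

lemma ln_logistic: "ln (logistic p) = p - ln 2 - lncosh p" "ln (1 - logistic p) = - p - ln 2 - lncosh p"
proof -
  have pos: "cosh p > 0" by simp
  have "logistic p = exp p / (2 * cosh p)" "1 - logistic p = exp (- p) / (2 * cosh p)"
    using pos by (auto simp: logistic_def tanh_def field_simps cosh_plus_sinh cosh_minus_sinh)
      (simp add: cosh_def)
  thus "ln (logistic p) = p - ln 2 - lncosh p" "ln (1 - logistic p) = - p - ln 2 - lncosh p"
    using pos by (simp_all add: ln_div ln_mult lncosh_def)
qed

text \<open>The right-hand side is half the cross entropy of \<open>u\<close> relative to \<open>logistic p\<close>.\<close>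

lemma entropy_density_dual:
  assumes "0 \<le> u" "u \<le> 1"
  shows "entropy_density u \<le> ln 2 / 2 + lncosh p / 2 - (u - 1/2) * p"
    and "entropy_density u = ln 2 / 2 + lncosh p / 2 - (u - 1/2) * p \<longleftrightarrow> u = logistic p"
proof -
  define v where "v = logistic p"
  have v: "0 < v" "v < 1" by (auto simp: v_def logistic_bounds)
  have rhs: "ln 2 / 2 + lncosh p / 2 - (u - 1/2) * p = - (1/2) * (u * ln v + (1 - u) * ln (1 - v))"
    unfolding v_def ln_logistic by (simp add: algebra_simps)
  note g = gibbs_term[of u v] gibbs_term[of "1 - u" "1 - v"]
  show "entropy_density u \<le> ln 2 / 2 + lncosh p / 2 - (u - 1/2) * p"
    unfolding rhs entropy_density_def using g(1,3) assms v by simp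
  have "u = v" if "entropy_density u = - (1/2) * (u * ln v + (1 - u) * ln (1 - v))"
    using that g assms v unfolding entropy_density_def by simp
  thus "entropy_density u = ln 2 / 2 + lncosh p / 2 - (u - 1/2) * p \<longleftrightarrow> u = logistic p"
    unfolding rhs v_def[symmetric] by (auto simp: entropy_density_def)
qed

lemma entropy_density_bounds:
  assumes "0 \<le> u" "u \<le> 1"
  shows "0 \<le> entropy_density u" "entropy_density u \<le> ln 2 / 2"
proof -
  have "u * ln u \<le> 0" using assms by (cases "u = 0") (auto simp: mult_le_0_iff)
  moreover have "(1 - u) * ln (1 - u) \<le> 0" using assms by (cases "u = 1") (auto simp: mult_le_0_iff)
  ultimately show "0 \<le> entropy_density u" by (simp add: entropy_density_def)
  show "entropy_density u \<le> ln 2 / 2"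
    using entropy_density_dual(1)[OF assms, of 0] by (simp add: lncosh_def)
qed

section \<open>Integrals over the unit square\<close>

lemma space_unit_measure [simp]: "space unit_measure = {0..1}"
  by (simp add: unit_measure_def space_restrict_space)

lemma prob_space_unit_measure: "prob_space unit_measure"
  by (rule prob_spaceI) (simp add: unit_measure_def emeasure_restrict_space space_restrict_space)

interpretation U: prob_space unit_measure by (rule prob_space_unit_measure)

lemma measure_unit_measure [simp]: "measure unit_measure {0..1} = 1"
  using U.prob_space by simp

interpretation UU: pair_prob_space unit_measure unit_measure ..

abbreviation unit_square :: "(real \<times> real) measure" where
  "unit_square \<equiv> unit_measure \<Otimes>\<^sub>M unit_measure"

lemma graphon_measurable:
  assumes "graphon g" "f \<in> measurable N unit_measure" "h \<in> measurable N unit_measure"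
  shows "(\<lambda>x. g (f x) (h x)) \<in> borel_measurable N"
proof -
  have "(\<lambda>x. case_prod g (f x, h x)) \<in> borel_measurable N"
    using assms by (intro measurable_compose[OF measurable_Pair[OF assms(2,3)]]) (auto simp: graphon_def)
  thus ?thesis by simp
qed

lemma UU_integrable_bounded:
  fixes f :: "real \<times> real \<Rightarrow> real"
  assumes "f \<in> borel_measurable unit_square"
    and "\<And>x y. x \<in> {0..1} \<Longrightarrow> y \<in> {0..1} \<Longrightarrow> \<bar>f (x, y)\<bar> \<le> B"
  shows "integrable unit_square f"
  using assms by (intro UU.P.integrable_const_bound[of _ B]) (auto simp: space_pair_measure)

lemma UU_iterated:
  fixes f :: "real \<Rightarrow> real \<Rightarrow> real"
  assumes "integrable unit_square (case_prod f)"
  shows "(LINT x|unit_measure. LINT y|unit_measure. f x y) = (LINT z|unit_square. case_prod f z)"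
    and "(LINT y|unit_measure. LINT x|unit_measure. f x y) = (LINT z|unit_square. case_prod f z)"
  using UU.integral_fst'[OF assms] UU.integral_snd[of f, OF assms] by simp_all

lemma bipodal_eq: 
  "bipodal a b c d x y = (if x < c then if y < c then a else d else if y < c then d else b)"
  by (simp add: bipodal_def)

lemma integral_step:
  assumes "0 \<le> c" "c \<le> 1"
  shows "(LINT x|unit_measure. (if x < c then u else v)) = c * u + (1 - c) * (v::real)"
proof -
  have m: "{..<c} \<inter> {0..1} \<in> sets unit_measure"
    by (simp add: unit_measure_def sets_restrict_space image_iff) (rule bexI[of _ "{..<c}"], auto)
  have "{..<c} \<inter> {0..1} = {0..<c}" using assms by auto
  moreover have "emeasure unit_measure {0..<c} = ennreal c"
    unfolding unit_measure_def using assms by (subst emeasure_restrict_space) auto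
  ultimately have meas: "measure unit_measure ({..<c} \<inter> {0..1}) = c"
    using assms by (simp add: measure_def)
  have "(LINT x|unit_measure. (if x < c then u else v)) =
      (LINT x|unit_measure. v + (u - v) * indicator ({..<c} \<inter> {0..1}) x)"
    by (intro Bochner_Integration.integral_cong) (auto simp: indicator_def)
  also have "\<dots> = v + (u - v) * c"
    using m meas by (simp add: U.prob_space U.emeasure_eq_measure)
  finally show ?thesis by (simp add: algebra_simps)
qed

lemma integral_bipodal:
  assumes "0 \<le> c" "c \<le> 1"
  shows "(LINT y|unit_measure. bipodal a b c d x y) = (if x < c then c * a + (1 - c) * d else c * d + (1 - c) * b)"
  using assms by (cases "x < c") (simp_all add: bipodal_eq integral_step)

lemma graphon_bipodal:
  assumes "a \<in> {0..1}" "b \<in> {0..1}" "d \<in> {0..1}"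
  shows "graphon (bipodal a b c d)"
proof -
  have [measurable]: "(\<lambda>x. x) \<in> borel_measurable unit_measure"
    unfolding unit_measure_def by (intro measurable_restrict_space1) simp
  have "case_prod (bipodal a b c d) \<in> borel_measurable unit_square"
    unfolding bipodal_eq[abs_def] by measurable
  thus ?thesis using assms by (auto simp: graphon_def bipodal_eq)
qed

lemma bipodal_densities:
  fixes a b c d :: real
  assumes "0 \<le> c" "c \<le> 1"
  defines "d1 \<equiv> c * a + (1 - c) * d" and "d2 \<equiv> c * d + (1 - c) * b"
  shows "edge_density (bipodal a b c d) = c * d1 + (1 - c) * d2"
    and "two_star_density (bipodal a b c d) = c * d1\<^sup>2 + (1 - c) * d2\<^sup>2"
    and "shannon_entropy (bipodal a b c d) = c * (c * entropy_density a + (1 - c) * entropy_density d)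
           + (1 - c) * (c * entropy_density d + (1 - c) * entropy_density b)"
proof -
  show "edge_density (bipodal a b c d) = c * d1 + (1 - c) * d2"
    unfolding edge_density_def integral_bipodal[OF assms(1,2)] d1_def d2_def
    by (rule integral_step[OF assms(1,2)])
  have "(if x < c then d1 else d2)\<^sup>2 = (if x < c then d1\<^sup>2 else d2\<^sup>2)" for x by simp
  thus "two_star_density (bipodal a b c d) = c * d1\<^sup>2 + (1 - c) * d2\<^sup>2"
    unfolding two_star_density_def degree_fun_def integral_bipodal[OF assms(1,2)] d1_def[symmetric] d2_def[symmetric]
    by (simp only: integral_step[OF assms(1,2)])
  have "entropy_density (bipodal a b c d x y) = 
      bipodal (entropy_density a) (entropy_density b) c (entropy_density d) x y" for x y
    by (simp add: bipodal_eq)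
  thus "shannon_entropy (bipodal a b c d) = c * (c * entropy_density a + (1 - c) * entropy_density d)
           + (1 - c) * (c * entropy_density d + (1 - c) * entropy_density b)"
    unfolding shannon_entropy_def by (simp only: integral_bipodal[OF assms(1,2)] integral_step[OF assms(1,2)])
qed

section \<open>Entropy bound\<close>

lemma graphon_degree:
  assumes "graphon g"
  shows "degree_fun g \<in> borel_measurable unit_measure"
    and "x \<in> {0..1} \<Longrightarrow> 0 \<le> degree_fun g x" "x \<in> {0..1} \<Longrightarrow> degree_fun g x \<le> 1"
proof -
  have "case_prod g \<in> borel_measurable unit_square" using assms by (simp add: graphon_def)
  thus "degree_fun g \<in> borel_measurable unit_measure"
    unfolding degree_fun_def[abs_def] by (rule U.borel_measurable_lebesgue_integral)
  assume x: "x \<in> {0..1}"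
  hence b: "\<And>y. y \<in> {0..1} \<Longrightarrow> 0 \<le> g x y \<and> g x y \<le> 1" using assms by (auto simp: graphon_def)
  show "0 \<le> degree_fun g x" unfolding degree_fun_def using b by (intro integral_nonneg_AE AE_I2) auto
  have "(\<lambda>y. g x y) \<in> borel_measurable unit_measure"
    using x by (intro graphon_measurable[OF assms]) auto
  hence "integrable unit_measure (\<lambda>y. g x y)" using b by (intro U.integrable_const_bound[of _ 1]) auto
  hence "degree_fun g x \<le> (LINT y|unit_measure. 1)"
    unfolding degree_fun_def using b by (intro integral_mono) auto
  thus "degree_fun g x \<le> 1" by (simp add: U.prob_space)
qed

lemma entropy_density_measurable [measurable]: "entropy_density \<in> borel_measurable borel"
  unfolding entropy_density_def[abs_def] by measurable

text \<open>Critical bipodal parameters: \<open>q1\<close>, \<open>q2\<close> are the dual variables of the two blocks, and \<open>s1\<close>, \<open>s2\<close> are the degrees of the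
blocks minus \<open>1/2\<close>. The bound on \<open>q2 - q1\<close> limits the slope of the affine map taking degrees to dual variables, so that
this map sends all possible degrees into the range of \<open>double_contact_gap\<close>.\<close>

locale two_point_certificate =
  fixes c q1 q2 s1 s2 a b d e t :: real
  assumes q: "q1 < q2" "\<bar>q1\<bar> \<le> 1/100000" "\<bar>q2\<bar> \<le> 1/100000"
    and c: "0 \<le> c" "c \<le> 1"
    and contact: "double_contact c q1 q2"
    and abd: "a = logistic (2 * q1)" "b = logistic (2 * q2)" "d = logistic (q1 + q2)"
    and s: "s1 = c * a + (1 - c) * d - 1/2" "s2 = c * d + (1 - c) * b - 1/2"
    and slope: "q2 - q1 \<le> 5/2 * (s2 - s1)"
    and e: "e - 1/2 = c * s1 + (1 - c) * s2"
    and t: "(e - 1/2)\<^sup>2 + t = c * s1\<^sup>2 + (1 - c) * s2\<^sup>2"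
begin

lemma s_less: "s1 < s2"
proof -
  have "0 < 5/2 * (s2 - s1)" using slope q(1) by simp
  thus ?thesis by simp
qed

lemma bipodal_entropy:
  "shannon_entropy (bipodal a b c d) = ln 2 / 2 
     + (c\<^sup>2 * lncosh (2 * q1) + 2 * c * (1 - c) * lncosh (q1 + q2) + (1 - c)\<^sup>2 * lncosh (2 * q2)) / 2
     - 2 * (c * (s1 * q1) + (1 - c) * (s2 * q2))"
proof -
  have H: "entropy_density (logistic p) = ln 2 / 2 + lncosh p / 2 - (logistic p - 1/2) * p" for p
    using entropy_density_dual(2)[of "logistic p" p] logistic_bounds[of p] by simp
  have H': "entropy_density a = ln 2 / 2 + lncosh (2 * q1) / 2 - (a - 1/2) * (2 * q1)"
    "entropy_density b = ln 2 / 2 + lncosh (2 * q2) / 2 - (b - 1/2) * (2 * q2)"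
    "entropy_density d = ln 2 / 2 + lncosh (q1 + q2) / 2 - (d - 1/2) * (q1 + q2)"
    unfolding abd by (rule H)+
  show ?thesis
    unfolding bipodal_densities(3)[OF c] H' s by (simp add: power2_eq_square field_simps)
qed

lemma bipodal_has_densities: "has_densities (bipodal a b c d) e t"
proof -
  have "graphon (bipodal a b c d)"
    using logistic_bounds by (intro graphon_bipodal) (auto simp: abd intro: less_imp_le)
  moreover have d12: "c * a + (1 - c) * d = s1 + 1/2" "c * d + (1 - c) * b = s2 + 1/2"
    using s by auto
  have ed: "edge_density (bipodal a b c d) = e"
    unfolding bipodal_densities(1)[OF c] d12 using e by (simp add: field_simps)
  moreover have "two_star_density (bipodal a b c d) = c * (s1 + 1/2)\<^sup>2 + (1 - c) * (s2 + 1/2)\<^sup>2"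
    unfolding bipodal_densities(2)[OF c] d12 ..
  hence "two_star_density (bipodal a b c d) = (c * s1\<^sup>2 + (1 - c) * s2\<^sup>2) + (c * s1 + (1 - c) * s2) + 1/4"
    by (simp add: power2_eq_square field_simps)
  hence "two_star_density (bipodal a b c d) = t + e\<^sup>2"
    unfolding t[symmetric] e[symmetric] by (simp add: power2_eq_square field_simps)
  ultimately show ?thesis by (simp add: has_densities_def reduced_two_star_density_def)
qed

text \<open>The test function \<open>X\<close> is the affine function of the degree that maps \<open>s1\<close> to \<open>q1\<close> and \<open>s2\<close> to \<open>q2\<close>. For the bipodal
graphon the dual inequality is then an equality everywhere. If another graphon attains the same entropy, both
inequalities are equalities: \<open>X\<close> takes almost everywhere one of the values \<open>q1\<close>, \<open>q2\<close>, and \<open>g\<close> is the logistic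
function of \<open>X x + X y\<close>.\<close>

lemma entropy_bound:
  assumes "has_densities g e t"
  shows "shannon_entropy g \<le> shannon_entropy (bipodal a b c d)"
    and "shannon_entropy g = shannon_entropy (bipodal a b c d) \<Longrightarrow>
      \<exists>A \<in> sets unit_measure. measure unit_measure A = c \<and>
        (AE (x, y) in unit_square.
          g x y = (if x \<in> A then if y \<in> A then a else d else if y \<in> A then d else b))"
proof -
  have g: "graphon g" and ge: "edge_density g = e" and gt: "two_star_density g = t + e\<^sup>2"
    using assms by (auto simp: has_densities_def reduced_two_star_density_def)
  define \<phi> where "\<phi> x = degree_fun g x - 1/2" for x
  have \<phi>_meas [measurable]: "\<phi> \<in> borel_measurable unit_measure"
    unfolding \<phi>_def[abs_def] using graphon_degree(1)[OF g] by measurable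
  have \<phi>_bd: "\<bar>\<phi> x\<bar> \<le> 1/2" if "x \<in> {0..1}" for x
    using graphon_degree(2,3)[OF g that] unfolding \<phi>_def by linarith
  have g01: "0 \<le> g x y \<and> g x y \<le> 1" if "x \<in> {0..1}" "y \<in> {0..1}" for x y
    using g that by (auto simp: graphon_def)
  have I\<phi>: "integrable unit_measure \<phi>" "integrable unit_measure (\<lambda>x. (\<phi> x)\<^sup>2)"
  proof -
    show "integrable unit_measure \<phi>"
      using \<phi>_bd by (intro U.integrable_const_bound[of _ "1/2"]) auto
    show "integrable unit_measure (\<lambda>x. (\<phi> x)\<^sup>2)"
      by (rule U.integrable_continuous_bounded[OF \<phi>_meas, of "1/2" "\<lambda>u. u\<^sup>2"])
        (use \<phi>_bd in \<open>auto intro!: continuous_intros\<close>)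
  qed
  have E\<phi>: "(LINT x|unit_measure. \<phi> x) = e - 1/2"
    "(LINT x|unit_measure. (\<phi> x)\<^sup>2) = (e - 1/2)\<^sup>2 + t"
  proof -
    have Id: "integrable unit_measure (degree_fun g)"
      using graphon_degree[OF g] by (intro U.integrable_const_bound[of _ 1]) auto
    have Ed: "(LINT x|unit_measure. degree_fun g x) = e"
      using ge by (simp add: edge_density_def degree_fun_def)
    show "(LINT x|unit_measure. \<phi> x) = e - 1/2"
      unfolding \<phi>_def using Id Ed by (simp add: U.prob_space)
    have "degree_fun g x ^ 2 = (\<phi> x)\<^sup>2 + degree_fun g x - 1/4" for x
      by (simp add: \<phi>_def power2_eq_square field_simps)
    hence "t + e\<^sup>2 = (LINT x|unit_measure. (\<phi> x)\<^sup>2 + degree_fun g x - 1/4)"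
      using gt by (simp add: two_star_density_def)
    also have "\<dots> = (LINT x|unit_measure. (\<phi> x)\<^sup>2) + e - 1/4"
      using Id I\<phi> Ed by (simp add: U.prob_space)
    finally show "(LINT x|unit_measure. (\<phi> x)\<^sup>2) = (e - 1/2)\<^sup>2 + t"
      by (simp add: power2_eq_square algebra_simps)
  qed
  \<comment> \<open>The affine map taking the degrees of the two blocks to their dual variables.\<close>
  define \<beta> where "\<beta> = (q2 - q1) / (s2 - s1)"
  have \<beta>: "0 < \<beta>" "\<beta> \<le> 5/2" "\<beta> * (s2 - s1) = q2 - q1"
    using slope s_less q by (auto simp: \<beta>_def field_simps)
  define \<alpha> where "\<alpha> = q1 - \<beta> * s1"
  have \<alpha>: "\<alpha> + \<beta> * s1 = q1" "\<alpha> + \<beta> * s2 = q2" using \<beta>(3) by (auto simp: \<alpha>_def algebra_simps)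
  define X where "X x = \<alpha> + \<beta> * \<phi> x" for x
  have X_meas [measurable]: "X \<in> borel_measurable unit_measure" unfolding X_def[abs_def] by measurable
  have s_bd: "\<bar>s1\<bar> \<le> 1/1000"
  proof -
    have "\<bar>logistic p - 1/2\<bar> \<le> 1/1000" if "\<bar>p\<bar> \<le> 1/1000" for p
    proof -
      have "logistic p - 1/2 = tanh p / 2" by (simp add: logistic_def field_simps)
      thus ?thesis using abs_tanh_le[of p] that by linarith
    qed
    from this[of "2 * q1"] this[of "q1 + q2"] have "\<bar>a - 1/2\<bar> \<le> 1/1000" "\<bar>d - 1/2\<bar> \<le> 1/1000"
      unfolding abd using q by linarith+
    hence "\<bar>c * (a - 1/2)\<bar> \<le> c * (1/1000)" "\<bar>(1 - c) * (d - 1/2)\<bar> \<le> (1 - c) * (1/1000)"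
      unfolding abs_mult using c by (intro mult_mono; simp)+
    moreover have "s1 = c * (a - 1/2) + (1 - c) * (d - 1/2)" by (simp add: s field_simps)
    moreover have "c * (1/1000) + (1 - c) * (1/1000) = 1/1000" by (simp add: field_simps)
    ultimately show ?thesis by linarith
  qed
  have X_bd: "\<bar>X x\<bar> \<le> 3/2" if "x \<in> {0..1}" for x
  proof -
    have "\<bar>\<phi> x - s1\<bar> \<le> 501/1000" using \<phi>_bd[OF that] s_bd by linarith
    hence "\<bar>\<beta> * (\<phi> x - s1)\<bar> \<le> 5/2 * (501/1000)"
      unfolding abs_mult using \<beta> by (intro mult_mono) auto
    moreover have "X x = q1 + \<beta> * (\<phi> x - s1)" by (simp add: X_def \<alpha>_def algebra_simps)
    ultimately show ?thesis using q by linarith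
  qed
  have IX: "integrable unit_measure X"
    using X_bd by (intro U.integrable_const_bound[of _ "3/2"]) auto
  have EX: "(LINT x|unit_measure. X x) = c * q1 + (1 - c) * q2"
  proof -
    have "(LINT x|unit_measure. X x) = \<alpha> + \<beta> * (e - 1/2)"
      unfolding X_def using I\<phi> E\<phi> by (simp add: U.prob_space)
    also have "\<dots> = c * (\<alpha> + \<beta> * s1) + (1 - c) * (\<alpha> + \<beta> * s2)"
      unfolding e by (simp add: algebra_simps)
    finally show ?thesis unfolding \<alpha> .
  qed
  have EX2: "(LINT x|unit_measure. (X x)\<^sup>2) = c * q1\<^sup>2 + (1 - c) * q2\<^sup>2"
  proof -
    have "(LINT x|unit_measure. (X x)\<^sup>2) = (LINT x|unit_measure. \<alpha>\<^sup>2 + 2 * \<alpha> * \<beta> * \<phi> x + \<beta>\<^sup>2 * (\<phi> x)\<^sup>2)"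
      by (intro Bochner_Integration.integral_cong) (auto simp: X_def power2_eq_square algebra_simps)
    also have "\<dots> = \<alpha>\<^sup>2 + 2 * \<alpha> * \<beta> * (e - 1/2) + \<beta>\<^sup>2 * ((e - 1/2)\<^sup>2 + t)"
      using I\<phi> E\<phi> by (simp add: U.prob_space)
    also have "\<dots> = c * (\<alpha> + \<beta> * s1)\<^sup>2 + (1 - c) * (\<alpha> + \<beta> * s2)\<^sup>2"
      unfolding t unfolding e by (simp add: power2_eq_square algebra_simps)
    finally show ?thesis unfolding \<alpha> .
  qed
  have E\<phi>X: "(LINT x|unit_measure. \<phi> x * X x) = c * (s1 * q1) + (1 - c) * (s2 * q2)"
  proof -
    have "(LINT x|unit_measure. \<phi> x * X x) = (LINT x|unit_measure. \<alpha> * \<phi> x + \<beta> * (\<phi> x)\<^sup>2)"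
      by (intro Bochner_Integration.integral_cong) (auto simp: X_def power2_eq_square algebra_simps)
    also have "\<dots> = \<alpha> * (e - 1/2) + \<beta> * ((e - 1/2)\<^sup>2 + t)"
      using I\<phi> E\<phi> by simp
    also have "\<dots> = c * (s1 * (\<alpha> + \<beta> * s1)) + (1 - c) * (s2 * (\<alpha> + \<beta> * s2))"
      unfolding t unfolding e by (simp add: power2_eq_square algebra_simps)
    finally show ?thesis unfolding \<alpha> .
  qed
  define P where "P = (LINT x|unit_measure. (X x - q1)\<^sup>2 * (X x - q2)\<^sup>2)"
  define V where "V = (LINT x|unit_measure. LINT y|unit_measure. lncosh (X x + X y))"
  define V0 where "V0 = c\<^sup>2 * lncosh (2 * q1) + 2 * c * (1 - c) * lncosh (q1 + q2) + (1 - c)\<^sup>2 * lncosh (2 * q2)"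
  have V_le: "V \<le> V0 - 1/100000 * P"
    unfolding V_def V0_def P_def
    by (rule two_point_law_maximises[OF prob_space_unit_measure X_meas _ EX EX2 q c contact]) (use X_bd in auto)
  have [measurable]: "lncosh \<in> borel_measurable borel"
    using lncosh_has_derivative
    by (intro borel_measurable_continuous_onI) (meson DERIV_isCont continuous_at_imp_continuous_on)
  \<comment> \<open>The pointwise dual bound for the entropy density of \<open>g\<close>.\<close>
  define R where "R = (\<lambda>(x, y). ln 2 / 2 + lncosh (X x + X y) / 2 - (g x y - 1/2) * (X x + X y))"
  define Hg where "Hg = (\<lambda>(x, y). entropy_density (g x y))"
  have g_meas [measurable]: "(\<lambda>z. g (fst z) (snd z)) \<in> borel_measurable unit_square"
    using g by (simp add: graphon_def case_prod_beta')
  have IH: "integrable unit_square Hg"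
  proof (rule UU_integrable_bounded[of _ "ln 2 / 2"])
    show "Hg \<in> borel_measurable unit_square" unfolding Hg_def case_prod_beta' by measurable
  qed (use g01 entropy_density_bounds in \<open>auto simp: Hg_def\<close>)
  have IgX: "integrable unit_square (\<lambda>(x, y). (g x y - 1/2) * X x)" "integrable unit_square (\<lambda>(x, y). (g x y - 1/2) * X y)"
  proof -
    have "\<bar>(g x y - 1/2) * X z\<bar> \<le> 1/2 * (3/2)" if "x \<in> {0..1}" "y \<in> {0..1}" "z \<in> {0..1}" for x y z
    proof -
      have "\<bar>g x y - 1/2\<bar> \<le> 1/2" using g01[OF that(1,2)] by linarith
      thus ?thesis unfolding abs_mult using X_bd[OF that(3)] by (intro mult_mono) auto
    qed
    moreover have "(\<lambda>(x, y). (g x y - 1/2) * X x) \<in> borel_measurable unit_square"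
        "(\<lambda>(x, y). (g x y - 1/2) * X y) \<in> borel_measurable unit_square"
      unfolding case_prod_beta' by measurable
    ultimately show "integrable unit_square (\<lambda>(x, y). (g x y - 1/2) * X x)" "integrable unit_square (\<lambda>(x, y). (g x y - 1/2) * X y)"
      by (auto intro!: UU_integrable_bounded[of _ "1/2 * (3/2)"] simp del: times_divide_eq_left times_divide_eq_right)
  qed
  have IV: "integrable unit_square (\<lambda>(x, y). lncosh (X x + X y))"
  proof (rule UU_integrable_bounded[of _ 3])
    fix x y :: real assume xy: "x \<in> {0..1}" "y \<in> {0..1}"
    show "\<bar>case (x, y) of (x, y) \<Rightarrow> lncosh (X x + X y)\<bar> \<le> 3"
      using lncosh_lipschitz[of "X x + X y" 0] X_bd[OF xy(1)] X_bd[OF xy(2)] by (auto simp: lncosh_def)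
  qed measurable
  have IR: "integrable unit_square R"
    unfolding R_def case_prod_beta' distrib_left using IgX IV unfolding case_prod_beta' by auto
  have gX: "(LINT z|unit_square. (case z of (x, y) \<Rightarrow> (g x y - 1/2) * X x)) = (LINT x|unit_measure. \<phi> x * X x)"
    "(LINT z|unit_square. (case z of (x, y) \<Rightarrow> (g x y - 1/2) * X y)) = (LINT x|unit_measure. \<phi> x * X x)"
  proof -
    have row: "(LINT y|unit_measure. (g x y - 1/2)) = \<phi> x" if "x \<in> {0..1}" for x
    proof -
      have "(\<lambda>y. g x y) \<in> borel_measurable unit_measure"
        using that by (intro graphon_measurable[OF g]) auto
      hence "integrable unit_measure (\<lambda>y. g x y)"
        using g01[OF that] by (intro U.integrable_const_bound[of _ 1]) auto
      thus ?thesis by (simp add: \<phi>_def degree_fun_def U.prob_space)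
    qed
    show "(LINT z|unit_square. (case z of (x, y) \<Rightarrow> (g x y - 1/2) * X x)) = (LINT x|unit_measure. \<phi> x * X x)"
      unfolding UU_iterated(1)[OF IgX(1), symmetric]
      by (intro Bochner_Integration.integral_cong refl) (simp add: row)
    have "(LINT x|unit_measure. (g x y - 1/2)) = \<phi> y" if "y \<in> {0..1}" for y
    proof -
      have "(LINT x|unit_measure. (g x y - 1/2)) = (LINT x|unit_measure. (g y x - 1/2))"
        using g that by (intro Bochner_Integration.integral_cong refl) (auto simp: graphon_def)
      thus ?thesis using row[OF that] by simp
    qed
    thus "(LINT z|unit_square. (case z of (x, y) \<Rightarrow> (g x y - 1/2) * X y)) = (LINT x|unit_measure. \<phi> x * X x)"
      unfolding UU_iterated(2)[OF IgX(2), symmetric]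
      by (intro Bochner_Integration.integral_cong refl) simp
  qed
  have ER: "(LINT z|unit_square. R z) = ln 2 / 2 + V / 2 - 2 * (c * (s1 * q1) + (1 - c) * (s2 * q2))"
  proof -
    have "R = (\<lambda>z. ln 2 / 2 + (case z of (x, y) \<Rightarrow> lncosh (X x + X y)) / 2
        - ((case z of (x, y) \<Rightarrow> (g x y - 1/2) * X x) + (case z of (x, y) \<Rightarrow> (g x y - 1/2) * X y)))"
      by (auto simp: R_def algebra_simps)
    hence "(LINT z|unit_square. R z) = ln 2 / 2 + (LINT z|unit_square. (case z of (x, y) \<Rightarrow> lncosh (X x + X y))) / 2
       - ((LINT z|unit_square. (case z of (x, y) \<Rightarrow> (g x y - 1/2) * X x)) + (LINT z|unit_square. (case z of (x, y) \<Rightarrow> (g x y - 1/2) * X y)))"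
      using IV IgX by (simp add: UU.P.prob_space)
    thus ?thesis unfolding gX E\<phi>X using UU_iterated(1)[OF IV] by (simp add: V_def)
  qed
  have EH: "(LINT z|unit_square. Hg z) = shannon_entropy g"
    using UU_iterated(1)[of "\<lambda>x y. entropy_density (g x y)"] IH by (simp add: shannon_entropy_def Hg_def)
  have HR: "Hg z \<le> R z" if "z \<in> space unit_square" for z
    using that g01 entropy_density_dual(1) by (auto simp: Hg_def R_def space_pair_measure)
  have le: "shannon_entropy g \<le> (LINT z|unit_square. R z)"
    unfolding EH[symmetric] by (intro integral_mono IH IR HR)
  have P0: "0 \<le> P" unfolding P_def by (intro integral_nonneg_AE) auto
  have R0: "(LINT z|unit_square. R z) \<le> shannon_entropy (bipodal a b c d) - 1/200000 * P"
    unfolding ER bipodal_entropy V0_def[symmetric] using V_le by simp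
  show "shannon_entropy g \<le> shannon_entropy (bipodal a b c d)"
    using le R0 P0 by linarith
  assume eq: "shannon_entropy g = shannon_entropy (bipodal a b c d)"
  have "P = 0" and intR: "(LINT z|unit_square. R z) = (LINT z|unit_square. Hg z)"
    using le R0 P0 eq unfolding EH by linarith+
  have IPi: "integrable unit_measure (\<lambda>x. (X x - q1)\<^sup>2 * (X x - q2)\<^sup>2)"
    by (rule U.integrable_continuous_bounded[OF X_meas, of "3/2" "\<lambda>u. (u - q1)\<^sup>2 * (u - q2)\<^sup>2"])
      (use X_bd in \<open>auto intro!: continuous_intros\<close>)
  have X2: "AE x in unit_measure. X x = q1 \<or> X x = q2"
    using \<open>P = 0\<close> integral_nonneg_eq_0_iff_AE[OF IPi] unfolding P_def by auto
  have "(LINT z|unit_square. R z - Hg z) = 0" using intR IR IH by simp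
  hence "AE z in unit_square. R z - Hg z = 0"
    using integral_nonneg_eq_0_iff_AE[of unit_square "\<lambda>z. R z - Hg z"] IR IH HR by auto
  hence AEg: "AE z in unit_square. case z of (x, y) \<Rightarrow> g x y = logistic (X x + X y)"
  proof (rule AE_mp, intro AE_I2 impI)
    fix z assume z: "z \<in> space unit_square" "R z - Hg z = 0"
    obtain x y where [simp]: "z = (x, y)" by fastforce
    have "entropy_density (g x y) = ln 2 / 2 + lncosh (X x + X y) / 2 - (g x y - 1/2) * (X x + X y)"
      using z(2) by (simp add: R_def Hg_def)
    thus "case z of (x, y) \<Rightarrow> g x y = logistic (X x + X y)"
      using entropy_density_dual(2)[of "g x y" "X x + X y"] g01[of x y] z(1) by (auto simp: space_pair_measure)
  qed
  define A where "A = {x \<in> space unit_measure. X x = q1}"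
  have A [measurable]: "A \<in> sets unit_measure" unfolding A_def by measurable
  have "(LINT x|unit_measure. X x) = (LINT x|unit_measure. q2 + (q1 - q2) * indicator A x)"
  proof (rule integral_cong_AE)
    show "AE x in unit_measure. X x = q2 + (q1 - q2) * indicator A x"
      using X2 AE_space by eventually_elim (auto simp: A_def indicator_def)
  qed measurable
  also have "\<dots> = q2 + (q1 - q2) * measure unit_measure A"
  proof -
    have "A \<inter> {0..1} = A" by (auto simp: A_def)
    thus ?thesis using A by (simp add: U.prob_space U.emeasure_eq_measure)
  qed
  finally have "(q1 - q2) * measure unit_measure A = (q1 - q2) * c"
    unfolding EX by (simp add: algebra_simps)
  hence mA: "measure unit_measure A = c" using q by simp
  have X2': "AE z in unit_square. (X (fst z) = q1 \<or> X (fst z) = q2) \<and> (X (snd z) = q1 \<or> X (snd z) = q2)"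
  proof (rule UU.AE_pair_measure)
    show "AE x in unit_measure. AE y in unit_measure. 
        (X (fst (x, y)) = q1 \<or> X (fst (x, y)) = q2) \<and> (X (snd (x, y)) = q1 \<or> X (snd (x, y)) = q2)"
      using X2 by simp
  qed measurable
  have "AE (x, y) in unit_square. g x y = (if x \<in> A then if y \<in> A then a else d else if y \<in> A then d else b)"
    using AEg X2'
  proof (rule AE_mp[OF AE_conjI], intro AE_I2 impI)
    fix z assume z: "z \<in> space unit_square"
      and *: "(case z of (x, y) \<Rightarrow> g x y = logistic (X x + X y)) \<and>
         (X (fst z) = q1 \<or> X (fst z) = q2) \<and> (X (snd z) = q1 \<or> X (snd z) = q2)"
    obtain x y where [simp]: "z = (x, y)" by fastforce
    have "q1 + q1 = 2 * q1" "q2 + q2 = 2 * q2" "q2 + q1 = q1 + q2" "q1 \<noteq> q2" using q by auto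
    with * z show "case z of (x, y) \<Rightarrow> g x y = (if x \<in> A then if y \<in> A then a else d else if y \<in> A then d else b)"
      by (auto simp: A_def abd space_pair_measure add.commute)
  qed
  with A mA show "\<exists>A \<in> sets unit_measure. measure unit_measure A = c \<and>
        (AE (x, y) in unit_square.
          g x y = (if x \<in> A then if y \<in> A then a else d else if y \<in> A then d else b))"
    by blast
qed

end

section \<open>Cut distance zero\<close>

text \<open>Boundedness matters also for the lower bound: the supremum of an unbounded set of reals carries no information.\<close>

lemma cut_norm_bounds:
  fixes f :: "real \<Rightarrow> real \<Rightarrow> real"
  assumes f: "case_prod f \<in> borel_measurable unit_square"
    and bd: "\<And>x y. x \<in> {0..1} \<Longrightarrow> y \<in> {0..1} \<Longrightarrow> \<bar>f x y\<bar> \<le> B"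
  shows "0 \<le> cut_norm f"
    and "cut_norm f \<le> (LINT z|unit_square. \<bar>case_prod f z\<bar>)"
proof -
  define L where "L = (LINT z|unit_square. \<bar>case_prod f z\<bar>)"
  have If: "integrable unit_square (case_prod f)" by (rule UU_integrable_bounded[OF f, of B]) (use bd in auto)
  have le: "\<bar>LINT x:A|unit_measure. LINT y:C|unit_measure. f x y\<bar> \<le> L"
    if [measurable]: "A \<in> sets unit_measure" "C \<in> sets unit_measure" for A C
  proof -
    define h where "h x y = indicator A x * (indicator C y * f x y)" for x y
    have Ih: "integrable unit_square (case_prod h)"
    proof (rule UU_integrable_bounded[of _ B])
      have [measurable]: "(\<lambda>z. f (fst z) (snd z)) \<in> borel_measurable unit_square" using f by (simp add: case_prod_beta')
      show "case_prod h \<in> borel_measurable unit_square" unfolding h_def[abs_def] case_prod_beta' by measurable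
      show "\<bar>case_prod h (x, y)\<bar> \<le> B" if "x \<in> {0..1}" "y \<in> {0..1}" for x y
        using bd[OF that] abs_ge_zero[of "f x y"] by (auto simp: h_def indicator_def)
    qed
    have "(LINT x:A|unit_measure. LINT y:C|unit_measure. f x y) = (LINT x|unit_measure. LINT y|unit_measure. h x y)"
      by (simp add: set_lebesgue_integral_def h_def)
    also have "\<dots> = (LINT z|unit_square. case_prod h z)" by (rule UU_iterated(1)[OF Ih])
    also have "\<bar>\<dots>\<bar> \<le> (LINT z|unit_square. \<bar>case_prod h z\<bar>)"
      using integral_norm_bound[of unit_square "case_prod h"] by simp
    also have "\<dots> \<le> L"
      unfolding L_def using Ih If by (intro integral_mono integrable_abs) (auto simp: h_def indicator_def)
    finally show ?thesis .
  qed
  define S where "S = sets unit_measure \<times> sets unit_measure"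
  define \<Phi> where "\<Phi> = (\<lambda>(A, C). \<bar>LINT x:A|unit_measure. LINT y:C|unit_measure. f x y\<bar>)"
  have cn: "cut_norm f = (SUP p\<in>S. \<Phi> p)" by (simp add: cut_norm_def S_def \<Phi>_def)
  have le': "\<Phi> p \<le> L" if "p \<in> S" for p using that le by (auto simp: S_def \<Phi>_def)
  have ne: "({}, {}) \<in> S" by (simp add: S_def)
  have bdd: "bdd_above (\<Phi> ` S)" using le' by (intro bdd_aboveI2)
  have "0 \<le> \<Phi> ({}, {})" by (simp add: \<Phi>_def)
  also have "\<dots> \<le> cut_norm f" unfolding cn by (rule cSUP_upper[OF ne bdd])
  finally show "0 \<le> cut_norm f" .
  show "cut_norm f \<le> (LINT z|unit_square. \<bar>case_prod f z\<bar>)"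
    unfolding cn L_def[symmetric] using ne by (intro cSUP_least le') auto
qed

lemma rearrangement_id: "rearrangement (\<lambda>x. x)"
  unfolding rearrangement_def by (auto simp: bij_betw_def inj_on_def distr_id)

lemma rearranged_measurable:
  assumes "graphon g" "graphon h" "rearrangement \<sigma>"
  shows "case_prod (\<lambda>x y. g x y - h (\<sigma> x) (\<sigma> y)) \<in> borel_measurable unit_square"
    and "x \<in> {0..1} \<Longrightarrow> y \<in> {0..1} \<Longrightarrow> \<bar>g x y - h (\<sigma> x) (\<sigma> y)\<bar> \<le> 1"
proof -
  have [measurable]: "\<sigma> \<in> measurable unit_measure unit_measure"
    using assms(3) by (simp add: rearrangement_def)
  have [measurable]: "(\<lambda>z. g (fst z) (snd z)) \<in> borel_measurable unit_square"
    by (rule graphon_measurable[OF assms(1)]) measurable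
  have [measurable]: "(\<lambda>z. h (\<sigma> (fst z)) (\<sigma> (snd z))) \<in> borel_measurable unit_square"
    by (rule graphon_measurable[OF assms(2)]) measurable
  show "case_prod (\<lambda>x y. g x y - h (\<sigma> x) (\<sigma> y)) \<in> borel_measurable unit_square"
    unfolding case_prod_beta' by measurable
  assume xy: "x \<in> {0..1}" "y \<in> {0..1}"
  hence "\<sigma> x \<in> {0..1}" "\<sigma> y \<in> {0..1}"
    using assms(3) by (auto simp: rearrangement_def bij_betw_def)
  hence "g x y \<in> {0..1}" "h (\<sigma> x) (\<sigma> y) \<in> {0..1}" using xy assms(1,2) by (simp_all add: graphon_def)
  thus "\<bar>g x y - h (\<sigma> x) (\<sigma> y)\<bar> \<le> 1" by auto
qed

lemma cut_distance_zeroI: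
  assumes g: "graphon g" and h: "graphon h"
    and approx: "\<And>\<epsilon>. \<epsilon> > 0 \<Longrightarrow> \<exists>\<sigma>. rearrangement \<sigma> \<and> 
      (LINT z|unit_square. \<bar>case z of (x, y) \<Rightarrow> g x y - h (\<sigma> x) (\<sigma> y)\<bar>) \<le> \<epsilon>"
  shows "cut_distance g h = 0"
proof -
  define K where "K \<sigma> = cut_norm (\<lambda>x y. g x y - h (\<sigma> x) (\<sigma> y))" for \<sigma>
  have cd: "cut_distance g h = (INF \<sigma>\<in>{\<sigma>. rearrangement \<sigma>}. K \<sigma>)" by (simp add: cut_distance_def K_def)
  note cn = cut_norm_bounds[OF rearranged_measurable[OF g h]]
  have K0: "0 \<le> K \<sigma>" if "rearrangement \<sigma>" for \<sigma> unfolding K_def by (rule cn(1)) (use that in auto)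
  have ge: "0 \<le> cut_distance g h"
    unfolding cd using K0 rearrangement_id by (intro cINF_greatest) auto
  have bdd: "bdd_below (K ` {\<sigma>. rearrangement \<sigma>})" using K0 by (intro bdd_belowI2[of _ 0]) auto
  have "cut_distance g h \<le> \<epsilon>" if pos: "\<epsilon> > 0" for \<epsilon>
  proof -
    obtain \<sigma> where \<sigma>: "rearrangement \<sigma>" 
      and le: "(LINT z|unit_square. \<bar>case z of (x, y) \<Rightarrow> g x y - h (\<sigma> x) (\<sigma> y)\<bar>) \<le> \<epsilon>"
      using approx[OF pos] by blast
    have "K \<sigma> \<le> (LINT z|unit_square. \<bar>case z of (x, y) \<Rightarrow> g x y - h (\<sigma> x) (\<sigma> y)\<bar>)"
      unfolding K_def by (rule cn(2)) (use \<sigma> in auto)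
    thus ?thesis unfolding cd using \<sigma> le by (intro cINF_lower2[OF bdd, of \<sigma>]) auto
  qed
  hence "cut_distance g h \<le> 0 + \<epsilon>" if "\<epsilon> > 0" for \<epsilon> using that by simp
  hence "cut_distance g h \<le> 0" by (rule field_le_epsilon)
  with ge show ?thesis by simp
qed

definition cell :: "nat \<Rightarrow> real \<Rightarrow> nat" where
  "cell N x = nat \<lfloor>real N * x\<rfloor>"

text \<open>The map that permutes the \<open>N\<close> grid cells of the unit interval by \<open>\<pi>\<close>. The right endpoint belongs to no cell
and stays fixed, which makes the map a bijection of the closed interval.\<close>

definition cell_shift :: "nat \<Rightarrow> (nat \<Rightarrow> nat) \<Rightarrow> real \<Rightarrow> real" where
  "cell_shift N \<pi> x = (if x \<in> {0..<1} then x + (real (\<pi> (cell N x)) - real (cell N x)) / real N else x)"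

lemma cell_iff:
  assumes "0 < N" "0 \<le> x"
  shows "cell N x = k \<longleftrightarrow> real k / real N \<le> x \<and> x < (real k + 1) / real N"
proof -
  have "cell N x = k \<longleftrightarrow> \<lfloor>real N * x\<rfloor> = int k"
    using assms by (auto simp: cell_def)
  also have "\<dots> \<longleftrightarrow> real k \<le> real N * x \<and> real N * x < real k + 1"
    by (simp add: floor_eq_iff)
  finally show ?thesis using assms by (simp add: divide_simps mult.commute)
qed

lemma cell_less: "0 < N \<Longrightarrow> x \<in> {0..<1} \<Longrightarrow> cell N x < N"
proof -
  assume "0 < N" "x \<in> {0..<1}"
  hence "real N * x < real N * 1" "0 \<le> real N * x" by (auto intro: mult_strict_left_mono simp del: mult_1_right)
  thus "cell N x < N" by (simp add: cell_def nat_less_iff floor_less_iff)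
qed

lemma cell_shift:
  assumes N: "0 < N" and x: "x \<in> {0..<1}" and \<pi>: "\<pi> ` {..<N} \<subseteq> {..<N}"
  shows "cell_shift N \<pi> x \<in> {0..<1}" "cell N (cell_shift N \<pi> x) = \<pi> (cell N x)"
proof -
  define k where "k = cell N x"
  define s where "s = cell_shift N \<pi> x"
  have "k < N" unfolding k_def by (rule cell_less[OF N x])
  hence pk: "\<pi> k < N" using \<pi> by auto
  have k: "real k / real N \<le> x" "x < (real k + 1) / real N"
    using cell_iff[of N x k] N x by (auto simp: k_def)
  have s: "s = x + (real (\<pi> k) - real k) / real N"
    using x by (simp add: s_def cell_shift_def k_def)
  have s': "real (\<pi> k) / real N \<le> s" "s < (real (\<pi> k) + 1) / real N"
  proof -
    have "x * real N \<ge> real k" "x * real N < real k + 1"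
      using k N by (simp_all add: pos_divide_le_eq pos_less_divide_eq)
    moreover have "s * real N = x * real N + real (\<pi> k) - real k"
      unfolding s using N by (simp add: distrib_right)
    ultimately show "real (\<pi> k) / real N \<le> s" "s < (real (\<pi> k) + 1) / real N"
      using N by (simp_all add: pos_divide_le_eq pos_less_divide_eq)
  qed
  have "(real (\<pi> k) + 1) / real N \<le> 1" using pk N by (simp add: divide_le_eq)
  moreover have "0 \<le> real (\<pi> k) / real N" by simp
  ultimately have s01: "0 \<le> s" "s < 1" using s' by linarith+
  thus "cell_shift N \<pi> x \<in> {0..<1}" by (simp add: s_def)
  show "cell N (cell_shift N \<pi> x) = \<pi> (cell N x)"
    using cell_iff[OF N s01(1), of "\<pi> k"] s' by (simp add: s_def k_def)
qed

lemma cell_shift_inverse: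
  assumes N: "0 < N" and \<pi>: "\<pi> ` {..<N} \<subseteq> {..<N}" and inv: "\<And>k. k < N \<Longrightarrow> \<rho> (\<pi> k) = k"
  shows "cell_shift N \<rho> (cell_shift N \<pi> x) = x"
proof (cases "x \<in> {0..<1}")
  case True
  define s where "s = cell_shift N \<pi> x"
  have s: "s \<in> {0..<1}" "cell N s = \<pi> (cell N x)" using cell_shift[OF N True \<pi>] by (auto simp: s_def)
  have r: "\<rho> (\<pi> (cell N x)) = cell N x" using inv cell_less[OF N True] by simp
  have "cell_shift N \<rho> s = s + (real (cell N x) - real (\<pi> (cell N x))) / real N"
    using s(1) unfolding cell_shift_def[of N \<rho> s] s(2) r by simp
  moreover have "s = x + (real (\<pi> (cell N x)) - real (cell N x)) / real N"
    unfolding s_def cell_shift_def using True by simp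
  ultimately have "cell_shift N \<rho> s = x" by (simp add: diff_divide_distrib)
  thus ?thesis by (simp add: s_def)
next
  case False
  hence "cell_shift N \<tau> x = x" for \<tau> unfolding cell_shift_def by (rule if_not_P)
  thus ?thesis by simp
qed

text \<open>On each cell the map is a translation, so the measure of a preimage is the sum over the cells of translated pieces.\<close>

lemma rearrangement_cell_shift:
  assumes N: "0 < N" and \<pi>: "bij_betw \<pi> {..<N} {..<N}"
  shows "rearrangement (cell_shift N \<pi>)"
  unfolding rearrangement_def
proof (intro conjI)
  define \<sigma> where "\<sigma> = cell_shift N \<pi>"
  define \<rho> where "\<rho> = the_inv_into {..<N} \<pi>"
  have \<pi>': "\<pi> ` {..<N} \<subseteq> {..<N}" using \<pi> by (auto simp: bij_betw_def)
  have \<rho>': "\<rho> ` {..<N} \<subseteq> {..<N}" using bij_betw_the_inv_into[OF \<pi>] by (auto simp: bij_betw_def \<rho>_def)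
  have inv: "\<And>k. k < N \<Longrightarrow> \<rho> (\<pi> k) = k" "\<And>k. k < N \<Longrightarrow> \<pi> (\<rho> k) = k"
    using \<pi> by (auto simp: \<rho>_def bij_betw_def the_inv_into_f_f f_the_inv_into_f)
  have into: "cell_shift N \<tau> x \<in> {0..1}" if "x \<in> {0..1}" "\<tau> ` {..<N} \<subseteq> {..<N}" for x \<tau>
  proof (cases "x = 1")
    case True
    thus ?thesis by (simp add: cell_shift_def)
  next
    case False
    hence "x \<in> {0..<1}" using that(1) by auto
    thus ?thesis using cell_shift(1)[OF N _ that(2), of x] by auto
  qed
  show "bij_betw (cell_shift N \<pi>) {0..1} {0..1}"
    by (rule bij_betw_byWitness[where f' = "cell_shift N \<rho>"])
      (use into \<pi>' \<rho>' inv in \<open>auto intro: cell_shift_inverse[OF N]\<close>)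
  have "cell_shift N \<pi> \<in> borel_measurable borel"
    unfolding cell_shift_def[abs_def] cell_def[abs_def] by measurable
  hence mb: "cell_shift N \<pi> \<in> borel_measurable unit_measure"
    unfolding unit_measure_def by (intro measurable_restrict_space1) simp
  show ms: "cell_shift N \<pi> \<in> measurable unit_measure unit_measure"
    using mb into \<pi>' unfolding unit_measure_def 
    by (intro measurable_restrict_space2) (auto simp: space_restrict_space)
  have e_unit: "emeasure unit_measure A = emeasure lborel A" if "A \<in> sets unit_measure" for A
    using that unfolding unit_measure_def by (subst emeasure_restrict_space) (auto simp: sets_restrict_space)
  show "distr unit_measure unit_measure (cell_shift N \<pi>) = unit_measure"
  proof (rule measure_eqI)
    fix A assume "A \<in> sets (distr unit_measure unit_measure (cell_shift N \<pi>))"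
    hence A: "A \<in> sets unit_measure" by simp
    hence A01: "A \<subseteq> {0..1}" "A \<in> sets borel"
      by (auto simp: unit_measure_def sets_restrict_space)
    define C where "C k = {real k / real N ..< (real k + 1) / real N}" for k
    have C_iff: "x \<in> C k \<longleftrightarrow> cell N x = k" if "x \<in> {0..<1}" for x k
      using cell_iff[OF N, of x k] that by (auto simp: C_def)
    have C_sub: "C k \<subseteq> {0..<1}" if "k < N" for k
    proof
      fix x assume "x \<in> C k"
      hence x: "real k / real N \<le> x" "x < (real k + 1) / real N" by (auto simp: C_def)
      have "(real k + 1) / real N \<le> 1" using that N by (simp add: divide_le_eq)
      with x(2) have "x < 1" by (rule less_le_trans)
      moreover have "0 \<le> real k / real N" by simp
      hence "0 \<le> x" using x(1) by (rule order_trans)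
      ultimately show "x \<in> {0..<1}" by simp
    qed
    have decomp: "emeasure lborel B = (\<Sum>k<N. emeasure lborel (B \<inter> C k))" if "B \<in> sets borel" "B \<subseteq> {0..1}" for B
    proof -
      have U: "(\<Union>k<N. B \<inter> C k) = B - {1}"
      proof (intro equalityI subsetI)
        fix x assume "x \<in> (\<Union>k<N. B \<inter> C k)"
        then obtain k where "k < N" "x \<in> B" "x \<in> C k" by blast
        moreover from this have "x \<in> {0..<1}" using C_sub[of k] by blast
        ultimately show "x \<in> B - {1}" by simp
      next
        fix x assume x: "x \<in> B - {1}"
        hence "x \<in> {0..<1}" using that(2) by (auto simp: subset_iff less_le)
        hence "x \<in> C (cell N x)" "cell N x < N" using C_iff cell_less[OF N] by auto
        thus "x \<in> (\<Union>k<N. B \<inter> C k)" using x by blast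
      qed
      have D: "disjoint_family_on (\<lambda>k. B \<inter> C k) {..<N}"
      proof (unfold disjoint_family_on_def, intro ballI impI equals0I)
        fix k l x assume "k \<in> {..<N}" "l \<in> {..<N}" "k \<noteq> l" and x: "x \<in> B \<inter> C k \<inter> (B \<inter> C l)"
        hence "x \<in> {0..<1}" using C_sub[of k] by blast
        thus False using x C_iff \<open>k \<noteq> l\<close> by simp
      qed
      have "(\<Sum>k<N. emeasure lborel (B \<inter> C k)) = emeasure lborel (\<Union>k<N. B \<inter> C k)"
        by (rule sum_emeasure[OF _ D]) (use that(1) in \<open>auto simp: C_def\<close>)
      also have "\<dots> = emeasure lborel (B - {1})" by (simp only: U)
      also have "\<dots> = emeasure lborel B"
        using that(1) finite_imp_null_set_lborel[of "{1}"] by (intro emeasure_Diff_null_set) simp_all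
      finally show ?thesis by simp
    qed
    define B where "B = cell_shift N \<pi> -` A \<inter> {0..1}"
    have B: "B \<in> sets unit_measure" using measurable_sets[OF ms A] by (simp add: B_def)
    hence B01: "B \<subseteq> {0..1}" "B \<in> sets borel" by (auto simp: unit_measure_def sets_restrict_space)
    have piece: "emeasure lborel (B \<inter> C k) = emeasure lborel (A \<inter> C (\<pi> k))" if k: "k < N" for k
    proof -
      define \<tau> where "\<tau> = (real (\<pi> k) - real k) / real N"
      have shift: "cell_shift N \<pi> x = \<tau> + x" if "x \<in> C k" for x
      proof -
        have x: "x \<in> {0..<1}" using C_sub[OF k] that by blast
        hence "cell N x = k" using C_iff that by blast
        thus ?thesis using x unfolding cell_shift_def \<tau>_def by simp
      qed
      have C_shift: "\<tau> + x \<in> C (\<pi> k) \<longleftrightarrow> x \<in> C k" for x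
      proof -
        have "real (\<pi> k) / real N = \<tau> + real k / real N" "(real (\<pi> k) + 1) / real N = \<tau> + (real k + 1) / real N"
          by (simp_all add: \<tau>_def add_divide_distrib diff_divide_distrib)
        thus ?thesis by (simp add: C_def)
      qed
      have "B \<inter> C k = (\<lambda>x. \<tau> + x) -` (A \<inter> C (\<pi> k)) \<inter> space lborel"
      proof (intro set_eqI iffI)
        fix x assume "x \<in> B \<inter> C k"
        thus "x \<in> (\<lambda>x. \<tau> + x) -` (A \<inter> C (\<pi> k)) \<inter> space lborel"
          using shift[of x] C_shift[of x] by (simp add: B_def)
      next
        fix x assume x: "x \<in> (\<lambda>x. \<tau> + x) -` (A \<inter> C (\<pi> k)) \<inter> space lborel"
        hence "x \<in> C k" using C_shift by simp
        moreover from this have "x \<in> {0..<1}" using C_sub[OF k] by blast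
        ultimately show "x \<in> B \<inter> C k" using x shift[of x] by (simp add: B_def)
      qed
      moreover have "emeasure lborel (A \<inter> C (\<pi> k)) = emeasure (distr lborel borel (\<lambda>x. \<tau> + x)) (A \<inter> C (\<pi> k))"
        by (simp add: lborel_distr_plus)
      moreover have "\<dots> = emeasure lborel ((\<lambda>x. \<tau> + x) -` (A \<inter> C (\<pi> k)) \<inter> space lborel)"
        using A01 by (intro emeasure_distr) (auto simp: C_def)
      ultimately show ?thesis by simp
    qed
    have "emeasure (distr unit_measure unit_measure (cell_shift N \<pi>)) A = emeasure unit_measure B"
      using A ms by (simp add: emeasure_distr B_def)
    also have "\<dots> = (\<Sum>k<N. emeasure lborel (B \<inter> C k))" unfolding e_unit[OF B] by (rule decomp[OF B01(2,1)])
    also have "\<dots> = (\<Sum>k<N. emeasure lborel (A \<inter> C (\<pi> k)))" by (intro sum.cong piece) auto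
    also have "\<dots> = (\<Sum>k<N. emeasure lborel (A \<inter> C k))" using sum.reindex_bij_betw[OF \<pi>] .
    also have "\<dots> = emeasure unit_measure A" unfolding e_unit[OF A] by (rule decomp[OF A01(2,1), symmetric])
    finally show "emeasure (distr unit_measure unit_measure (cell_shift N \<pi>)) A = emeasure unit_measure A" .
  qed simp
qed


lemma extend_to_permutation:
  assumes "I \<subseteq> {..<N::nat}"
  obtains \<pi> where "bij_betw \<pi> {..<N} {..<N}" "\<pi> ` I = {..<card I}"
proof -
  define M where "M = card I"
  have fin: "finite I" using assms finite_subset by blast
  have MN: "M \<le> N" using card_mono[OF _ assms] by (simp add: M_def)
  obtain f where f: "bij_betw f I {..<M}"
    using finite_same_card_bij[OF fin, of "{..<M}"] unfolding M_def by (metis card_lessThan finite_lessThan)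
  have "{..<M} \<subseteq> {..<N}" using MN by simp
  hence "card ({..<N} - I) = card ({..<N} - {..<M})"
    unfolding card_Diff_subset[OF fin assms] card_Diff_subset[OF finite_lessThan] card_lessThan M_def by simp
  then obtain h where h: "bij_betw h ({..<N} - I) ({..<N} - {..<M})"
    using finite_same_card_bij[of "{..<N} - I" "{..<N} - {..<M}"] by (metis finite_Diff finite_lessThan)
  define \<pi> where "\<pi> x = (if x \<in> I then f x else h x)" for x
  have 1: "bij_betw \<pi> I {..<M}" using f by (rule bij_betw_cong[THEN iffD1, rotated]) (simp add: \<pi>_def)
  have 2: "bij_betw \<pi> ({..<N} - I) ({..<N} - {..<M})"
    using h by (rule bij_betw_cong[THEN iffD1, rotated]) (simp add: \<pi>_def)
  have "bij_betw \<pi> (I \<union> ({..<N} - I)) ({..<M} \<union> ({..<N} - {..<M}))"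
    using 1 2 by (rule bij_betw_combine) auto
  moreover have "I \<union> ({..<N} - I) = {..<N}" "{..<M} \<union> ({..<N} - {..<M}) = {..<N}" using assms MN by auto
  ultimately have "bij_betw \<pi> {..<N} {..<N}" by simp
  moreover have "\<pi> ` I = {..<card I}" using 1 by (simp add: bij_betw_def M_def)
  ultimately show ?thesis by (rule that)
qed

definition cells :: "nat \<Rightarrow> nat set \<Rightarrow> real set" where
  "cells N I = {x \<in> {0..<1}. cell N x \<in> I}"

lemma sets_unit_measure_iff: "A \<in> sets unit_measure \<longleftrightarrow> A \<in> sets borel \<and> A \<subseteq> {0..1}"
  unfolding unit_measure_def sets_restrict_space sets_lborel
proof (intro iffI conjI)
  assume "A \<in> sets borel \<and> A \<subseteq> {0..1}"
  thus "A \<in> (\<inter>) {0..1} ` sets borel" by (intro image_eqI[of _ _ A]) auto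
qed auto

lemma measure_unit_measure_eq: "A \<in> sets unit_measure \<Longrightarrow> measure unit_measure A = measure lborel A"
  unfolding unit_measure_def by (subst measure_restrict_space) (auto simp: sets_restrict_space)

lemma cells_measurable [measurable]: "cells N I \<in> sets unit_measure"
proof -
  have "cells N I = {x \<in> space borel. x \<in> {0..<1} \<and> cell N x \<in> I}" by (auto simp: cells_def)
  also have "\<dots> \<in> sets borel" unfolding cell_def by measurable
  finally show ?thesis unfolding sets_unit_measure_iff by (auto simp: cells_def)
qed

lemma cells_initial:
  assumes "0 < N" "M \<le> N"
  shows "cells N {..<M} = {0..<real M / real N}"
proof (intro set_eqI iffI)
  fix x assume "x \<in> cells N {..<M}"
  hence x: "x \<in> {0..<1}" "cell N x < M" by (auto simp: cells_def)
  have "x < (real (cell N x) + 1) / real N" using cell_iff[of N x "cell N x"] assms x by auto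
  also have "\<dots> \<le> real M / real N" using x assms by (intro divide_right_mono) auto
  finally show "x \<in> {0..<real M / real N}" using x by auto
next
  fix x assume x: "x \<in> {0..<real M / real N}"
  moreover have "real M / real N \<le> 1" using assms by (simp add: divide_le_eq)
  ultimately have x1: "x \<in> {0..<1}" by auto
  have "real (cell N x) / real N \<le> x" using cell_iff[of N x "cell N x"] assms x1 by auto
  hence "real (cell N x) / real N < real M / real N" using x by auto
  hence "cell N x < M" using assms by (simp add: divide_less_cancel)
  thus "x \<in> cells N {..<M}" using x1 by (simp add: cells_def)
qed

text \<open>Squeeze \<open>A\<close> between a compact and an open set. If the mesh is finer than the distance from the compact set to the
complement of the open one, the cells that meet the former lie inside the latter.\<close>

lemma approx_by_cells:
  assumes A: "A \<in> sets unit_measure" and \<epsilon>: "0 < \<epsilon>"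
  obtains N I where "0 < N" "I \<subseteq> {..<N}" 
    "measure unit_measure ((A - cells N I) \<union> (cells N I - A)) \<le> \<epsilon>"
proof -
  have Ab: "A \<in> sets borel" "A \<subseteq> {0..1}" using A by (auto simp: sets_unit_measure_iff)
  hence AL: "A \<in> sets lebesgue" by simp
  obtain V where V: "open V" "A \<subseteq> V" "V - A \<in> lmeasurable" "emeasure lebesgue (V - A) < ennreal (\<epsilon> / 2)"
    by (rule sets_lebesgue_outer_open[OF AL, of "\<epsilon> / 2"]) (use \<epsilon> in simp)
  obtain K where K: "closed K" "K \<subseteq> A" "A - K \<in> lmeasurable" "emeasure lebesgue (A - K) < ennreal (\<epsilon> / 2)"
    by (rule sets_lebesgue_inner_closed[OF AL, of "\<epsilon> / 2"]) (use \<epsilon> in simp)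
  have "bounded K" by (rule bounded_subset[OF bounded_closed_interval[of 0 1]]) (use K(2) Ab(2) in blast)
  hence cK: "compact K" using K(1) by (simp add: compact_eq_bounded_closed)
  have "K \<inter> - V = {}" using K V by auto
  hence "\<exists>d>0. \<forall>x\<in>K. \<forall>y\<in>- V. d \<le> dist x y"
    using V(1) by (intro separate_compact_closed[OF cK]) (simp_all add: closed_Compl)
  then obtain d where d: "0 < d" "\<And>x y. x \<in> K \<Longrightarrow> y \<in> - V \<Longrightarrow> d \<le> dist x y"
    by blast
  obtain N where N: "0 < N" "1 / real N < d"
    using real_arch_inverse[of d] d(1) unfolding inverse_eq_divide by blast
  \<comment> \<open>The point \<open>1\<close> lies in no cell; it is a null set and is set aside.\<close>
  define I where "I = {k. k < N \<and> (\<exists>x\<in>K \<inter> {0..<1}. cell N x = k)}"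
  have up: "cells N I \<subseteq> V"
  proof
    fix y assume "y \<in> cells N I"
    then obtain x where x: "x \<in> K" "x \<in> {0..<1}" "cell N x = cell N y" and y: "y \<in> {0..<1}"
      by (auto simp: cells_def I_def)
    have "real (cell N y) / real N \<le> y \<and> y < (real (cell N y) + 1) / real N"
      "real (cell N y) / real N \<le> x \<and> x < (real (cell N y) + 1) / real N"
      using cell_iff[OF N(1), of y "cell N y"] cell_iff[OF N(1), of x "cell N y"] x y by auto
    moreover have "(real (cell N y) + 1) / real N = real (cell N y) / real N + 1 / real N"
      by (simp add: add_divide_distrib)
    ultimately have "dist x y < d" using N(2) unfolding dist_real_def by linarith
    thus "y \<in> V" using d(2)[OF x(1), of y] by force
  qed
  have lo: "K - {1} \<subseteq> cells N I"
  proof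
    fix x assume x: "x \<in> K - {1}"
    hence "x \<in> {0..<1}" using K(2) Ab(2) by (force simp: less_le)
    thus "x \<in> cells N I" using x cell_less[OF N(1)] by (auto simp: cells_def I_def)
  qed
  define E where "E = (A - cells N I) \<union> (cells N I - A)"
  have E: "E \<in> sets unit_measure" unfolding E_def using A by auto
  have "E \<subseteq> (V - A) \<union> (A - K) \<union> {1}" unfolding E_def using up lo by auto
  moreover have sets: "V - A \<in> sets lborel" "A - K \<in> sets lborel" "{1::real} \<in> sets lborel"
    using V(1) K(1) Ab(1) by auto
  ultimately have "emeasure lborel E \<le> emeasure lborel ((V - A) \<union> (A - K) \<union> {1})"
    by (intro emeasure_mono sets.Un)
  also have "\<dots> \<le> emeasure lborel ((V - A) \<union> (A - K)) + emeasure lborel {1::real}"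
    using sets by (intro emeasure_subadditive sets.Un)
  also have "\<dots> \<le> (emeasure lborel (V - A) + emeasure lborel (A - K)) + 0"
    using sets by (intro add_mono emeasure_subadditive) simp_all
  also have "\<dots> \<le> ennreal (\<epsilon> / 2) + ennreal (\<epsilon> / 2) + 0"
    using V(4) K(4) sets by (intro add_mono) (simp_all add: main_part_sets less_imp_le)
  also have "\<dots> = ennreal \<epsilon>" using \<epsilon> by (simp flip: ennreal_plus)
  finally have "emeasure lborel E \<le> ennreal \<epsilon>" .
  hence "measure lborel E \<le> \<epsilon>" using \<epsilon> by (simp add: measure_def enn2real_leI)
  thus ?thesis using E N(1) that[of N I] by (simp add: I_def[symmetric] E_def measure_unit_measure_eq) (auto simp: I_def)
qed

text \<open>An exact measure isomorphism moving \<open>A\<close> to an initial interval is never constructed: the cut distance is an infimum, so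
it suffices to move a union of cells close to \<open>A\<close> onto the initial cells. The points where the rearranged bipodal
graphon then disagrees with \<open>g\<close> have a coordinate in a set of small measure.\<close>

lemma cut_distance_two_block:
  assumes g: "graphon g" and abd: "a \<in> {0..1}" "b \<in> {0..1}" "d \<in> {0..1}" and c: "0 \<le> c" "c \<le> 1"
    and A: "A \<in> sets unit_measure" "measure unit_measure A = c"
    and AE: "AE (x, y) in unit_square.
          g x y = (if x \<in> A then if y \<in> A then a else d else if y \<in> A then d else b)"
  shows "cut_distance g (bipodal a b c d) = 0"
proof (rule cut_distance_zeroI[OF g graphon_bipodal[OF abd]])
  fix \<epsilon> :: real assume "\<epsilon> > 0"
  obtain N I where N: "0 < N" and I: "I \<subseteq> {..<N}" 
    and m1: "measure unit_measure ((A - cells N I) \<union> (cells N I - A)) \<le> \<epsilon> / 4"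
    by (rule approx_by_cells[OF A(1), of "\<epsilon> / 4"]) (use \<open>\<epsilon> > 0\<close> in auto)
  obtain \<pi> where \<pi>: "bij_betw \<pi> {..<N} {..<N}" "\<pi> ` I = {..<card I}"
    by (rule extend_to_permutation[OF I])
  define \<sigma> where "\<sigma> = cell_shift N \<pi>"
  have \<sigma>: "rearrangement \<sigma>" unfolding \<sigma>_def by (rule rearrangement_cell_shift[OF N \<pi>(1)])
  have ms [measurable]: "\<sigma> \<in> measurable unit_measure unit_measure"
    and ds: "distr unit_measure unit_measure \<sigma> = unit_measure" using \<sigma> by (auto simp: rearrangement_def)
  have pre: "measure unit_measure (\<sigma> -` B \<inter> {0..1}) = measure unit_measure B" if "B \<in> sets unit_measure" for B
    using measure_distr[OF ms that] by (simp add: ds)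
  have cI: "card I \<le> N" using card_mono[OF _ I] by simp
  define m where "m = real (card I) / real N"
  have m: "0 \<le> m" "m \<le> 1" using cI N by (auto simp: m_def divide_le_eq)
  have init: "cells N {..<card I} = {0..<m}" unfolding m_def by (rule cells_initial[OF N cI])
  have meas_Ico: "{0..<r} \<in> sets unit_measure" "measure unit_measure {0..<r} = r" if "0 \<le> r" "r \<le> 1" for r :: real
  proof -
    show 1: "{0..<r} \<in> sets unit_measure" using that by (auto simp: sets_unit_measure_iff)
    show "measure unit_measure {0..<r} = r" using that by (simp add: measure_unit_measure_eq[OF 1])
  qed
  have \<sigma>_cells: "\<sigma> -` {0..<m} \<inter> {0..<1} = cells N I"
  proof -
    have "\<pi> k \<in> {..<card I} \<longleftrightarrow> k \<in> I" if "k < N" for k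
      using \<pi> I that by (metis bij_betw_def image_eqI inj_on_image_mem_iff lessThan_iff)
    moreover have "\<pi> ` {..<N} \<subseteq> {..<N}" using \<pi>(1) by (auto simp: bij_betw_def)
    ultimately show ?thesis
      unfolding init[symmetric] using cell_shift[OF N, of _ \<pi>] cell_less[OF N] by (auto simp: cells_def \<sigma>_def)
  qed
  define A' where "A' = \<sigma> -` {..<c} \<inter> {0..1}"
  define E where "E = (A - cells N I) \<union> (cells N I - A)"
  \<comment> \<open>The image \<open>{0..<m}\<close> of the cells and the block \<open>{0..<c}\<close> differ by \<open>G\<close>, of measure \<open>\<bar>m - c\<bar>\<close>.\<close>
  define G where "G = {min m c..<max m c}"
  define G' where "G' = \<sigma> -` G \<inter> {0..1}"
  have E [measurable]: "E \<in> sets unit_measure" unfolding E_def using A by auto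
  have Gs: "G \<in> sets unit_measure" using m c by (auto simp: sets_unit_measure_iff G_def)
  have mG: "measure unit_measure G = \<bar>m - c\<bar>"
    unfolding measure_unit_measure_eq[OF Gs] by (auto simp: G_def min_def max_def)
  have G's [measurable]: "G' \<in> sets unit_measure" using measurable_sets[OF ms Gs] by (simp add: G'_def)
  have mG': "measure unit_measure G' = \<bar>m - c\<bar>" unfolding G'_def pre[OF Gs] mG ..
  have m_cells: "measure unit_measure (cells N I) = m"
  proof -
    have "measure unit_measure (\<sigma> -` {0..<m} \<inter> {0..1}) = m" using pre meas_Ico m by simp
    moreover have "measure unit_measure (\<sigma> -` {0..<m} \<inter> {0..1}) = measure unit_measure (cells N I)"
    proof (rule U.finite_measure_eq_AE)
      have "AE x in unit_measure. x \<noteq> 1"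
        by (rule AE_I[of _ _ "{1}"]) (auto simp: unit_measure_def emeasure_restrict_space sets_restrict_space)
      thus "AE x in unit_measure. (x \<in> \<sigma> -` {0..<m} \<inter> {0..1}) = (x \<in> cells N I)"
        unfolding \<sigma>_cells[symmetric] by eventually_elim auto
    qed (use measurable_sets[OF ms meas_Ico(1)[OF m]] in auto)
    ultimately show ?thesis by simp
  qed
  have "\<bar>m - c\<bar> \<le> \<epsilon> / 4"
  proof -
    have "measure unit_measure A \<le> measure unit_measure (cells N I \<union> E)"
      using A by (intro U.finite_measure_mono) (auto simp: E_def)
    also have "\<dots> \<le> m + measure unit_measure E"
      unfolding m_cells[symmetric] by (rule measure_Un_le[OF cells_measurable E])
    finally have 1: "c \<le> m + \<epsilon> / 4" using A m1 by (simp add: E_def)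
    have "measure unit_measure (cells N I) \<le> measure unit_measure (A \<union> E)"
      using A by (intro U.finite_measure_mono) (auto simp: E_def)
    also have "\<dots> \<le> c + measure unit_measure E"
      unfolding A(2)[symmetric] by (rule measure_Un_le[OF A(1) E])
    finally have 2: "m \<le> c + \<epsilon> / 4" using m_cells m1 by (simp add: E_def)
    show ?thesis using 1 2 by linarith
  qed
  define Q where "Q = E \<union> G' \<union> {1}"
  have Q [measurable]: "Q \<in> sets unit_measure" unfolding Q_def using E G's by (auto simp: sets_unit_measure_iff)
  have mQ: "measure unit_measure Q \<le> \<epsilon> / 2"
  proof -
    have s1: "{1::real} \<in> sets unit_measure" by (simp add: sets_unit_measure_iff)
    have "measure unit_measure Q \<le> measure unit_measure E + measure unit_measure G' + measure unit_measure {1}"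
      unfolding Q_def using measure_Un_le[OF E G's]
        measure_Un_le[OF sets.Un[OF E G's] s1] by simp
    moreover have "measure unit_measure {1::real} = 0" by (simp add: measure_unit_measure_eq[OF s1])
    ultimately show ?thesis using m1 mG' \<open>\<bar>m - c\<bar> \<le> \<epsilon> / 4\<close> by (simp add: E_def)
  qed
  have agree: "x \<in> A \<longleftrightarrow> \<sigma> x < c" if "x \<in> {0..1}" "x \<notin> Q" for x
  proof -
    have x: "x \<in> {0..<1}" "x \<notin> E" "x \<notin> G'" using that by (auto simp: Q_def less_le)
    have \<sigma>0: "0 \<le> \<sigma> x" using \<sigma> that(1) by (auto simp: rearrangement_def bij_betw_def)
    have "x \<in> A \<longleftrightarrow> x \<in> cells N I" using x(2) by (auto simp: E_def)
    also have "\<dots> \<longleftrightarrow> \<sigma> x < m" using x(1) \<sigma>0 unfolding \<sigma>_cells[symmetric] by auto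
    also have "\<dots> \<longleftrightarrow> \<sigma> x < c" using x(3) that(1) by (auto simp: G'_def G_def)
    finally show ?thesis .
  qed
  define D where "D = (\<lambda>(x, y). g x y - bipodal a b c d (\<sigma> x) (\<sigma> y))"
  note rm = rearranged_measurable[OF g graphon_bipodal[OF abd, of c] \<sigma>]
  have ID: "integrable unit_square D"
    unfolding D_def by (rule UU_integrable_bounded[of _ 1]) (use rm in auto)
  define W where "W z = indicator Q (fst z) + (indicator Q (snd z) :: real)" for z :: "real \<times> real"
  have IQ: "integrable unit_square (\<lambda>(x, y). indicator Q x :: real)" "integrable unit_square (\<lambda>(x, y). indicator Q y :: real)"
  proof -
    have m: "(\<lambda>(x, y). indicator Q x :: real) \<in> borel_measurable unit_square" "(\<lambda>(x, y). indicator Q y :: real) \<in> borel_measurable unit_square"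
      unfolding case_prod_beta' by measurable
    show "integrable unit_square (\<lambda>(x, y). indicator Q x :: real)"
      by (rule UU_integrable_bounded[OF m(1), of 1]) (simp add: indicator_def)
    show "integrable unit_square (\<lambda>(x, y). indicator Q y :: real)"
      by (rule UU_integrable_bounded[OF m(2), of 1]) (simp add: indicator_def)
  qed
  have EW: "(LINT z|unit_square. W z) \<le> \<epsilon>"
  proof -
    have "(LINT z|unit_square. W z) = (LINT z|unit_square. (case z of (x, y) \<Rightarrow> indicator Q x)) + (LINT z|unit_square. (case z of (x, y) \<Rightarrow> indicator Q y))"
      unfolding W_def using IQ by (simp add: case_prod_beta')
    also have "\<dots> = 2 * measure unit_measure Q"
    proof -
      have "Q \<inter> {0..1} = Q" using Q by (auto simp: sets_unit_measure_iff)
      thus ?thesis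
        unfolding UU_iterated(1)[OF IQ(1), symmetric] UU_iterated(1)[OF IQ(2), symmetric]
        using Q by (simp add: U.emeasure_eq_measure)
    qed
    finally show ?thesis using mQ by simp
  qed
  have "(LINT z|unit_square. \<bar>D z\<bar>) \<le> (LINT z|unit_square. W z)"
  proof (rule integral_mono_AE)
    show "integrable unit_square W" unfolding W_def using IQ by (auto simp: case_prod_beta')
    show "AE z in unit_square. \<bar>D z\<bar> \<le> W z"
      using AE
    proof (rule AE_mp, intro AE_I2 impI)
      fix z assume z: "z \<in> space unit_square"
        and eq: "case z of (x, y) \<Rightarrow> g x y = (if x \<in> A then if y \<in> A then a else d else if y \<in> A then d else b)"
      obtain x y where [simp]: "z = (x, y)" by fastforce
      have xy: "x \<in> {0..1}" "y \<in> {0..1}" using z by (auto simp: space_pair_measure)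
      show "\<bar>D z\<bar> \<le> W z"
      proof (cases "x \<in> Q \<or> y \<in> Q")
        case True
        hence "1 \<le> W z" by (auto simp: W_def)
        thus ?thesis using rm(2)[OF xy] by (simp add: D_def)
      next
        case False
        hence "D z = 0" using eq agree xy by (simp add: D_def bipodal_eq)
        thus ?thesis by (simp add: W_def)
      qed
    qed
  qed (use ID in auto)
  hence "(LINT z|unit_square. \<bar>D z\<bar>) \<le> \<epsilon>" using EW by linarith
  thus "\<exists>\<sigma>. rearrangement \<sigma> \<and> (LINT z|unit_square. \<bar>case z of (x, y) \<Rightarrow> g x y - bipodal a b c d (\<sigma> x) (\<sigma> y)\<bar>) \<le> \<epsilon>"
    using \<sigma> by (intro exI[of _ \<sigma>]) (simp add: D_def)
qed

section \<open>Separately holomorphic functions have double power series\<close>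

text \<open>Outside the disc of radius \<open>R/2\<close> the bound is immediate, and the maximum principle carries it inside.\<close>

lemma holomorphic_difference_quotient:
  fixes f :: "complex \<Rightarrow> complex"
  assumes hol: "f holomorphic_on ball 0 R" and bd: "\<And>u. cmod u < R \<Longrightarrow> cmod (f u) \<le> B" and R: "0 < R"
  defines "g \<equiv> \<lambda>u. if u = 0 then deriv f 0 else (f u - f 0) / u"
  shows "g holomorphic_on ball 0 R" "\<And>u. cmod u < R \<Longrightarrow> cmod (g u) \<le> 4 * B / R"
proof -
  have B0: "0 \<le> B" using order_trans[OF norm_ge_zero bd[of 0]] R by simp
  show "g holomorphic_on ball 0 R"
    using pole_lemma_open[OF hol, of 0] unfolding g_def by (simp only: diff_0_right open_ball)
  hence g_hol: "g holomorphic_on ball 0 R" .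
  have outer: "cmod (g u) \<le> 4 * B / R" if "R / 2 \<le> cmod u" "cmod u < R" for u
  proof -
    have "u \<noteq> 0" using that R by auto
    hence "cmod (g u) = cmod (f u - f 0) / cmod u" by (simp add: g_def norm_divide)
    also have "\<dots> \<le> (B + B) / (R / 2)"
      using norm_triangle_ineq4[of "f u" "f 0"] bd[of u] bd[of 0] that R B0 by (intro frac_le) auto
    finally show ?thesis by simp
  qed
  fix u :: complex assume u: "cmod u < R"
  show "cmod (g u) \<le> 4 * B / R"
  proof (cases "R / 2 \<le> cmod u")
    case False
    have "cmod (g u) \<le> 4 * B / R"
    proof (rule maximum_modulus_frontier[of g "ball 0 (R/2)"])
      show "g holomorphic_on interior (ball 0 (R/2))"
        using g_hol R by (auto intro: holomorphic_on_subset)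
      have "closure (ball (0::complex) (R/2)) \<subseteq> ball 0 R" using R by auto
      thus "continuous_on (closure (ball 0 (R/2))) g"
        using g_hol by (meson continuous_on_subset holomorphic_on_imp_continuous_on)
      show "\<And>z. z \<in> frontier (ball 0 (R/2)) \<Longrightarrow> cmod (g z) \<le> 4 * B / R"
        using R by (intro outer) auto
    qed (use False in auto)
    thus ?thesis .
  qed (use outer u in auto)
qed

text \<open>Holomorphic in each variable separately, with a bound that replaces joint continuity.\<close>

definition sep_holomorphic :: "(complex \<Rightarrow> complex \<Rightarrow> complex) \<Rightarrow> real \<Rightarrow> real \<Rightarrow> bool" where
  "sep_holomorphic f R B \<longleftrightarrow> 
     (\<forall>v\<in>ball 0 R. (\<lambda>u. f u v) holomorphic_on ball 0 R) \<and>
     (\<forall>u\<in>ball 0 R. (\<lambda>v. f u v) holomorphic_on ball 0 R) \<and>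
     (\<forall>u\<in>ball 0 R. \<forall>v\<in>ball 0 R. cmod (f u v) \<le> B)"

definition divide_out :: "(complex \<Rightarrow> complex \<Rightarrow> complex) \<Rightarrow> complex \<Rightarrow> complex \<Rightarrow> complex" where
  "divide_out f u v = (if u = 0 then deriv (\<lambda>u. f u v) 0 else (f u v - f 0 v) / u)"

text \<open>Holomorphy in \<open>v\<close> at \<open>u = 0\<close> is the only point that is not formal: there the function is a uniform limit of its values
at nonzero \<open>u\<close>, by the Lipschitz bound coming from a second difference quotient.\<close>

lemma sep_holomorphic_divide_out:
  assumes f: "sep_holomorphic f R B" and R: "0 < R"
  shows "sep_holomorphic (divide_out f) R (4 * B / R)"
proof -
  let ?g = "divide_out f"
  have u_part: "(\<lambda>u. ?g u v) holomorphic_on ball 0 R" "\<And>u. cmod u < R \<Longrightarrow> cmod (?g u v) \<le> 4 * B / R"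
    if "v \<in> ball 0 R" for v
    unfolding divide_out_def using f that R
    by (intro holomorphic_difference_quotient[of "\<lambda>u. f u v" R B]; simp add: sep_holomorphic_def)+
  have v_part: "(\<lambda>v. ?g u v) holomorphic_on ball 0 R" if "u \<in> ball 0 R" "u \<noteq> 0" for u
  proof -
    have "(\<lambda>v. (f u v - f 0 v) / u) holomorphic_on ball 0 R"
      using f that R by (auto simp: sep_holomorphic_def intro!: holomorphic_intros)
    thus ?thesis using that by (simp add: divide_out_def)
  qed
  have "(\<lambda>v. ?g 0 v) holomorphic_on ball 0 R"
  proof (rule holomorphic_uniform_sequence[where f = "\<lambda>n v. ?g (of_real (R / (2 + real n))) v"])
    have un: "of_real (R / (2 + real n)) \<in> ball (0::complex) R" for n
    proof -
      have "R / (2 + real n) < R" "0 < R / (2 + real n)" using R by (simp_all add: divide_less_eq)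
      thus ?thesis unfolding mem_ball_0 norm_of_real by simp
    qed
    show "(\<lambda>v. ?g (of_real (R / (2 + real n))) v) holomorphic_on ball 0 R" for n
    proof (rule v_part[OF un])
      show "of_real (R / (2 + real n)) \<noteq> (0::complex)"
        unfolding of_real_eq_0_iff using R by simp
    qed
    fix v0 :: complex assume v0: "v0 \<in> ball 0 R"
    obtain d where d: "0 < d" "cball v0 d \<subseteq> ball 0 R"
      using open_contains_cball_eq[OF open_ball] v0 by blast
    have lip: "cmod (?g u v - ?g 0 v) \<le> 4 * (4 * B / R) / R * cmod u" if "v \<in> ball 0 R" "u \<in> ball 0 R" for u v
    proof (cases "u = 0")
      case False
      have "cmod ((?g u v - ?g 0 v) / u) \<le> 4 * (4 * B / R) / R"
        using holomorphic_difference_quotient(2)[OF u_part(1)[OF that(1)] u_part(2)[OF that(1)] R, of u] that False by simp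
      moreover have "0 < cmod u" using False by simp
      ultimately show ?thesis unfolding norm_divide by (simp only: pos_divide_le_eq)
    qed auto
    have "uniform_limit (cball v0 d) (\<lambda>n. ?g (of_real (R / (2 + real n)))) (?g 0) sequentially"
    proof (rule uniform_limitI)
      fix \<epsilon> :: real assume "\<epsilon> > 0"
      have "(\<lambda>n. 4 * (4 * B / R) / R * (R / (2 + real n))) \<longlonglongrightarrow> 0"
        by real_asymp
      hence "\<forall>\<^sub>F n in sequentially. 4 * (4 * B / R) / R * (R / (2 + real n)) < \<epsilon>"
        using \<open>\<epsilon> > 0\<close> by (rule order_tendstoD(2))
      thus "\<forall>\<^sub>F n in sequentially. \<forall>v\<in>cball v0 d. dist (?g (of_real (R / (2 + real n))) v) (?g 0 v) < \<epsilon>"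
      proof (rule eventually_mono, intro ballI)
        fix n v assume n: "4 * (4 * B / R) / R * (R / (2 + real n)) < \<epsilon>" and v: "v \<in> cball v0 d"
        have "cmod (of_real (R / (2 + real n))) = R / (2 + real n)" using R by (simp only: norm_of_real) simp
        thus "dist (?g (of_real (R / (2 + real n))) v) (?g 0 v) < \<epsilon>"
          using lip[OF subsetD[OF d(2) v] un[of n]] n unfolding dist_norm by simp
      qed
    qed
    with d show "\<exists>d>0. cball v0 d \<subseteq> ball 0 R \<and> uniform_limit (cball v0 d) (\<lambda>n. ?g (of_real (R / (2 + real n)))) (?g 0) sequentially"
      by blast
  qed auto
  thus ?thesis unfolding sep_holomorphic_def using u_part v_part by (metis mem_ball_0)
qed

text \<open>Dividing out \<open>u\<close> repeatedly gives \<open>f u v = (\<Sum>i<n. F i 0 v * u ^ i) + u ^ n * F n u v\<close> with \<open>F n\<close> bounded by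
\<open>(4/R) ^ n * B\<close>. The coefficients \<open>F i 0\<close> are holomorphic in \<open>v\<close>, and Cauchy's inequality makes the resulting double
series absolutely convergent.\<close>

lemma double_power_series:
  assumes f: "sep_holomorphic f R B" and R: "0 < R"
  shows "\<exists>\<alpha> :: nat \<Rightarrow> nat \<Rightarrow> complex. \<forall>u v. cmod u < R / 8 \<and> cmod v < R / 8 \<longrightarrow>
     ((\<lambda>(i, j). \<alpha> i j * u ^ i * v ^ j) has_sum f u v) UNIV"
proof -
  define F where "F n = (divide_out ^^ n) f" for n
  define B' where "B' n = (4 / R) ^ n * B" for n
  have FS: "F (Suc n) = divide_out (F n)" for n by (simp add: F_def)
  have F: "sep_holomorphic (F n) R (B' n)" for n
  proof (induction n)
    case 0 thus ?case using f by (simp add: F_def B'_def)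
  next
    case (Suc n)
    have "4 * B' n / R = B' (Suc n)" by (simp add: B'_def)
    thus ?case using sep_holomorphic_divide_out[OF Suc R] by (simp add: FS)
  qed
  have B0: "0 \<le> B" using f R unfolding sep_holomorphic_def
    by (metis centre_in_ball norm_ge_zero order_trans)
  define \<alpha> where "\<alpha> i j = (deriv ^^ j) (F i 0) 0 / fact j" for i j
  have a_hol: "F i 0 holomorphic_on ball 0 R" for i
    using F[of i] R by (simp add: sep_holomorphic_def)
  have \<alpha>_bound: "cmod (\<alpha> i j) \<le> B' i * (2 / R) ^ j" for i j
  proof -
    have "cmod ((deriv ^^ j) (F i 0) 0) \<le> fact j * B' i / (R / 2) ^ j"
    proof (rule Cauchy_inequality)
      show "F i 0 holomorphic_on ball 0 (R / 2)" using R by (intro holomorphic_on_subset[OF a_hol]) auto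
      have "cball (0::complex) (R / 2) \<subseteq> ball 0 R" using R by auto
      thus "continuous_on (cball 0 (R / 2)) (F i 0)"
        using a_hol by (meson continuous_on_subset holomorphic_on_imp_continuous_on)
      show "cmod (F i 0 x) \<le> B' i" if "cmod (0 - x) = R / 2" for x
        using F[of i] R that by (auto simp: sep_holomorphic_def)
    qed (use R in auto)
    hence "cmod ((deriv ^^ j) (F i 0) 0) / fact j \<le> (fact j * B' i / (R / 2) ^ j) / fact j"
      by (intro divide_right_mono) auto
    also have "\<dots> = B' i * (2 / R) ^ j" using R by (simp add: power_divide)
    finally show ?thesis by (simp add: \<alpha>_def norm_divide)
  qed
  show ?thesis
  proof (intro exI[of _ \<alpha>] allI impI)
    fix u v :: complex assume uv: "cmod u < R / 8 \<and> cmod v < R / 8"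
    define T where "T = (\<lambda>(i, j). \<alpha> i j * u ^ i * v ^ j)"
    have T_bound: "cmod (T (i, j)) \<le> B * ((1/2) ^ i * (1/2) ^ j)" for i j
    proof -
      have "cmod (T (i, j)) \<le> (B' i * (2 / R) ^ j) * (R / 8) ^ i * (R / 8) ^ j"
        unfolding T_def prod.case norm_mult norm_power using \<alpha>_bound[of i j] uv R B0
        by (intro mult_mono power_mono) (auto simp: B'_def)
      also have "\<dots> = B * ((4 / R * (R / 8)) ^ i * (2 / R * (R / 8)) ^ j)"
        unfolding B'_def power_mult_distrib by (simp only: mult_ac)
      also have "\<dots> = B * ((1/2) ^ i * (1/4) ^ j)" using R by simp
      also have "\<dots> \<le> B * ((1/2) ^ i * (1/2) ^ j)"
        using B0 by (intro mult_left_mono power_mono) auto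
      finally show ?thesis .
    qed
    have geo: "((\<lambda>j. (1/2) ^ j) has_sum (2::real)) UNIV"
      using geometric_sums[of "1/2::real"] by (intro sums_nonneg_imp_has_sum) auto
    have "(\<lambda>(i, j). (1/2::real) ^ i * (1/2) ^ j) summable_on UNIV \<times> UNIV"
    proof (rule summable_on_SigmaI[where g = "\<lambda>i. (1/2) ^ i * 2"])
      show "((\<lambda>j. case (i, j) of (i, j) \<Rightarrow> (1/2::real) ^ i * (1/2) ^ j) has_sum (1/2) ^ i * 2) UNIV" for i
        using has_sum_cmult_right[OF geo, of "(1/2) ^ i"] by simp
      show "(\<lambda>i. (1/2::real) ^ i * 2) summable_on UNIV"
        using has_sum_cmult_left[OF geo, of 2] by (auto simp: summable_on_def)
    qed auto
    hence sg: "(\<lambda>p. B * (case p of (i, j) \<Rightarrow> (1/2::real) ^ i * (1/2) ^ j)) summable_on UNIV"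
      by (intro summable_on_cmult_right) simp
    have T_summable: "T summable_on UNIV"
    proof (rule abs_summable_summable, rule summable_on_comparison_test[OF sg])
      show "norm (T p) \<le> B * (case p of (i, j) \<Rightarrow> (1/2::real) ^ i * (1/2) ^ j)" for p
        using T_bound by (cases p) simp
    qed auto
    have inner: "((\<lambda>j. T (i, j)) has_sum (F i 0 v * u ^ i)) UNIV" for i
    proof -
      have "v \<in> ball 0 R" using uv R by auto
      from holomorphic_power_series[OF a_hol this] have "(\<lambda>j. \<alpha> i j * v ^ j) sums F i 0 v"
        by (simp add: \<alpha>_def)
      hence "(\<lambda>j. u ^ i * (\<alpha> i j * v ^ j)) sums (u ^ i * F i 0 v)" by (rule sums_mult)
      hence s: "(\<lambda>j. T (i, j)) sums (F i 0 v * u ^ i)" by (simp add: T_def mult_ac)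
      have "summable (\<lambda>j. B * (1/2) ^ i * (1/2::real) ^ j)" by (intro summable_mult) simp
      hence "summable (\<lambda>j. norm (T (i, j)))"
        by (rule summable_comparison_test_ev[rotated]) (intro always_eventually allI, simp only: real_norm_def abs_norm_cancel mult.assoc, rule T_bound)
      thus ?thesis using s by (rule norm_summable_imp_has_sum)
    qed
    have outer: "((\<lambda>i. F i 0 v * u ^ i) has_sum f u v) UNIV"
    proof (rule norm_summable_imp_has_sum)
      have partial: "f u v = (\<Sum>i<n. F i 0 v * u ^ i) + u ^ n * F n u v" for n
      proof (induction n)
        case (Suc n)
        have "F n u v = F n 0 v + u * F (Suc n) u v"
          unfolding FS by (cases "u = 0") (simp_all add: divide_out_def)
        thus ?case using Suc by (simp add: algebra_simps)
      qed (simp add: F_def)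
      have Fb: "cmod (F n w v) * cmod u ^ n \<le> B * (1/2) ^ n" if "w \<in> ball 0 R" for n w
      proof -
        have "cmod (F n w v) * cmod u ^ n \<le> B' n * (R / 8) ^ n"
          using F[of n] uv R B0 that by (intro mult_mono power_mono) (auto simp: sep_holomorphic_def B'_def)
        also have "\<dots> = B * (4 / R * (R / 8)) ^ n"
          unfolding B'_def power_mult_distrib by (simp only: mult_ac)
        finally show ?thesis using R by simp
      qed
      have "summable (\<lambda>n. B * (1/2::real) ^ n)" by (intro summable_mult) simp
      thus "summable (\<lambda>i. norm (F i 0 v * u ^ i))"
        by (rule summable_comparison_test_ev[rotated]) (use Fb[of 0] R in \<open>auto simp: norm_mult norm_power\<close>)
      have "(\<lambda>n. u ^ n * F n u v) \<longlonglongrightarrow> 0"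
      proof (rule Lim_null_comparison)
        show "\<forall>\<^sub>F n in sequentially. norm (u ^ n * F n u v) \<le> B * (1/2) ^ n"
          using Fb[of u] uv R by (auto simp: norm_mult norm_power mult.commute)
        show "(\<lambda>n. B * (1/2::real) ^ n) \<longlonglongrightarrow> 0" by real_asymp
      qed
      hence "(\<lambda>n. f u v - u ^ n * F n u v) \<longlonglongrightarrow> f u v - 0" by (intro tendsto_diff tendsto_const)
      moreover have "f u v - u ^ n * F n u v = (\<Sum>i<n. F i 0 v * u ^ i)" for n
        using partial[of n] by simp
      ultimately show "(\<lambda>i. F i 0 v * u ^ i) sums f u v" by (simp add: sums_def)
    qed
    have "(T has_sum f u v) (UNIV \<times> UNIV)"
      using inner outer T_summable by (intro has_sum_SigmaI) auto
    thus "((\<lambda>(i, j). \<alpha> i j * u ^ i * v ^ j) has_sum f u v) UNIV" by (simp add: T_def)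
  qed
qed

lemma real_analytic2_onI:
  fixes h :: "real \<times> real \<Rightarrow> real"
  assumes "\<And>x0 y0. (x0, y0) \<in> S \<Longrightarrow> \<exists>R>0. \<exists>B f. sep_holomorphic f R B \<and>
     (\<forall>x y. (x, y) \<in> S \<longrightarrow> \<bar>x - x0\<bar> < R \<longrightarrow> \<bar>y - y0\<bar> < R \<longrightarrow> h (x, y) = Re (f (of_real (x - x0)) (of_real (y - y0))))"
  shows "real_analytic2_on h S"
  unfolding real_analytic2_on_def
proof (intro ballI, clarify)
  fix x0 y0 assume "(x0, y0) \<in> S"
  then obtain R B f where R: "R > 0" and f: "sep_holomorphic f R B"
    and h: "\<And>x y. (x, y) \<in> S \<Longrightarrow> \<bar>x - x0\<bar> < R \<Longrightarrow> \<bar>y - y0\<bar> < R \<Longrightarrow> h (x, y) = Re (f (of_real (x - x0)) (of_real (y - y0)))"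
    using assms by meson
  from double_power_series[OF f R] obtain \<alpha> where \<alpha>: "\<And>u v. cmod u < R / 8 \<Longrightarrow> cmod v < R / 8 \<Longrightarrow>
     ((\<lambda>(i, j). \<alpha> i j * u ^ i * v ^ j) has_sum f u v) UNIV" by meson
  have sum: "((\<lambda>(i, j). Re (\<alpha> i j) * u ^ i * v ^ j) has_sum Re (f (of_real u) (of_real v))) UNIV"
    if "\<bar>u\<bar> < R / 8" "\<bar>v\<bar> < R / 8" for u v :: real
  proof -
    have "((\<lambda>p. Re (case p of (i, j) \<Rightarrow> \<alpha> i j * of_real u ^ i * of_real v ^ j)) has_sum Re (f (of_real u) (of_real v))) UNIV"
      using that by (intro has_sum_Re \<alpha>) auto
    moreover have "Re (case p of (i, j) \<Rightarrow> \<alpha> i j * of_real u ^ i * of_real v ^ j) = (case p of (i, j) \<Rightarrow> Re (\<alpha> i j) * u ^ i * v ^ j)" for p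
      by (cases p) (simp flip: of_real_power)
    ultimately show ?thesis by simp
  qed
  show "\<exists>r>0. \<exists>\<alpha>. (\<forall>u v. \<bar>u\<bar> < r \<and> \<bar>v\<bar> < r \<longrightarrow> (\<lambda>(i, j). \<alpha> i j * u ^ i * v ^ j) summable_on UNIV) \<and>
     (\<forall>(x, y)\<in>S. \<bar>x - x0\<bar> < r \<and> \<bar>y - y0\<bar> < r \<longrightarrow>
       ((\<lambda>(i, j). \<alpha> i j * (x - x0) ^ i * (y - y0) ^ j) has_sum h (x, y)) UNIV)"
  proof (intro exI[of _ "R / 8"] exI[of _ "\<lambda>i j. Re (\<alpha> i j)"] conjI)
    show "\<forall>u v. \<bar>u\<bar> < R / 8 \<and> \<bar>v\<bar> < R / 8 \<longrightarrow> (\<lambda>(i, j). Re (\<alpha> i j) * u ^ i * v ^ j) summable_on UNIV"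
      using sum by (auto simp: summable_on_def)
    show "\<forall>(x, y)\<in>S. \<bar>x - x0\<bar> < R / 8 \<and> \<bar>y - y0\<bar> < R / 8 \<longrightarrow>
       ((\<lambda>(i, j). Re (\<alpha> i j) * (x - x0) ^ i * (y - y0) ^ j) has_sum h (x, y)) UNIV"
    proof (clarify)
      fix x y assume "(x, y) \<in> S" "\<bar>x - x0\<bar> < R / 8" "\<bar>y - y0\<bar> < R / 8"
      thus "((\<lambda>(i, j). Re (\<alpha> i j) * (x - x0) ^ i * (y - y0) ^ j) has_sum h (x, y)) UNIV"
        using sum[of "x - x0" "y - y0"] h[of x y] R by simp
    qed
  qed (use R in auto)
qed

section \<open>Taylor remainders of ln cosh and tanh in the complex domain\<close>

lemma Re_cosh_pos: "cmod z < 1 \<Longrightarrow> 0 < Re (cosh z)"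
proof -
  assume "cmod z < 1"
  hence "\<bar>Im z\<bar> < 1" using abs_Im_le_cmod[of z] by linarith
  hence "\<bar>Im z\<bar> < pi / 2" using pi_gt3 by linarith
  hence "0 < cos (Im z)" by (intro cos_gt_zero_pi) linarith+
  moreover have "0 < exp (Re z) + exp (- Re z)" by (simp add: add_pos_pos)
  moreover have "Re (cosh z) = cos (Im z) * (exp (Re z) + exp (- Re z)) / 2"
    by (simp add: cosh_conv_cos Re_cos)
  ultimately show ?thesis by (simp only:) (simp add: divide_pos_pos mult_pos_pos)
qed

lemma cosh_neq_0_disc: "cmod z < 1 \<Longrightarrow> cosh z \<noteq> 0"
  using Re_cosh_pos[of z] by auto

lemma Ln_cosh_derivative:
  assumes "cmod z < 1"
  shows "((\<lambda>z. Ln (cosh z)) has_field_derivative tanh z) (at z within S)"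
proof -
  have "cosh z \<notin> \<real>\<^sub>\<le>\<^sub>0" using Re_cosh_pos[OF assms] by (auto simp: complex_nonpos_Reals_iff)
  thus ?thesis unfolding tanh_def by (auto intro!: derivative_eq_intros simp: field_simps)
qed

lemma tanh_holomorphic: "(tanh :: complex \<Rightarrow> complex) holomorphic_on ball 0 (3/4)"
  unfolding holomorphic_on_def field_differentiable_def
  using tanh_tower_derivative[of 0, OF _ cosh_neq_0_disc] by (force simp: tanh_tower_def[of 0])

lemma tanh_tower_bounded: "\<exists>B. \<forall>z\<in>ball 0 (3/4). cmod (tanh_tower n z) \<le> B"
proof -
  have "continuous_on (cball 0 (3/4)) (tanh :: complex \<Rightarrow> complex)"
    using cosh_neq_0_disc by (intro continuous_intros) auto
  hence "continuous_on (cball 0 (3/4)) (tanh_tower n :: complex \<Rightarrow> complex)"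
    unfolding tanh_tower_def by (auto intro!: continuous_intros)
  hence "compact (tanh_tower n ` cball (0::complex) (3/4))" by (intro compact_continuous_image) auto
  hence "bounded (tanh_tower n ` cball (0::complex) (3/4))" by (rule compact_imp_bounded)
  then obtain B where "\<forall>y\<in>tanh_tower n ` cball (0::complex) (3/4). norm y \<le> B" unfolding bounded_iff by blast
  thus ?thesis by (intro exI[of _ B]) auto
qed

text \<open>The value at the origin is \<open>0\<close> by the convention for division, which is the right one because of the extra factor of \<open>z\<close>.\<close>

lemma holomorphic_divide_power:
  fixes f :: "complex \<Rightarrow> complex"
  assumes hol: "f holomorphic_on ball 0 r" and bd: "\<And>z. cmod z < r \<Longrightarrow> cmod (f z) \<le> B * cmod z ^ Suc n"
    and n: "0 < n"
  shows "(\<lambda>z. f z / z ^ n) holomorphic_on ball 0 r"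
proof (rule no_isolated_singularity[where K = "{0}"])
  show hol': "(\<lambda>z. f z / z ^ n) holomorphic_on ball 0 r - {0}"
    using hol by (intro holomorphic_intros) (auto intro: holomorphic_on_subset)
  have bd': "cmod (f z / z ^ n) \<le> B * cmod z" if "cmod z < r" for z
  proof (cases "z = 0")
    case True
    thus ?thesis using n by (simp add: power_0_left)
  next
    case False
    thus ?thesis using bd[OF that] by (simp add: norm_divide norm_power pos_divide_le_eq mult_ac)
  qed
  have "isCont (\<lambda>z. f z / z ^ n) z" if z: "z \<in> ball 0 r" for z
  proof (cases "z = 0")
    case False
    have "open (ball (0::complex) r - {0})" by (intro open_Diff) auto
    thus ?thesis using holomorphic_on_imp_continuous_on[OF hol'] z False
      by (simp add: continuous_on_eq_continuous_at)
  next
    case True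
    have "((\<lambda>z. f z / z ^ n) \<longlongrightarrow> 0) (at 0)"
    proof (rule Lim_null_comparison)
      have "0 < r" using z by (simp add: True)
      thus "\<forall>\<^sub>F z in at 0. norm (f z / z ^ n) \<le> B * cmod z"
        using bd' by (auto simp: eventually_at intro!: exI[of _ r])
      show "((\<lambda>z. B * cmod z) \<longlongrightarrow> 0) (at 0)" by (auto intro!: tendsto_eq_intros)
    qed
    thus ?thesis using n by (simp add: True isCont_def power_0_left)
  qed
  thus "continuous_on (ball 0 r) (\<lambda>z. f z / z ^ n)" by (simp add: continuous_at_imp_continuous_on)
qed auto

text \<open>The expansions of \<open>tanh\<close> and \<open>Ln \<circ> cosh\<close> with these remainders are carried just far enough that the parameter equations
can be divided by the powers of \<open>w\<close> they contain.\<close>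

definition tanh_remainder :: "complex \<Rightarrow> complex" where
  "tanh_remainder z = (tanh z - z + z ^ 3 / 3) / z ^ 4"

definition lncosh_remainder :: "complex \<Rightarrow> complex" where
  "lncosh_remainder z = (Ln (cosh z) - z ^ 2 / 2 + z ^ 4 / 12) / z ^ 5"

lemma tanh_remainder_holomorphic: "tanh_remainder holomorphic_on ball 0 (3/4)"
proof -
  obtain B where B: "\<And>z. z \<in> ball 0 (3/4) \<Longrightarrow> cmod (tanh_tower 5 z) \<le> B"
    using tanh_tower_bounded[of 5] by blast
  have "(\<lambda>z. (tanh z - z + z ^ 3 / 3) / z ^ 4) holomorphic_on ball 0 (3/4)"
  proof (rule holomorphic_divide_power)
    show "(\<lambda>z. tanh z - z + z ^ 3 / 3) holomorphic_on ball 0 (3/4)"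
      by (intro holomorphic_intros tanh_holomorphic) auto
    fix z :: complex assume z: "cmod z < 3/4"
    have N: "norm (tanh_tower 0 z - (\<Sum>i\<le>4. tanh_tower i 0 * (z - 0) ^ i / fact i)) \<le> B * norm (z - 0) ^ Suc 4 / fact 4"
      by (rule complex_Taylor[of "ball 0 (3/4)"]) (use z B tanh_tower_derivative[OF _ cosh_neq_0_disc] in auto)
    have S: "(\<Sum>i\<le>4. tanh_tower i 0 * (z - 0) ^ i / fact i) = z - z ^ 3 / 3"
      by (simp add: tanh_tower_def atMost_nat_numeral fact_numeral numeral_eq_Suc)
    have "tanh z - z + z ^ 3 / 3 = tanh_tower 0 z - (z - z ^ 3 / 3)" by (simp add: tanh_tower_def)
    note E = this
    show "cmod (tanh z - z + z ^ 3 / 3) \<le> B / fact 4 * cmod z ^ Suc 4"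
      using N unfolding S E by simp
  qed simp
  thus ?thesis by (simp add: tanh_remainder_def[abs_def])
qed

lemma lncosh_remainder_holomorphic: "lncosh_remainder holomorphic_on ball 0 (3/4)"
proof -
  obtain B where B: "\<And>z. z \<in> ball 0 (3/4) \<Longrightarrow> cmod (tanh_tower 5 z) \<le> B"
    using tanh_tower_bounded[of 5] by blast
  define f where "f n = (case n of 0 \<Rightarrow> (\<lambda>z. Ln (cosh z)) | Suc n \<Rightarrow> tanh_tower n)" for n
  have f: "(f i has_field_derivative f (Suc i) z) (at z within ball 0 (3/4))" if "z \<in> ball 0 (3/4)" "i \<le> 5" for i z
    using that Ln_cosh_derivative[of z] tanh_tower_derivative[OF _ cosh_neq_0_disc, of _ z] by (cases i) (auto simp: f_def tanh_tower_def[of 0])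
  have "(\<lambda>z. (Ln (cosh z) - z ^ 2 / 2 + z ^ 4 / 12) / z ^ 5) holomorphic_on ball 0 (3/4)"
  proof (rule holomorphic_divide_power)
    have "(\<lambda>z. Ln (cosh z)) holomorphic_on ball 0 (3/4)"
      unfolding holomorphic_on_def field_differentiable_def using Ln_cosh_derivative by force
    note L = this
    show "(\<lambda>z. Ln (cosh z) - z ^ 2 / 2 + z ^ 4 / 12) holomorphic_on ball 0 (3/4)"
      by (rule holomorphic_on_add[OF holomorphic_on_diff[OF L]]; intro holomorphic_intros; simp)
    fix z :: complex assume z: "cmod z < 3/4"
    have N: "norm (f 0 z - (\<Sum>i\<le>5. f i 0 * (z - 0) ^ i / fact i)) \<le> B * norm (z - 0) ^ Suc 5 / fact 5"
      by (rule complex_Taylor[of "ball 0 (3/4)"]) (use z B f in \<open>auto simp: f_def\<close>)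
    have S: "(\<Sum>i\<le>5. f i 0 * (z - 0) ^ i / fact i) = z ^ 2 / 2 - z ^ 4 / 12"
      by (simp add: f_def tanh_tower_def atMost_nat_numeral fact_numeral numeral_eq_Suc)
    have "Ln (cosh z) - z ^ 2 / 2 + z ^ 4 / 12 = f 0 z - (z ^ 2 / 2 - z ^ 4 / 12)" by (simp add: f_def)
    note E = this
    show "cmod (Ln (cosh z) - z ^ 2 / 2 + z ^ 4 / 12) \<le> B / fact 5 * cmod z ^ Suc 5"
      using N unfolding S E by simp
  qed simp
  thus ?thesis by (simp add: lncosh_remainder_def[abs_def])
qed

lemma tanh_remainder_eq: "cmod z < 3/4 \<Longrightarrow> tanh z = z - z ^ 3 / 3 + z ^ 4 * tanh_remainder z"
  by (cases "z = 0") (simp_all add: tanh_remainder_def)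

lemma lncosh_remainder_eq: "cmod z < 3/4 \<Longrightarrow> Ln (cosh z) = z ^ 2 / 2 - z ^ 4 / 12 + z ^ 5 * lncosh_remainder z"
  by (cases "z = 0") (simp_all add: lncosh_remainder_def)

lemma tanh_remainder_hol_comp: "f holomorphic_on U \<Longrightarrow> (\<And>s. s \<in> U \<Longrightarrow> cmod (f s) < 3/4) \<Longrightarrow> (\<lambda>s. tanh_remainder (f s)) holomorphic_on U"
  by (rule holomorphic_on_compose_gen[OF _ tanh_remainder_holomorphic, unfolded o_def]) auto

lemma lncosh_remainder_hol_comp: "f holomorphic_on U \<Longrightarrow> (\<And>s. s \<in> U \<Longrightarrow> cmod (f s) < 3/4) \<Longrightarrow> (\<lambda>s. lncosh_remainder (f s)) holomorphic_on U"
  by (rule holomorphic_on_compose_gen[OF _ lncosh_remainder_holomorphic, unfolded o_def]) auto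

lemma tanh_remainder_cont_comp: "continuous_on S f \<Longrightarrow> (\<And>s. s \<in> S \<Longrightarrow> cmod (f s) < 3/4) \<Longrightarrow> continuous_on S (\<lambda>s. tanh_remainder (f s))"
  by (rule continuous_on_compose2[OF holomorphic_on_imp_continuous_on[OF tanh_remainder_holomorphic]]) auto

lemma lncosh_remainder_cont_comp: "continuous_on S f \<Longrightarrow> (\<And>s. s \<in> S \<Longrightarrow> cmod (f s) < 3/4) \<Longrightarrow> continuous_on S (\<lambda>s. lncosh_remainder (f s))"
  by (rule continuous_on_compose2[OF holomorphic_on_imp_continuous_on[OF lncosh_remainder_holomorphic]]) auto

lemma hyperbolic_of_real:
  "cosh (of_real y :: complex) = of_real (cosh y)" "tanh (of_real y :: complex) = of_real (tanh y)"
proof -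
  show c: "cosh (of_real y :: complex) = of_real (cosh y)"
    unfolding cosh_field_def by (simp flip: exp_of_real)
  have "sinh (of_real y :: complex) = of_real (sinh y)"
    unfolding sinh_field_def by (simp flip: exp_of_real)
  thus "tanh (of_real y :: complex) = of_real (tanh y)" by (simp add: tanh_def c)
qed

lemma Ln_cosh_of_real: "Ln (cosh (of_real y)) = of_real (ln (cosh y))"
  by (simp add: hyperbolic_of_real Ln_of_real)

lemma remainders_real:
  assumes "z \<in> \<real>"
  shows "tanh_remainder z \<in> \<real>" "lncosh_remainder z \<in> \<real>"
proof -
  obtain y where z: "z = of_real y" using assms by (auto elim: Reals_cases)
  have "tanh z \<in> \<real>" unfolding z hyperbolic_of_real by simp
  thus "tanh_remainder z \<in> \<real>" unfolding tanh_remainder_def using assms by (intro Reals_divide Reals_add Reals_diff Reals_power) auto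
  have "Ln (cosh z) \<in> \<real>" unfolding z Ln_cosh_of_real by simp
  thus "lncosh_remainder z \<in> \<real>" unfolding lncosh_remainder_def using assms by (intro Reals_divide Reals_add Reals_diff Reals_power) auto
qed

section \<open>The rescaled equations\<close>

text \<open>This is \<open>tanh (w * y) / w\<close>, continued holomorphically to \<open>w = 0\<close>.\<close>

definition scaled_tanh :: "complex \<Rightarrow> complex \<Rightarrow> complex" where
  "scaled_tanh w y = y - w ^ 2 * y ^ 3 / 3 + w ^ 3 * y ^ 4 * tanh_remainder (w * y)"

text \<open>For \<open>w\<close> nonzero, \<open>w\<^sup>3\<close> times this quantity is twice the difference between the trapezoidal rule and the mean value of
\<open>tanh\<close> on the segment from \<open>w (x - 2)\<close> to \<open>w x\<close>. Double contact says that the errors for this segment and the next one,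
weighted with \<open>c\<close> and \<open>1 - c\<close>, cancel.\<close>

definition trapezoid_error :: "complex \<Rightarrow> complex \<Rightarrow> complex" where
  "trapezoid_error w x = - (4/3) * (x - 1) + w * ((x - 2) ^ 4 * tanh_remainder (w * (x - 2)) + x ^ 4 * tanh_remainder (w * x)
     - x ^ 5 * lncosh_remainder (w * x) + (x - 2) ^ 5 * lncosh_remainder (w * (x - 2)))"

definition trapezoid_diff :: "complex \<Rightarrow> complex \<Rightarrow> complex" where
  "trapezoid_diff w x = trapezoid_error w (x + 2) - trapezoid_error w x"

text \<open>The solution \<open>c\<close> of \<open>c * trapezoid_error w x + (1 - c) * trapezoid_error w (x + 2) = 0\<close>.\<close>

definition block_weight :: "complex \<Rightarrow> complex \<Rightarrow> complex" where
  "block_weight w x = trapezoid_error w (x + 2) / trapezoid_diff w x"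

text \<open>The centred degrees \<open>s1\<close>, \<open>s2\<close> of the two blocks, divided by \<open>w\<close>; below are their mean and their second moment,
which the densities prescribe as \<open>\<zeta> \<kappa> / w\<close> and \<open>\<zeta>\<^sup>2 / w\<^sup>2\<close>.\<close>

definition scaled_degree1 :: "complex \<Rightarrow> complex \<Rightarrow> complex" where
  "scaled_degree1 w x = (block_weight w x * scaled_tanh w (x - 2) + (1 - block_weight w x) * scaled_tanh w x) / 2"

definition scaled_degree2 :: "complex \<Rightarrow> complex \<Rightarrow> complex" where
  "scaled_degree2 w x = (block_weight w x * scaled_tanh w x + (1 - block_weight w x) * scaled_tanh w (x + 2)) / 2"

definition scaled_mean :: "complex \<Rightarrow> complex \<Rightarrow> complex" where
  "scaled_mean w x = block_weight w x * scaled_degree1 w x + (1 - block_weight w x) * scaled_degree2 w x"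

definition scaled_square :: "complex \<Rightarrow> complex \<Rightarrow> complex" where
  "scaled_square w x = block_weight w x * (scaled_degree1 w x)\<^sup>2 + (1 - block_weight w x) * (scaled_degree2 w x)\<^sup>2"

text \<open>The second-moment equation is \<open>w = \<zeta> * inv_scale w x\<close>, and the first one becomes \<open>x = shift_defect w x - \<kappa>\<close>.\<close>

definition inv_scale :: "complex \<Rightarrow> complex \<Rightarrow> complex" where
  "inv_scale w x = 1 / csqrt (scaled_square w x)"

definition shift_defect :: "complex \<Rightarrow> complex \<Rightarrow> complex" where
  "shift_defect w x = x + scaled_mean w x * inv_scale w x"

lemma at_w_0:
  "trapezoid_error 0 x = - (4/3) * (x - 1)" "trapezoid_diff 0 x = - 8/3" "block_weight 0 x = (x + 1) / 2" 
  "scaled_degree1 0 x = - 1/2" "scaled_degree2 0 x = 1/2" "scaled_square 0 x = 1/4" "inv_scale 0 x = 2" "shift_defect 0 x = 0"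
proof -
  show trapezoid_error: "trapezoid_error 0 x = - (4/3) * (x - 1)" for x by (simp add: trapezoid_error_def)
  show trapezoid_diff: "trapezoid_diff 0 x = - 8/3" by (simp add: trapezoid_diff_def trapezoid_error field_simps)
  show block_weight: "block_weight 0 x = (x + 1) / 2" by (simp add: block_weight_def trapezoid_diff trapezoid_error field_simps)
  show scaled_degree1: "scaled_degree1 0 x = - 1/2" by (simp add: scaled_degree1_def block_weight scaled_tanh_def field_simps)
  show scaled_degree2: "scaled_degree2 0 x = 1/2" by (simp add: scaled_degree2_def block_weight scaled_tanh_def field_simps)
  show scaled_square: "scaled_square 0 x = 1/4" by (simp add: scaled_square_def scaled_degree1 scaled_degree2 field_simps power2_eq_square)
  have "(1/4 :: complex) = (1/2)\<^sup>2" by (simp add: power2_eq_square)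
  moreover have "csqrt ((1/2)\<^sup>2) = 1/2" by (rule csqrt_square) simp
  ultimately have "csqrt (1/4) = 1/2" by (simp only:)
  hence "inv_scale 0 x = 1 / (1/2)" unfolding inv_scale_def scaled_square by (simp only:)
  thus inv: "inv_scale 0 x = 2" by simp
  show "shift_defect 0 x = 0" by (simp add: shift_defect_def scaled_mean_def inv block_weight scaled_degree1 scaled_degree2 field_simps)
qed

lemma arg_small:
  assumes "cmod w \<le> 1/16" "cmod x \<le> 4"
  shows "cmod (w * x) < 3/4" "cmod (w * (x - 2)) < 3/4" "cmod (w * (x + 2)) < 3/4" "cmod (w * (x + 2 - 2)) < 3/4"
proof -
  have "cmod (w * y) < 3/4" if "cmod y \<le> 6" for y
  proof -
    have "cmod (w * y) \<le> 1/16 * 6" unfolding norm_mult using assms that by (intro mult_mono) auto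
    thus ?thesis by simp
  qed
  note * = this
  show "cmod (w * x) < 3/4" using assms by (intro *) auto
  show "cmod (w * (x - 2)) < 3/4" using assms norm_triangle_ineq4[of x 2] by (intro *) auto
  show "cmod (w * (x + 2)) < 3/4" using assms norm_triangle_ineq[of x 2] by (intro *) auto
  show "cmod (w * (x + 2 - 2)) < 3/4" using assms by (intro *) auto
qed

text \<open>All inequalities hold with room to spare at \<open>w = 0\<close>, uniformly in \<open>x\<close>, and therefore for small \<open>w\<close>. The bounds on
\<open>inv_scale\<close> and \<open>shift_defect\<close> give the contraction, the last one the slope condition of the certificate.\<close>

definition good_radius :: "real \<Rightarrow> bool" where
  "good_radius r \<longleftrightarrow> 0 < r \<and> r \<le> 1/16 \<and> (\<forall>w x. cmod w \<le> r \<longrightarrow> cmod x \<le> 4 \<longrightarrow>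
     trapezoid_diff w x \<noteq> 0 \<and> 0 < Re (scaled_square w x) \<and> cmod (inv_scale w x - 2) \<le> 1/2 \<and> cmod (shift_defect w x) \<le> 1/32 \<and>
     cmod (block_weight w x - (x + 1) / 2) \<le> 1 \<and> cmod (scaled_degree2 w x - scaled_degree1 w x - 1) \<le> 1/5)"

lemma uniform_near_0:
  fixes g :: "complex \<times> complex \<Rightarrow> complex"
  assumes "continuous_on (cball 0 r \<times> cball 0 4) g" "0 < r" "0 < \<epsilon>"
  shows "\<exists>r'>0. r' \<le> r \<and> (\<forall>w x. cmod w \<le> r' \<longrightarrow> cmod x \<le> 4 \<longrightarrow> cmod (g (w, x) - g (0, x)) < \<epsilon>)"
proof -
  have "uniformly_continuous_on (cball 0 r \<times> cball 0 4) g"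
    using assms(1) by (intro compact_uniformly_continuous compact_Times) auto
  then obtain \<delta> where \<delta>: "\<delta> > 0" "\<And>p p'. p \<in> cball 0 r \<times> cball 0 4 \<Longrightarrow> p' \<in> cball 0 r \<times> cball 0 4 \<Longrightarrow> dist p' p < \<delta> \<Longrightarrow> dist (g p') (g p) < \<epsilon>"
    unfolding uniformly_continuous_on_def using assms(3) by metis
  show ?thesis
  proof (intro exI[of _ "min r (\<delta>/2)"] conjI allI impI)
    fix w x :: complex assume w: "cmod w \<le> min r (\<delta>/2)" and x: "cmod x \<le> 4"
    have "dist (w, x) (0, x) < \<delta>" using w \<delta>(1) by (simp add: dist_Pair_Pair)
    thus "cmod (g (w, x) - g (0, x)) < \<epsilon>"
      using \<delta>(2)[of "(0, x)" "(w, x)"] w x assms(2) by (simp add: dist_norm)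
  qed (use assms \<delta> in auto)
qed

lemma good_radius_exists: "\<exists>r. good_radius r"
proof -
  define C where "C r = cball (0::complex) r \<times> cball (0::complex) 4" for r
  have sub: "C r' \<subseteq> C r" if "r' \<le> r" for r r' using that by (auto simp: C_def)
  have small: "cmod (fst p * snd p) < 3/4" "cmod (fst p * (snd p - 2)) < 3/4" "cmod (fst p * (snd p + 2)) < 3/4"
     "cmod (fst p * (snd p + 2 - 2)) < 3/4" if "p \<in> C (1/16)" for p
    using arg_small[of "fst p" "snd p"] that by (auto simp: C_def)
  have c_err: "continuous_on (C (1/16)) (\<lambda>p. trapezoid_error (fst p) (snd p))" "continuous_on (C (1/16)) (\<lambda>p. trapezoid_error (fst p) (snd p + 2))"
    unfolding trapezoid_error_def by (intro continuous_intros tanh_remainder_cont_comp lncosh_remainder_cont_comp small; assumption)+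
  have c_tau: "continuous_on (C (1/16)) (\<lambda>p. scaled_tanh (fst p) (snd p))" "continuous_on (C (1/16)) (\<lambda>p. scaled_tanh (fst p) (snd p - 2))"
     "continuous_on (C (1/16)) (\<lambda>p. scaled_tanh (fst p) (snd p + 2))"
    unfolding scaled_tanh_def by (intro continuous_intros tanh_remainder_cont_comp small; (assumption | simp))+
  have c_den: "continuous_on (C (1/16)) (\<lambda>p. trapezoid_diff (fst p) (snd p))"
    unfolding trapezoid_diff_def by (intro continuous_intros c_err)
  obtain r1 where r1: "0 < r1" "r1 \<le> 1/16" "\<And>w x. cmod w \<le> r1 \<Longrightarrow> cmod x \<le> 4 \<Longrightarrow> cmod (trapezoid_diff w x - trapezoid_diff 0 x) < 1"
    using uniform_near_0[OF c_den[unfolded C_def], of 1] by auto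
  have den_nz: "trapezoid_diff w x \<noteq> 0" if "cmod w \<le> r1" "cmod x \<le> 4" for w x
    using r1(3)[OF that] by (auto simp: at_w_0)
  note s1 = continuous_on_subset[OF _ sub[OF r1(2)]]
  have c_wt: "continuous_on (C r1) (\<lambda>p. block_weight (fst p) (snd p))"
    unfolding block_weight_def using den_nz by (intro continuous_intros s1[OF c_err(2)] s1[OF c_den]) (auto simp: C_def)
  note c_tau1 = c_tau[THEN s1]
  have c_sc: "continuous_on (C r1) (\<lambda>p. scaled_degree1 (fst p) (snd p))" "continuous_on (C r1) (\<lambda>p. scaled_degree2 (fst p) (snd p))"
    unfolding scaled_degree1_def scaled_degree2_def by (intro continuous_intros c_wt c_tau1; simp)+
  have c_msq: "continuous_on (C r1) (\<lambda>p. scaled_square (fst p) (snd p))"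
    unfolding scaled_square_def by (intro continuous_intros c_wt c_sc)
  have c_mean: "continuous_on (C r1) (\<lambda>p. scaled_mean (fst p) (snd p))"
    unfolding scaled_mean_def by (intro continuous_intros c_wt c_sc)
  obtain r2 where r2: "0 < r2" "r2 \<le> r1" "\<And>w x. cmod w \<le> r2 \<Longrightarrow> cmod x \<le> 4 \<Longrightarrow> cmod (scaled_square w x - scaled_square 0 x) < 1/8"
    using uniform_near_0[OF c_msq[unfolded C_def] r1(1), of "1/8"] by auto
  have msq_pos: "0 < Re (scaled_square w x)" if "cmod w \<le> r2" "cmod x \<le> 4" for w x
    using r2(3)[OF that] abs_Re_le_cmod[of "scaled_square w x - 1/4"] by (auto simp: at_w_0)
  note s2 = continuous_on_subset[OF _ sub[OF r2(2)]]
  have c_inv: "continuous_on (C r2) (\<lambda>p. inv_scale (fst p) (snd p))"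
    unfolding inv_scale_def
  proof (intro continuous_intros)
    show "continuous_on (C r2) (\<lambda>p. csqrt (scaled_square (fst p) (snd p)))"
      by (rule continuous_on_compose2[OF continuous_on_csqrt s2[OF c_msq]])
        (use msq_pos in \<open>fastforce simp: C_def complex_nonpos_Reals_iff\<close>)
    show "\<forall>p\<in>C r2. csqrt (scaled_square (fst p) (snd p)) \<noteq> 0"
    proof
      fix p assume "p \<in> C r2"
      hence "0 < Re (scaled_square (fst p) (snd p))" using msq_pos by (auto simp: C_def)
      thus "csqrt (scaled_square (fst p) (snd p)) \<noteq> 0" by auto
    qed
  qed
  have c_defect: "continuous_on (C r2) (\<lambda>p. shift_defect (fst p) (snd p))"
    unfolding shift_defect_def by (intro continuous_intros c_inv s2[OF c_mean])
  obtain r3 where r3: "0 < r3" "r3 \<le> r2" "\<And>w x. cmod w \<le> r3 \<Longrightarrow> cmod x \<le> 4 \<Longrightarrow> cmod (inv_scale w x - inv_scale 0 x) < 1/2"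
    using uniform_near_0[OF c_inv[unfolded C_def] r2(1), of "1/2"] by auto
  obtain r4 where r4: "0 < r4" "r4 \<le> r2" "\<And>w x. cmod w \<le> r4 \<Longrightarrow> cmod x \<le> 4 \<Longrightarrow> cmod (shift_defect w x - shift_defect 0 x) < 1/32"
    using uniform_near_0[OF c_defect[unfolded C_def] r2(1), of "1/32"] by auto
  obtain r5 where r5: "0 < r5" "r5 \<le> r1" "\<And>w x. cmod w \<le> r5 \<Longrightarrow> cmod x \<le> 4 \<Longrightarrow> cmod (block_weight w x - block_weight 0 x) < 1"
    using uniform_near_0[OF c_wt[unfolded C_def] r1(1), of 1] by auto
  have c_diff: "continuous_on (C r1) (\<lambda>p. scaled_degree2 (fst p) (snd p) - scaled_degree1 (fst p) (snd p))"
    by (intro continuous_intros c_sc)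
  obtain r6 where r6: "0 < r6" "r6 \<le> r1" "\<And>w x. cmod w \<le> r6 \<Longrightarrow> cmod x \<le> 4 \<Longrightarrow> cmod ((scaled_degree2 w x - scaled_degree1 w x) - (scaled_degree2 0 x - scaled_degree1 0 x)) < 1/5"
    using uniform_near_0[OF c_diff[unfolded C_def] r1(1), of "1/5"] by auto
  define r where "r = min (min r3 r4) (min r5 r6)"
  have "good_radius r"
    unfolding good_radius_def
  proof (intro conjI allI impI)
    show "0 < r" "r \<le> 1/16" using r1 r2 r3 r4 r5 r6 by (auto simp: r_def)
    fix w x :: complex assume w: "cmod w \<le> r" and x: "cmod x \<le> 4"
    have w': "cmod w \<le> r1" "cmod w \<le> r2" "cmod w \<le> r3" "cmod w \<le> r4" "cmod w \<le> r5" "cmod w \<le> r6"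
      using w r1 r2 r3 r4 r5 r6 by (auto simp: r_def)
    show "trapezoid_diff w x \<noteq> 0" by (rule den_nz[OF w'(1) x])
    show "0 < Re (scaled_square w x)" by (rule msq_pos[OF w'(2) x])
    show "cmod (inv_scale w x - 2) \<le> 1/2" using r3(3)[OF w'(3) x] by (simp add: at_w_0)
    show "cmod (shift_defect w x) \<le> 1/32" using r4(3)[OF w'(4) x] by (simp add: at_w_0)
    show "cmod (block_weight w x - (x + 1) / 2) \<le> 1" using r5(3)[OF w'(5) x] by (simp add: at_w_0)
    show "cmod (scaled_degree2 w x - scaled_degree1 w x - 1) \<le> 1/5" using r6(3)[OF w'(6) x] by (simp add: at_w_0)
  qed
  thus ?thesis by blast
qed

definition radius :: real where "radius = (SOME r. good_radius r)"

lemma good_radius_radius: "good_radius radius"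
  unfolding radius_def by (rule someI_ex[OF good_radius_exists])

lemma radius: "0 < radius" "radius \<le> 1/16"
  using good_radius_radius unfolding good_radius_def by blast+

lemma radius_bounds: 
  assumes "cmod w \<le> radius" "cmod x \<le> 4"
  shows "trapezoid_diff w x \<noteq> 0" "0 < Re (scaled_square w x)" "cmod (inv_scale w x - 2) \<le> 1/2" "cmod (shift_defect w x) \<le> 1/32"
    "cmod (block_weight w x - (x + 1) / 2) \<le> 1" "cmod (scaled_degree2 w x - scaled_degree1 w x - 1) \<le> 1/5"
  using good_radius_radius assms unfolding good_radius_def by blast+

lemma inv_scale_bound: "cmod w \<le> radius \<Longrightarrow> cmod x \<le> 4 \<Longrightarrow> cmod (inv_scale w x) \<le> 5/2"
  using radius_bounds(3)[of w x] norm_triangle_ineq[of "inv_scale w x - 2" 2] by simp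

text \<open>Holomorphy of a function of two variables is expressed by composing it with arbitrary pairs of holomorphic functions of
one variable. This form is stable under composition and contains holomorphy in each variable.\<close>

lemma curve_holomorphic:
  assumes "w holomorphic_on U" "x holomorphic_on U" 
    and bd: "\<And>s. s \<in> U \<Longrightarrow> cmod (w s) < radius \<and> cmod (x s) < 4"
  shows "(\<lambda>s. inv_scale (w s) (x s)) holomorphic_on U" "(\<lambda>s. shift_defect (w s) (x s)) holomorphic_on U"
    "(\<lambda>s. block_weight (w s) (x s)) holomorphic_on U"
proof -
  have small: "cmod (w s * x s) < 3/4" "cmod (w s * (x s - 2)) < 3/4" "cmod (w s * (x s + 2)) < 3/4"
     "cmod (w s * (x s + 2 - 2)) < 3/4" if "s \<in> U" for s
    using arg_small[of "w s" "x s"] bd[OF that] radius by auto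
  have le: "cmod (w s) \<le> radius" "cmod (x s) \<le> 4" if "s \<in> U" for s using bd[OF that] by auto
  have h_err: "(\<lambda>s. trapezoid_error (w s) (x s)) holomorphic_on U" "(\<lambda>s. trapezoid_error (w s) (x s + 2)) holomorphic_on U"
    unfolding trapezoid_error_def by (intro holomorphic_intros tanh_remainder_hol_comp lncosh_remainder_hol_comp assms small; assumption)+
  have h_tau: "(\<lambda>s. scaled_tanh (w s) (x s)) holomorphic_on U" "(\<lambda>s. scaled_tanh (w s) (x s - 2)) holomorphic_on U"
     "(\<lambda>s. scaled_tanh (w s) (x s + 2)) holomorphic_on U"
    unfolding scaled_tanh_def by (intro holomorphic_intros tanh_remainder_hol_comp small assms; (assumption | simp))+
  have h_den: "(\<lambda>s. trapezoid_diff (w s) (x s)) holomorphic_on U"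
    unfolding trapezoid_diff_def by (intro holomorphic_intros h_err)
  show h_wt: "(\<lambda>s. block_weight (w s) (x s)) holomorphic_on U"
    unfolding block_weight_def using radius_bounds(1) le by (intro holomorphic_intros h_err h_den) auto
  have h_sc: "(\<lambda>s. scaled_degree1 (w s) (x s)) holomorphic_on U" "(\<lambda>s. scaled_degree2 (w s) (x s)) holomorphic_on U"
    unfolding scaled_degree1_def scaled_degree2_def by (intro holomorphic_intros h_wt h_tau; simp)+
  have h_msq: "(\<lambda>s. scaled_square (w s) (x s)) holomorphic_on U" and h_mean: "(\<lambda>s. scaled_mean (w s) (x s)) holomorphic_on U"
    unfolding scaled_square_def scaled_mean_def by (intro holomorphic_intros h_wt h_sc)+
  show h_inv: "(\<lambda>s. inv_scale (w s) (x s)) holomorphic_on U"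
    unfolding inv_scale_def
  proof (intro holomorphic_intros h_msq)
    fix s assume "s \<in> U"
    hence "0 < Re (scaled_square (w s) (x s))" using radius_bounds(2) le by auto
    thus "csqrt (scaled_square (w s) (x s)) \<noteq> 0" "scaled_square (w s) (x s) \<notin> \<real>\<^sub>\<le>\<^sub>0" 
      by (auto simp: csqrt_eq_0 complex_nonpos_Reals_iff)
  qed
  show "(\<lambda>s. shift_defect (w s) (x s)) holomorphic_on U"
    unfolding shift_defect_def by (intro holomorphic_intros h_mean h_inv assms)
qed

lemma real_on_reals:
  assumes "w \<in> \<real>" "x \<in> \<real>" "cmod w \<le> radius" "cmod x \<le> 4"
  shows "inv_scale w x \<in> \<real>" "shift_defect w x \<in> \<real>" "block_weight w x \<in> \<real>"
proof -
  have r_err: "trapezoid_error w y \<in> \<real>" if "y \<in> \<real>" for y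
    unfolding trapezoid_error_def using assms that
    by (intro Reals_add Reals_mult Reals_minus Reals_diff Reals_divide Reals_power remainders_real Reals_numeral Reals_1)
  have r_tau: "scaled_tanh w y \<in> \<real>" if "y \<in> \<real>" for y
    unfolding scaled_tanh_def using assms that
    by (intro Reals_add Reals_mult Reals_minus Reals_diff Reals_divide Reals_power remainders_real Reals_numeral Reals_1)
  have x2: "x + 2 \<in> \<real>" "x - 2 \<in> \<real>" using assms(2) by (auto intro: Reals_add Reals_diff)
  show r_wt: "block_weight w x \<in> \<real>" unfolding block_weight_def trapezoid_diff_def using assms x2 by (intro Reals_divide Reals_diff r_err)
  have r_sc: "scaled_degree1 w x \<in> \<real>" "scaled_degree2 w x \<in> \<real>"
    unfolding scaled_degree1_def scaled_degree2_def using assms x2 r_wt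
    by (intro Reals_add Reals_mult Reals_diff Reals_divide r_tau Reals_numeral Reals_1; simp)+
  have r_msq: "scaled_square w x \<in> \<real>" and r_mean: "scaled_mean w x \<in> \<real>"
    unfolding scaled_square_def scaled_mean_def by (intro Reals_add Reals_mult Reals_diff Reals_power r_wt r_sc Reals_1)+
  obtain m where m: "scaled_square w x = of_real m" using r_msq by (auto elim: Reals_cases)
  have "0 < m" using radius_bounds(2)[OF assms(3,4)] by (simp add: m)
  hence "csqrt (scaled_square w x) \<in> \<real>" by (simp add: m flip: of_real_sqrt)
  thus r_inv: "inv_scale w x \<in> \<real>" unfolding inv_scale_def by (intro Reals_divide Reals_1)
  show "shift_defect w x \<in> \<real>" unfolding shift_defect_def by (intro Reals_add Reals_mult assms r_mean r_inv)
qed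

section \<open>Solving the equations by iteration\<close>

lemma holomorphic_bound_from_0:
  fixes f :: "complex \<Rightarrow> complex"
  assumes "f holomorphic_on ball 0 R" "\<And>u. cmod u < R \<Longrightarrow> cmod (f u) \<le> B" "0 < R" "cmod u < R"
  shows "cmod (f u - f 0) \<le> 4 * B / R * cmod u"
proof (cases "u = 0")
  case False
  have "cmod ((f u - f 0) / u) \<le> 4 * B / R"
    using holomorphic_difference_quotient(2)[OF assms(1,2,3,4)] False by simp
  moreover have "0 < cmod u" using False by simp
  ultimately show ?thesis unfolding norm_divide by (simp only: pos_divide_le_eq)
qed auto

lemma holomorphic_lipschitz:
  fixes f :: "complex \<Rightarrow> complex"
  assumes hol: "f holomorphic_on ball 0 R" and bd: "\<And>u. cmod u < R \<Longrightarrow> cmod (f u) \<le> B" and R: "0 < R"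
    and u: "cmod u < R / 2" "cmod u' < R / 2"
  shows "cmod (f u - f u') \<le> 8 * B / R * cmod (u - u')"
proof (cases "cmod (u - u') < R / 2")
  case True
  have sub: "cmod (u' + h) < R" if "cmod h < R / 2" for h
    using norm_triangle_ineq[of u' h] that u by linarith
  have "cmod (f (u' + (u - u')) - f (u' + 0)) \<le> 4 * B / (R / 2) * cmod (u - u')"
  proof (rule holomorphic_bound_from_0[where f = "\<lambda>h. f (u' + h)"])
    have "f \<circ> (\<lambda>h. u' + h) holomorphic_on ball 0 (R / 2)"
    proof (rule holomorphic_on_compose_gen[OF _ hol])
      show "(\<lambda>h. u' + h) ` ball 0 (R / 2) \<subseteq> ball 0 R"
      proof (rule image_subsetI)
        fix h assume "h \<in> ball (0::complex) (R / 2)"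
        thus "u' + h \<in> ball 0 R" using sub[of h] by simp
      qed
    qed (intro holomorphic_intros)
    thus "(\<lambda>h. f (u' + h)) holomorphic_on ball 0 (R / 2)" by (simp add: o_def)
  qed (use True R bd sub in auto)
  thus ?thesis by simp
next
  case False
  have B: "0 \<le> B" using order_trans[OF norm_ge_zero bd[of 0]] R by simp
  have "cmod (f u - f u') \<le> B + B"
    using norm_triangle_ineq4[of "f u" "f u'"] bd[of u] bd[of u'] u R by linarith
  also have "\<dots> \<le> 8 * B / R * (R / 2)" using R B by simp
  also have "\<dots> \<le> 8 * B / R * cmod (u - u')" using False B R by (intro mult_left_mono) auto
  finally show ?thesis .
qed

text \<open>The variable \<open>w\<close> is measured in units of \<open>radius\<close>, so that both Lipschitz constants depend only on the bound.\<close>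

lemma lipschitz_2:
  fixes g :: "complex \<Rightarrow> complex \<Rightarrow> complex"
  assumes hol: "\<And>U w x. w holomorphic_on U \<Longrightarrow> x holomorphic_on U \<Longrightarrow> (\<And>s. s \<in> U \<Longrightarrow> cmod (w s) < radius \<and> cmod (x s) < 4)
      \<Longrightarrow> (\<lambda>s. g (w s) (x s)) holomorphic_on U"
    and bd: "\<And>w x. cmod w \<le> radius \<Longrightarrow> cmod x \<le> 4 \<Longrightarrow> cmod (g w x) \<le> B"
    and w: "cmod w < radius / 2" "cmod w' < radius / 2" and x: "cmod x < 2" "cmod x' < 2"
  shows "cmod (g w x - g w' x') \<le> 8 * B * (cmod (w - w') / radius) + 2 * B * cmod (x - x')"
proof -
  have "cmod (g w x - g w' x) \<le> 8 * B / radius * cmod (w - w')"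
    using w x radius by (intro holomorphic_lipschitz[of "\<lambda>w. g w x"] hol bd) (auto intro!: holomorphic_intros)
  moreover have "cmod (g w' x - g w' x') \<le> 8 * B / 4 * cmod (x - x')"
    using w x radius by (intro holomorphic_lipschitz[of "\<lambda>x. g w' x"] hol bd) (auto intro!: holomorphic_intros)
  ultimately show ?thesis using norm_triangle_ineq[of "g w x - g w' x" "g w' x - g w' x'"] by simp
qed

lemma scale_shift_lipschitz:
  assumes "cmod w < radius / 2" "cmod w' < radius / 2" "cmod x < 2" "cmod x' < 2"
  shows "cmod (inv_scale w x - inv_scale w' x') \<le> 20 * (cmod (w - w') / radius) + 5 * cmod (x - x')"
    and "cmod (shift_defect w x - shift_defect w' x') \<le> 1/4 * (cmod (w - w') / radius) + 1/16 * cmod (x - x')"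
proof -
  have "cmod (inv_scale w x - inv_scale w' x') \<le> 8 * (5/2) * (cmod (w - w') / radius) + 2 * (5/2) * cmod (x - x')"
    by (rule lipschitz_2[OF _ inv_scale_bound assms]) (rule curve_holomorphic(1); blast)
  thus "cmod (inv_scale w x - inv_scale w' x') \<le> 20 * (cmod (w - w') / radius) + 5 * cmod (x - x')" by simp
  have "cmod (shift_defect w x - shift_defect w' x') \<le> 8 * (1/32) * (cmod (w - w') / radius) + 2 * (1/32) * cmod (x - x')"
    by (rule lipschitz_2[OF _ radius_bounds(4) assms]) (rule curve_holomorphic(2); blast)
  thus "cmod (shift_defect w x - shift_defect w' x') \<le> 1/4 * (cmod (w - w') / radius) + 1/16 * cmod (x - x')" by simp
qed

definition picard_step :: "complex \<times> complex \<Rightarrow> complex \<times> complex \<Rightarrow> complex \<times> complex" where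
  "picard_step p q = (fst p * inv_scale (fst q) (snd q), shift_defect (fst q) (snd q) - snd p)"

primrec picard :: "nat \<Rightarrow> complex \<times> complex \<Rightarrow> complex \<times> complex" where
  "picard 0 p = (0, 0)"
| "picard (Suc n) p = picard_step p (picard n p)"

definition param_domain :: "(complex \<times> complex) set" where
  "param_domain = {p. cmod (fst p) < radius / 64 \<and> cmod (snd p) < 3/2}"

text \<open>The iteration stays in this set, well inside the region where the Lipschitz estimates hold.\<close>

definition picard_domain :: "(complex \<times> complex) set" where
  "picard_domain = {q. cmod (fst q) \<le> radius / 4 \<and> cmod (snd q) \<le> 7/4}"

lemma picard_domain_small:
  assumes "q \<in> picard_domain"
  shows "cmod (fst q) \<le> radius" "cmod (snd q) \<le> 4" "cmod (fst q) < radius / 2" "cmod (snd q) < 2" "cmod (fst q) < radius" "cmod (snd q) < 4"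
  using assms radius(1) unfolding picard_domain_def by simp_all

lemma picard_step_in_domain:
  assumes p: "p \<in> param_domain" and q: "q \<in> picard_domain"
  shows "picard_step p q \<in> picard_domain"
proof -
  have "cmod (fst (picard_step p q)) \<le> (radius / 64) * (5/2)"
    unfolding picard_step_def fst_conv norm_mult using p radius inv_scale_bound[OF picard_domain_small(1,2)[OF q]]
    by (intro mult_mono) (auto simp: param_domain_def)
  moreover have "cmod (snd (picard_step p q)) \<le> 1/32 + 3/2"
    using norm_triangle_ineq4[of "shift_defect (fst q) (snd q)" "snd p"] radius_bounds(4)[OF picard_domain_small(1,2)[OF q]] p
    by (simp add: param_domain_def picard_step_def)
  ultimately show ?thesis using radius by (simp add: picard_domain_def)
qed

lemma picard_in_domain: "p \<in> param_domain \<Longrightarrow> picard n p \<in> picard_domain"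
  by (induction n) (use radius in \<open>auto simp: picard_step_in_domain, simp add: picard_domain_def\<close>)

definition scaled_dist :: "complex \<times> complex \<Rightarrow> complex \<times> complex \<Rightarrow> real" where
  "scaled_dist p q = cmod (fst p - fst q) / radius + cmod (snd p - snd q)"

text \<open>The scale part contracts because \<open>\<zeta>\<close> is at most \<open>radius / 64\<close>, the shift part because \<open>shift_defect\<close> is at most \<open>1/32\<close>.\<close>

lemma picard_step_contracts:
  assumes p: "p \<in> param_domain" and q: "q \<in> picard_domain" "q' \<in> picard_domain"
  shows "scaled_dist (picard_step p q) (picard_step p q') \<le> 3/4 * scaled_dist q q'"
proof -
  define w x w' x' where "w = fst q" and "x = snd q" and "w' = fst q'" and "x' = snd q'"
  define a where "a = cmod (w - w') / radius"
  define b where "b = cmod (x - x')"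
  have ab: "0 \<le> a" "0 \<le> b" unfolding a_def b_def using radius(1) by simp_all
  have can: "(A - z) - (B - z) = A - B" for A B z :: complex by simp
  note small = picard_domain_small(3)[OF q(1)] picard_domain_small(3)[OF q(2)] picard_domain_small(4)[OF q(1)] picard_domain_small(4)[OF q(2)]
  have 1: "cmod (inv_scale w x - inv_scale w' x') \<le> 20 * a + 5 * b"
   and 2: "cmod (shift_defect w x - shift_defect w' x') \<le> 1/4 * a + 1/16 * b"
    unfolding a_def b_def w_def x_def w'_def x'_def by (rule scale_shift_lipschitz[OF small])+
  have "cmod (fst p * inv_scale w x - fst p * inv_scale w' x') / radius = (cmod (fst p) / radius) * cmod (inv_scale w x - inv_scale w' x')"
    unfolding right_diff_distrib[symmetric] norm_mult by simp
  also have "\<dots> \<le> 1/64 * (20 * a + 5 * b)"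
    using 1 p radius(1) by (intro mult_mono) (auto simp: param_domain_def pos_divide_le_eq)
  finally have "scaled_dist (picard_step p q) (picard_step p q') \<le> 1/64 * (20 * a + 5 * b) + (1/4 * a + 1/16 * b)"
    using 2 unfolding scaled_dist_def picard_step_def w_def w'_def x_def x'_def fst_conv snd_conv can by linarith
  also have "\<dots> \<le> 3/4 * (a + b)" using ab by (simp add: field_simps)
  finally show ?thesis by (simp add: scaled_dist_def a_def b_def w_def w'_def x_def x'_def)
qed

lemma picard_geometric:
  assumes p: "p \<in> param_domain"
  shows "scaled_dist (picard (Suc n) p) (picard n p) \<le> 4 * (3/4) ^ n"
proof (induction n)
  case 0
  have "picard (Suc 0) p \<in> picard_domain" by (rule picard_in_domain[OF p])
  hence "cmod (fst (picard (Suc 0) p)) / radius \<le> 1" "cmod (snd (picard (Suc 0) p)) \<le> 2" 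
    using radius(1) by (simp_all add: pos_divide_le_eq picard_domain_def del: picard.simps(2))
  thus ?case by (simp add: scaled_dist_def del: picard.simps(2))
next
  case (Suc n)
  have "scaled_dist (picard_step p (picard (Suc n) p)) (picard_step p (picard n p)) \<le> 3/4 * scaled_dist (picard (Suc n) p) (picard n p)"
    by (rule picard_step_contracts[OF p picard_in_domain[OF p] picard_in_domain[OF p]])
  hence "scaled_dist (picard (Suc (Suc n)) p) (picard (Suc n) p) \<le> 3/4 * scaled_dist (picard (Suc n) p) (picard n p)"
    by (simp only: picard.simps(2))
  thus ?case using Suc by simp
qed

text \<open>The limit of the iteration, as a telescoping series to which the Weierstrass test applies.\<close>

definition sol_w :: "complex \<times> complex \<Rightarrow> complex" where
  "sol_w p = (\<Sum>n. fst (picard (Suc n) p) - fst (picard n p))"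

definition sol_x :: "complex \<times> complex \<Rightarrow> complex" where
  "sol_x p = (\<Sum>n. snd (picard (Suc n) p) - snd (picard n p))"

lemma picard_uniform_limit:
  "uniform_limit param_domain (\<lambda>n p. fst (picard n p)) sol_w sequentially"
  "uniform_limit param_domain (\<lambda>n p. snd (picard n p)) sol_x sequentially"
proof -
  have s: "summable (\<lambda>n. 4 * (3/4::real) ^ n)" by (intro summable_mult summable_geometric) simp
  have 1: "cmod (fst (picard (Suc n) p) - fst (picard n p)) \<le> 4 * (3/4) ^ n" 
       and 2: "cmod (snd (picard (Suc n) p) - snd (picard n p)) \<le> 4 * (3/4) ^ n" if "p \<in> param_domain" for n p
  proof -
    have g: "cmod (fst (picard (Suc n) p) - fst (picard n p)) / radius + cmod (snd (picard (Suc n) p) - snd (picard n p)) \<le> 4 * (3/4) ^ n"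
      using picard_geometric[OF that, of n] by (simp only: scaled_dist_def)
    moreover have "cmod (fst (picard (Suc n) p) - fst (picard n p)) \<le> cmod (fst (picard (Suc n) p) - fst (picard n p)) / radius"
      using radius by (intro mult_imp_le_div_pos mult_left_le) auto
    moreover have "0 \<le> cmod (fst (picard (Suc n) p) - fst (picard n p)) / radius" using radius by auto
    ultimately show "cmod (fst (picard (Suc n) p) - fst (picard n p)) \<le> 4 * (3/4) ^ n" 
       "cmod (snd (picard (Suc n) p) - snd (picard n p)) \<le> 4 * (3/4) ^ n"
      using norm_ge_zero[of "snd (picard (Suc n) p) - snd (picard n p)"] by linarith+
  qed
  have tel: "(\<Sum>i<n. fst (picard (Suc i) p) - fst (picard i p)) = fst (picard n p)"
    "(\<Sum>i<n. snd (picard (Suc i) p) - snd (picard i p)) = snd (picard n p)" for n p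
    using sum_lessThan_telescope[of "\<lambda>i. fst (picard i p)" n] sum_lessThan_telescope[of "\<lambda>i. snd (picard i p)" n]
    by (simp_all del: picard.simps(2))
  have "uniform_limit param_domain (\<lambda>n p. \<Sum>i<n. fst (picard (Suc i) p) - fst (picard i p)) sol_w sequentially"
    unfolding sol_w_def by (rule Weierstrass_m_test[OF 1 s])
  thus "uniform_limit param_domain (\<lambda>n p. fst (picard n p)) sol_w sequentially"
    unfolding tel .
  have "uniform_limit param_domain (\<lambda>n p. \<Sum>i<n. snd (picard (Suc i) p) - snd (picard i p)) sol_x sequentially"
    unfolding sol_x_def by (rule Weierstrass_m_test[OF 2 s])
  thus "uniform_limit param_domain (\<lambda>n p. snd (picard n p)) sol_x sequentially"
    unfolding tel .
qed

lemma picard_limit: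
  assumes "p \<in> param_domain"
  shows "(\<lambda>n. fst (picard n p)) \<longlonglongrightarrow> sol_w p" "(\<lambda>n. snd (picard n p)) \<longlonglongrightarrow> sol_x p"
  using tendsto_uniform_limitI[OF picard_uniform_limit(1) assms] tendsto_uniform_limitI[OF picard_uniform_limit(2) assms] by auto

lemma sol_in_domain:
  assumes p: "p \<in> param_domain"
  shows "(sol_w p, sol_x p) \<in> picard_domain"
proof -
  have "cmod (sol_w p) \<le> radius / 4"
    by (rule Lim_norm_ubound[OF _ picard_limit(1)[OF p]]) (use picard_in_domain[OF p] in \<open>auto simp: picard_domain_def\<close>)
  moreover have "cmod (sol_x p) \<le> 7/4"
    by (rule Lim_norm_ubound[OF _ picard_limit(2)[OF p]]) (use picard_in_domain[OF p] in \<open>auto simp: picard_domain_def\<close>)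
  ultimately show ?thesis by (simp add: picard_domain_def)
qed

lemma sol_fixed_point:
  assumes p: "p \<in> param_domain"
  shows "sol_w p = fst p * inv_scale (sol_w p) (sol_x p)" "sol_x p = shift_defect (sol_w p) (sol_x p) - snd p"
proof -
  define s where "s = (sol_w p, sol_x p)"
  define q where "q = picard_step p s"
  have le: "scaled_dist (picard (Suc n) p) q \<le> 3/4 * scaled_dist (picard n p) s" for n
    unfolding picard.simps(2) q_def s_def by (rule picard_step_contracts[OF p picard_in_domain[OF p] sol_in_domain[OF p]])
  have 1: "(\<lambda>n. 3/4 * scaled_dist (picard n p) s) \<longlonglongrightarrow> 3/4 * (cmod (sol_w p - fst s) / radius + cmod (sol_x p - snd s))"
    unfolding scaled_dist_def using radius by (intro tendsto_intros picard_limit[OF p]) auto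
  have 2: "(\<lambda>n. scaled_dist (picard (Suc n) p) q) \<longlonglongrightarrow> cmod (sol_w p - fst q) / radius + cmod (sol_x p - snd q)"
    unfolding scaled_dist_def using radius by (intro tendsto_intros LIMSEQ_Suc[OF picard_limit(1)[OF p]] LIMSEQ_Suc[OF picard_limit(2)[OF p]]) auto
  have "cmod (sol_w p - fst q) / radius + cmod (sol_x p - snd q) \<le> 3/4 * (cmod (sol_w p - fst s) / radius + cmod (sol_x p - snd s))"
    by (rule LIMSEQ_le[OF 2 1]) (use le in blast)
  hence "cmod (sol_w p - fst q) / radius + cmod (sol_x p - snd q) \<le> 0" by (simp add: s_def)
  moreover have "0 \<le> cmod (sol_w p - fst q) / radius" using radius(1) by simp
  ultimately have "cmod (sol_w p - fst q) / radius = 0" "cmod (sol_x p - snd q) = 0"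
    using norm_ge_zero[of "sol_x p - snd q"] by linarith+
  thus "sol_w p = fst p * inv_scale (sol_w p) (sol_x p)" "sol_x p = shift_defect (sol_w p) (sol_x p) - snd p"
    using radius(1) by (simp_all add: q_def s_def picard_step_def)
qed

lemma picard_holomorphic:
  assumes "z holomorphic_on U" "k holomorphic_on U" "\<And>s. s \<in> U \<Longrightarrow> (z s, k s) \<in> param_domain"
  shows "(\<lambda>s. fst (picard n (z s, k s))) holomorphic_on U \<and> (\<lambda>s. snd (picard n (z s, k s))) holomorphic_on U"
proof (induction n)
  case (Suc n)
  have bd: "cmod (fst (picard n (z s, k s))) < radius \<and> cmod (snd (picard n (z s, k s))) < 4" if "s \<in> U" for s
    using picard_domain_small(5,6)[OF picard_in_domain[OF assms(3)[OF that]]] by blast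
  note c = curve_holomorphic[OF conjunct1[OF Suc] conjunct2[OF Suc] bd]
  show ?case unfolding picard.simps(2) picard_step_def fst_conv snd_conv
    by (intro conjI holomorphic_on_mult holomorphic_on_diff assms(1,2) c)
qed (auto intro!: holomorphic_intros)

text \<open>Each iterate is holomorphic along the curve, and the convergence is uniform over all parameters.\<close>

lemma sol_holomorphic:
  assumes U: "open U" and hol: "z holomorphic_on U" "k holomorphic_on U" and p: "\<And>s. s \<in> U \<Longrightarrow> (z s, k s) \<in> param_domain"
  shows "(\<lambda>s. sol_w (z s, k s)) holomorphic_on U" "(\<lambda>s. sol_x (z s, k s)) holomorphic_on U"
proof -
  have unif: "uniform_limit (cball x d) (\<lambda>n s. fst (picard n (z s, k s))) (\<lambda>s. sol_w (z s, k s)) sequentially"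
       "uniform_limit (cball x d) (\<lambda>n s. snd (picard n (z s, k s))) (\<lambda>s. sol_x (z s, k s)) sequentially" if "cball x d \<subseteq> U" for x d
    using that p by (auto intro!: uniform_limit_compose'[OF picard_uniform_limit(1)] uniform_limit_compose'[OF picard_uniform_limit(2)])
  have ex: "\<exists>d>0. cball x d \<subseteq> U" if "x \<in> U" for x using U that open_contains_cball_eq by blast
  show "(\<lambda>s. sol_w (z s, k s)) holomorphic_on U"
    by (rule holomorphic_uniform_sequence[OF U, where f = "\<lambda>n s. fst (picard n (z s, k s))"])
      (use picard_holomorphic[OF hol p] unif ex in blast)+
  show "(\<lambda>s. sol_x (z s, k s)) holomorphic_on U"
    by (rule holomorphic_uniform_sequence[OF U, where f = "\<lambda>n s. snd (picard n (z s, k s))"])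
      (use picard_holomorphic[OF hol p] unif ex in blast)+
qed

lemma sol_real:
  assumes p: "p \<in> param_domain" "fst p \<in> \<real>" "snd p \<in> \<real>"
  shows "sol_w p \<in> \<real>" "sol_x p \<in> \<real>"
proof -
  have "fst (picard n p) \<in> \<real> \<and> snd (picard n p) \<in> \<real>" for n
  proof (induction n)
    case (Suc n)
    note r = real_on_reals[OF conjunct1[OF Suc] conjunct2[OF Suc] picard_domain_small(1,2)[OF picard_in_domain[OF p(1)]]]
    show ?case unfolding picard.simps(2) picard_step_def fst_conv snd_conv
      by (intro conjI Reals_mult Reals_diff p r)
  qed auto
  note real = conjunct1[OF this] conjunct2[OF this]
  show "sol_w p \<in> \<real>" by (rule closed_sequentially[OF closed_complex_Reals real(1) picard_limit(1)[OF p(1)]])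
  show "sol_x p \<in> \<real>" by (rule closed_sequentially[OF closed_complex_Reals real(2) picard_limit(2)[OF p(1)]])
qed

text \<open>A holomorphic function of \<open>w\<close> differs from its value at \<open>w = 0\<close> by \<open>O(w)\<close>, hence by \<open>O(\<zeta>)\<close>; the values at \<open>0\<close> are
those in \<open>at_w_0\<close>.\<close>

lemma sol_asymptotics:
  assumes p: "p \<in> param_domain"
  shows "cmod (sol_w p - 2 * fst p) \<le> 25 / radius * (cmod (fst p))\<^sup>2"
    and "cmod (sol_x p + snd p) \<le> 1 / radius * cmod (fst p)"
    and "cmod (block_weight (sol_w p) (sol_x p) - (sol_x p + 1) / 2) \<le> 10 / radius * cmod (fst p)"
proof -
  define w where "w = sol_w p"
  define x where "x = sol_x p"
  define r where "r = cmod (fst p)"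
  have w': "cmod w < radius" "cmod w \<le> radius" "cmod x \<le> 4" "cmod x < 4" 
    using picard_domain_small[OF sol_in_domain[OF p]] by (simp_all add: w_def x_def)
  have fp: "w = fst p * inv_scale w x" "x = shift_defect w x - snd p" using sol_fixed_point[OF p] by (simp_all add: w_def x_def)
  have r0: "0 \<le> r" by (simp add: r_def)
  have w_le: "cmod (sol_w p) \<le> 5/2 * cmod (fst p)"
  proof -
    have "cmod w = r * cmod (inv_scale w x)" using fp(1) by (metis norm_mult r_def)
    also have "\<dots> \<le> r * (5/2)" using r0 inv_scale_bound[OF w'(2,3)] by (intro mult_left_mono) auto
    finally show ?thesis by (simp add: w_def r_def)
  qed
  have near: "cmod (g w x - g 0 x) \<le> 4 * B / radius * (5/2 * r)"
    if hol: "(\<lambda>w. g w x) holomorphic_on ball 0 radius" and bd: "\<And>w. cmod w \<le> radius \<Longrightarrow> cmod (g w x) \<le> B" and "0 \<le> B" for g B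
  proof -
    have "cmod (g w x - g 0 x) \<le> 4 * B / radius * cmod w"
      by (rule holomorphic_bound_from_0[of "\<lambda>w. g w x"]) (use hol bd radius w' in auto)
    also have "\<dots> \<le> 4 * B / radius * (5/2 * r)"
      using w_le radius that(3) by (intro mult_left_mono) (auto simp: w_def r_def)
    finally show ?thesis .
  qed
  have "cmod (inv_scale w x - inv_scale 0 x) \<le> 4 * (5/2) / radius * (5/2 * r)"
    using w' by (intro near curve_holomorphic inv_scale_bound) (auto intro!: holomorphic_intros)
  hence inv: "cmod (inv_scale w x - 2) \<le> 25 / radius * r" by (simp add: at_w_0)
  have "cmod (w - 2 * fst p) = r * cmod (inv_scale w x - 2)"
    using fp(1) by (metis norm_mult r_def right_diff_distrib mult.commute)
  also have "\<dots> \<le> r * (25 / radius * r)" using inv r0 by (intro mult_left_mono)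
  finally show "cmod (sol_w p - 2 * fst p) \<le> 25 / radius * (cmod (fst p))\<^sup>2"
    by (simp add: w_def r_def power2_eq_square mult_ac)
  have "cmod (shift_defect w x - shift_defect 0 x) \<le> 4 * (1/32) / radius * (5/2 * r)"
    using w' by (intro near curve_holomorphic radius_bounds(4)) (auto intro!: holomorphic_intros)
  hence "cmod (shift_defect w x) \<le> 5/16 * (r / radius)" by (simp add: at_w_0)
  also have "\<dots> \<le> 1 * (r / radius)" using r0 radius by (intro mult_right_mono) auto
  finally have "cmod (shift_defect w x) \<le> r / radius" by simp
  moreover have "x + snd p = shift_defect w x" using fp(2) by (simp add: algebra_simps)
  ultimately show "cmod (sol_x p + snd p) \<le> 1 / radius * cmod (fst p)"
    by (simp add: x_def r_def)
  have "cmod ((block_weight w x - (x + 1) / 2) - (block_weight 0 x - (x + 1) / 2)) \<le> 4 * 1 / radius * (5/2 * r)"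
    using w' by (intro near[of "\<lambda>w x. block_weight w x - (x + 1) / 2"] holomorphic_intros curve_holomorphic radius_bounds(5)) (auto intro!: holomorphic_intros)
  thus "cmod (block_weight (sol_w p) (sol_x p) - (sol_x p + 1) / 2) \<le> 10 / radius * cmod (fst p)"
    by (simp add: at_w_0 w_def x_def r_def)
qed

section \<open>From the fixed point to the two-point certificate\<close>

lemma tanh_scaled: "cmod (w * y) < 3/4 \<Longrightarrow> tanh (w * y) = w * scaled_tanh w y"
  using tanh_remainder_eq[of "w * y"] by (simp add: scaled_tanh_def power_mult_distrib algebra_simps numeral_eq_Suc)

lemma trapezoid_error_eq:
  assumes "cmod (w * (x - 2)) < 3/4" "cmod (w * x) < 3/4"
  shows "w * (tanh (w * (x - 2)) + tanh (w * x)) - (Ln (cosh (w * x)) - Ln (cosh (w * (x - 2)))) = w ^ 4 * trapezoid_error w x"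
proof -
  define A B C D where "A = tanh_remainder (w * (x - 2))" and "B = tanh_remainder (w * x)" and "C = lncosh_remainder (w * x)" and "D = lncosh_remainder (w * (x - 2))"
  show ?thesis
    unfolding tanh_remainder_eq[OF assms(1)] tanh_remainder_eq[OF assms(2)] lncosh_remainder_eq[OF assms(1)] lncosh_remainder_eq[OF assms(2)] trapezoid_error_def
      A_def[symmetric] B_def[symmetric] C_def[symmetric] D_def[symmetric]
    by (simp add: field_simps) algebra
qed

lemma tanh_minus_self: "\<bar>tanh P - P\<bar> \<le> \<bar>P :: real\<bar> ^ 3 / 3"
proof -
  have pos: "\<bar>tanh P - P\<bar> \<le> \<bar>P\<bar> ^ 3 / 3" if "0 \<le> P" for P :: real
  proof -
    have "(\<lambda>x. x ^ 3 / 3 - x + tanh x) 0 \<le> (\<lambda>x. x ^ 3 / 3 - x + tanh x) P"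
    proof (rule DERIV_nonneg_imp_nondecreasing[OF that])
      fix x :: real assume "0 \<le> x"
      have "((\<lambda>x. x ^ 3 / 3 - x + tanh x) has_real_derivative x\<^sup>2 - (tanh x)\<^sup>2) (at x)"
        by (auto intro!: derivative_eq_intros)
      moreover have "(tanh x)\<^sup>2 \<le> x\<^sup>2" using abs_tanh_le[of x] by (simp add: abs_le_square_iff)
      ultimately show "\<exists>y. ((\<lambda>x. x ^ 3 / 3 - x + tanh x) has_real_derivative y) (at x) \<and> 0 \<le> y"
        by (intro exI[of _ "x\<^sup>2 - (tanh x)\<^sup>2"]) simp
    qed
    thus ?thesis using tanh_le_self[OF that] that by simp
  qed
  show ?thesis
  proof (cases "0 \<le> P")
    case False
    hence "\<bar>tanh (- P) - (- P)\<bar> \<le> \<bar>- P\<bar> ^ 3 / 3" by (intro pos) simp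
    moreover have "\<bar>tanh (- P) - (- P)\<bar> = \<bar>tanh P - P\<bar>" by (simp add: abs_minus_commute)
    ultimately show ?thesis by simp
  qed (rule pos)
qed

text \<open>For \<open>\<bar>\<kappa>\<bar> \<le> 1\<close>, that is \<open>t \<ge> 0\<close>, the complex solution is real, and translating it back gives a certificate.\<close>

locale real_solution =
  fixes \<zeta> \<kappa> w x c :: real
  assumes \<zeta>: "0 < \<zeta>" "\<zeta> < radius / 64" and \<kappa>: "\<bar>\<kappa>\<bar> \<le> 1"
    and w_def: "w = Re (sol_w (of_real \<zeta>, of_real \<kappa>))"
    and x_def: "x = Re (sol_x (of_real \<zeta>, of_real \<kappa>))"
    and c_def: "c = Re (block_weight (sol_w (of_real \<zeta>, of_real \<kappa>)) (sol_x (of_real \<zeta>, of_real \<kappa>)))"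
begin

definition "s1 = (c * tanh (w * (x - 2)) + (1 - c) * tanh (w * x)) / 2"
definition "s2 = (c * tanh (w * x) + (1 - c) * tanh (w * (x + 2))) / 2"

lemma in_param_domain: "(of_real \<zeta>, of_real \<kappa>) \<in> param_domain"
  using \<zeta> \<kappa> by (simp add: param_domain_def)

lemma of_real_sol: "sol_w (of_real \<zeta>, of_real \<kappa>) = of_real w" "sol_x (of_real \<zeta>, of_real \<kappa>) = of_real x"
  using sol_real[OF in_param_domain] by (simp_all add: w_def x_def of_real_Re)

lemma small: "\<bar>w\<bar> \<le> radius" "\<bar>x\<bar> \<le> 4" "\<bar>x\<bar> \<le> 7/4"
  using picard_domain_small(1,2)[OF sol_in_domain[OF in_param_domain]] sol_in_domain[OF in_param_domain] unfolding of_real_sol 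
  by (simp_all add: picard_domain_def)

lemma cmod_small: "cmod (of_real w) \<le> radius" "cmod (of_real x) \<le> 4" "cmod (of_real w) \<le> 1/16"
  using small radius by simp_all

lemma of_real_c: "block_weight (of_real w) (of_real x) = of_real c"
proof -
  have "block_weight (of_real w) (of_real x) \<in> \<real>" by (rule real_on_reals) (use cmod_small in auto)
  thus ?thesis by (simp add: c_def of_real_sol of_real_Re)
qed

lemma of_real_tanh: "of_real (tanh (w * (x + y))) = of_real w * scaled_tanh (of_real w) (of_real x + of_real y)"
  if "y \<in> {-2, 0, 2}"
proof -
  have "tanh (of_real w * (of_real x + of_real y)) = of_real w * scaled_tanh (of_real w) (of_real x + of_real y :: complex)"
    using that arg_small[OF cmod_small(3,2)] by (intro tanh_scaled) auto
  thus ?thesis by (simp only: hyperbolic_of_real flip: of_real_add of_real_mult)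
qed

lemma of_real_s: "of_real w * scaled_degree1 (of_real w) (of_real x) = of_real s1" "of_real w * scaled_degree2 (of_real w) (of_real x) = of_real s2"
proof -
  have *: "complex_of_real (tanh (w * (x - 2))) = of_real w * scaled_tanh (of_real w) (of_real x - 2)"
    "complex_of_real (tanh (w * x)) = of_real w * scaled_tanh (of_real w) (of_real x)"
    "complex_of_real (tanh (w * (x + 2))) = of_real w * scaled_tanh (of_real w) (of_real x + 2)"
    using of_real_tanh[of "-2"] of_real_tanh[of 0] of_real_tanh[of 2] by simp_all
  show "of_real w * scaled_degree1 (of_real w) (of_real x) = of_real s1" "of_real w * scaled_degree2 (of_real w) (of_real x) = of_real s2"
    unfolding s1_def s2_def scaled_degree1_def scaled_degree2_def of_real_c of_real_add of_real_mult of_real_divide of_real_diff *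
    by (simp_all add: algebra_simps)
qed

lemma fixed_point:
  obtains i where "inv_scale (of_real w) (of_real x) = of_real i" "3/2 \<le> i" "i \<le> 5/2" "w = \<zeta> * i"
proof -
  obtain i where i: "inv_scale (of_real w) (of_real x) = of_real i"
    using real_on_reals(1)[OF _ _ cmod_small(1,2)] by (auto elim!: Reals_cases)
  have "cmod (of_real (i - 2)) \<le> 1/2" using radius_bounds(3)[OF cmod_small(1,2)] by (simp add: i)
  hence "3/2 \<le> i" "i \<le> 5/2" unfolding norm_of_real by linarith+
  moreover have "of_real w = (of_real (\<zeta> * i) :: complex)"
    using sol_fixed_point(1)[OF in_param_domain] unfolding of_real_sol i by simp
  hence "w = \<zeta> * i" unfolding of_real_eq_iff .
  ultimately show ?thesis using i that by blast
qed

lemma w_pos: "0 < w" and w_le: "w \<le> 5/2 * \<zeta>"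
proof -
  obtain i where i: "3/2 \<le> i" "i \<le> 5/2" "w = \<zeta> * i" by (rule fixed_point)
  show "0 < w" using i \<zeta> by simp
  have "\<zeta> * i \<le> \<zeta> * (5/2)" using i \<zeta> by (intro mult_left_mono) auto
  thus "w \<le> 5/2 * \<zeta>" using i by simp
qed

lemma first_moment: "\<zeta> * \<kappa> = c * s1 + (1 - c) * s2"
proof -
  obtain i where i: "inv_scale (of_real w) (of_real x) = of_real i" "3/2 \<le> i" "w = \<zeta> * i" by (rule fixed_point)
  define \<mu> where "\<mu> = scaled_mean (of_real w) (of_real x)"
  have "of_real x = of_real x + \<mu> * of_real i - of_real \<kappa>"
    using sol_fixed_point(2)[OF in_param_domain] unfolding of_real_sol shift_defect_def \<mu>_def i(1) by simp
  hence "\<mu> * of_real i = of_real \<kappa>" by simp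
  hence "of_real (\<zeta> * \<kappa>) = of_real w * \<mu>" using i(3) by (simp add: mult_ac)
  also have "\<dots> = of_real c * (of_real w * scaled_degree1 (of_real w) (of_real x)) + (1 - of_real c) * (of_real w * scaled_degree2 (of_real w) (of_real x))"
    unfolding \<mu>_def scaled_mean_def of_real_c by (simp add: algebra_simps)
  also have "\<dots> = of_real (c * s1 + (1 - c) * s2)" unfolding of_real_s by simp
  finally show ?thesis unfolding of_real_eq_iff .
qed

lemma second_moment: "\<zeta>\<^sup>2 = c * s1\<^sup>2 + (1 - c) * s2\<^sup>2"
proof -
  obtain i where i: "inv_scale (of_real w) (of_real x) = of_real i" "3/2 \<le> i" "w = \<zeta> * i" by (rule fixed_point)
  define m where "m = scaled_square (of_real w) (of_real x)"
  have "csqrt m \<noteq> 0" using radius_bounds(2)[OF cmod_small(1,2)] by (auto simp: m_def)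
  moreover have "1 / csqrt m = of_real i" using i(1) by (simp add: inv_scale_def m_def)
  ultimately have "of_real i * csqrt m = 1" by (auto simp: field_simps)
  moreover have "(of_real i)\<^sup>2 * m = (of_real i * csqrt m)\<^sup>2" by (simp add: power_mult_distrib)
  ultimately have im: "(of_real i)\<^sup>2 * m = 1" by simp
  have "of_real (\<zeta>\<^sup>2) = of_real (\<zeta>\<^sup>2) * ((of_real i)\<^sup>2 * m)" unfolding im by simp
  also have "\<dots> = (of_real w)\<^sup>2 * m" unfolding i(3) by (simp add: power_mult_distrib)
  also have "\<dots> = of_real c * (of_real w * scaled_degree1 (of_real w) (of_real x))\<^sup>2 + (1 - of_real c) * (of_real w * scaled_degree2 (of_real w) (of_real x))\<^sup>2"
    unfolding m_def scaled_square_def of_real_c by (simp add: algebra_simps power_mult_distrib)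
  also have "\<dots> = of_real (c * s1\<^sup>2 + (1 - c) * s2\<^sup>2)" unfolding of_real_s by simp
  finally show ?thesis unfolding of_real_eq_iff .
qed

lemma slope: "4/5 * w \<le> s2 - s1"
proof -
  have "cmod (of_real w * (scaled_degree2 (of_real w) (of_real x) - scaled_degree1 (of_real w) (of_real x) - 1)) \<le> w * (1/5)"
    unfolding norm_mult using radius_bounds(6)[OF cmod_small(1,2)] w_pos by (intro mult_mono) auto
  moreover have "of_real w * (scaled_degree2 (of_real w) (of_real x) - scaled_degree1 (of_real w) (of_real x) - 1) = (of_real (s2 - s1 - w) :: complex)"
    by (simp add: right_diff_distrib of_real_s)
  ultimately have "\<bar>s2 - s1 - w\<bar> \<le> w * (1/5)" by (simp only: norm_of_real)
  thus ?thesis by linarith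
qed

lemma contact:
  "w * (c * (tanh (w * (x - 2)) + tanh (w * x)) + (1 - c) * (tanh (w * x) + tanh (w * (x + 2))))
    = c * (lncosh (w * x) - lncosh (w * (x - 2))) + (1 - c) * (lncosh (w * (x + 2)) - lncosh (w * x))"
proof -
  define W X where "W = complex_of_real w" and "X = complex_of_real x"
  note a = arg_small[OF cmod_small(3,2), folded W_def X_def]
  have C: "of_real c * trapezoid_error W X + (1 - of_real c) * trapezoid_error W (X + 2) = 0"
  proof -
    have "trapezoid_diff W X \<noteq> 0" unfolding W_def X_def by (rule radius_bounds(1)[OF cmod_small(1,2)])
    moreover have "of_real c = trapezoid_error W (X + 2) / trapezoid_diff W X" using of_real_c by (simp add: W_def X_def block_weight_def)
    ultimately show ?thesis by (simp add: trapezoid_diff_def field_simps)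
  qed
  have L: "Ln (cosh (W * (X - 2))) = of_real (lncosh (w * (x - 2)))" "Ln (cosh (W * X)) = of_real (lncosh (w * x))"
    "Ln (cosh (W * (X + 2))) = of_real (lncosh (w * (x + 2)))"
    using Ln_cosh_of_real[of "w * (x - 2)"] Ln_cosh_of_real[of "w * x"] Ln_cosh_of_real[of "w * (x + 2)"]
    by (simp_all add: W_def X_def lncosh_def)
  have T: "tanh (W * (X - 2)) = of_real (tanh (w * (x - 2)))" "tanh (W * X) = of_real (tanh (w * x))"
    "tanh (W * (X + 2)) = of_real (tanh (w * (x + 2)))"
    using hyperbolic_of_real(2)[of "w * (x - 2)"] hyperbolic_of_real(2)[of "w * x"] hyperbolic_of_real(2)[of "w * (x + 2)"]
    by (simp_all add: W_def X_def)
  have "of_real c * (W * (tanh (W * (X - 2)) + tanh (W * X)) - (Ln (cosh (W * X)) - Ln (cosh (W * (X - 2)))))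
     + (1 - of_real c) * (W * (tanh (W * (X + 2 - 2)) + tanh (W * (X + 2))) - (Ln (cosh (W * (X + 2))) - Ln (cosh (W * (X + 2 - 2)))))
     = W ^ 4 * (of_real c * trapezoid_error W X + (1 - of_real c) * trapezoid_error W (X + 2))"
    unfolding trapezoid_error_eq[OF a(2,1)] trapezoid_error_eq[OF a(4,3)] by (simp add: algebra_simps)
  hence "of_real (c * (w * (tanh (w * (x - 2)) + tanh (w * x)) - (lncosh (w * x) - lncosh (w * (x - 2))))
     + (1 - c) * (w * (tanh (w * x) + tanh (w * (x + 2))) - (lncosh (w * (x + 2)) - lncosh (w * x)))) = (of_real 0 :: complex)"
    unfolding C add_diff_cancel_right' T L by (simp add: W_def)
  hence "c * (w * (tanh (w * (x - 2)) + tanh (w * x)) - (lncosh (w * x) - lncosh (w * (x - 2))))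
     + (1 - c) * (w * (tanh (w * x) + tanh (w * (x + 2))) - (lncosh (w * (x + 2)) - lncosh (w * x))) = 0"
    unfolding of_real_eq_iff .
  thus ?thesis by (simp add: algebra_simps)
qed

text \<open>The two moments give \<open>c (1 - c) (s2 - s1)\<^sup>2 = \<zeta>\<^sup>2 - (\<zeta> \<kappa>)\<^sup>2 \<ge> 0\<close>.\<close>

lemma c_bounds: "0 \<le> c" "c \<le> 1"
proof -
  have eq: "\<zeta>\<^sup>2 - (\<zeta> * \<kappa>)\<^sup>2 = c * (1 - c) * (s2 - s1)\<^sup>2"
    unfolding first_moment second_moment by (simp add: power2_eq_square algebra_simps)
  have le: "(\<zeta> * \<kappa>)\<^sup>2 \<le> \<zeta>\<^sup>2"
  proof -
    have "\<kappa>\<^sup>2 \<le> 1" using \<kappa> by (simp add: abs_square_le_1)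
    thus ?thesis unfolding power_mult_distrib by (simp add: mult_left_le)
  qed
  have pos: "0 < (s2 - s1)\<^sup>2" using slope w_pos by auto
  have "0 \<le> c * (1 - c)"
  proof (rule ccontr)
    assume "\<not> 0 \<le> c * (1 - c)"
    hence "c * (1 - c) < 0" by simp
    from mult_neg_pos[OF this pos] show False using eq le by linarith
  qed
  thus "0 \<le> c" "c \<le> 1" by (auto simp: zero_le_mult_iff)
qed

lemma certificate:
  assumes "\<zeta> \<le> 1/1000000" "e - 1/2 = \<zeta> * \<kappa>" "(e - 1/2)\<^sup>2 + t = \<zeta>\<^sup>2"
  shows "two_point_certificate c (w * (x - 2) / 2) (w * (x + 2) / 2) s1 s2
     (logistic (w * (x - 2))) (logistic (w * (x + 2))) (logistic (w * x)) e t"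
proof
  have sum: "w * (x - 2) / 2 + w * (x + 2) / 2 = w * x" and dif: "w * (x + 2) / 2 - w * (x - 2) / 2 = 2 * w"
    by (simp_all add: field_simps)
  show "w * (x - 2) / 2 < w * (x + 2) / 2" using dif w_pos by linarith
  have "\<bar>w * y / 2\<bar> \<le> 1/100000" if "\<bar>y\<bar> \<le> 15/4" for y
  proof -
    have "\<bar>w * y\<bar> \<le> (5/2 * (1/1000000)) * (15/4)"
      unfolding abs_mult using w_pos w_le assms(1) that by (intro mult_mono) auto
    thus ?thesis by simp
  qed
  note * = this
  show "\<bar>w * (x - 2) / 2\<bar> \<le> 1/100000" "\<bar>w * (x + 2) / 2\<bar> \<le> 1/100000"
    using small(3) by (intro *; linarith)+
  show "0 \<le> c" "c \<le> 1" by (rule c_bounds)+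
  have e: "w * (x - 2) / 2 + w * (x - 2) / 2 = w * (x - 2)" "w * (x + 2) / 2 + w * (x + 2) / 2 = w * (x + 2)"
    "w * (x + 2) / 2 + w * (x - 2) / 2 = w * x" by (simp_all add: field_simps)
  show "double_contact c (w * (x - 2) / 2) (w * (x + 2) / 2)"
    unfolding double_contact_def mixture_def e sum dif using contact by (simp add: algebra_simps)
  show "logistic (w * (x - 2)) = logistic (2 * (w * (x - 2) / 2))" "logistic (w * (x + 2)) = logistic (2 * (w * (x + 2) / 2))"
    "logistic (w * x) = logistic (w * (x - 2) / 2 + w * (x + 2) / 2)" unfolding sum by simp_all
  show "s1 = c * logistic (w * (x - 2)) + (1 - c) * logistic (w * x) - 1/2"
    "s2 = c * logistic (w * x) + (1 - c) * logistic (w * (x + 2)) - 1/2"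
    by (simp_all add: s1_def s2_def logistic_def field_simps)
  show "w * (x + 2) / 2 - w * (x - 2) / 2 \<le> 5/2 * (s2 - s1)" unfolding dif using slope by simp
  show "e - 1/2 = c * s1 + (1 - c) * s2" using assms(2) first_moment by simp
  show "(e - 1/2)\<^sup>2 + t = c * s1\<^sup>2 + (1 - c) * s2\<^sup>2" using assms(3) second_moment by simp
qed

lemma asymptotics_c: "\<bar>c - 1/2 * (1 - \<kappa>)\<bar> \<le> 11 / radius * \<zeta>"
proof -
  have "cmod (of_real (c - (x + 1) / 2)) \<le> 10 / radius * \<zeta>"
    using sol_asymptotics(3)[OF in_param_domain] \<zeta>(1) unfolding of_real_sol of_real_c by simp
  hence 1: "\<bar>c - (x + 1) / 2\<bar> \<le> 10 / radius * \<zeta>" by (simp only: norm_of_real)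
  have "cmod (of_real (x + \<kappa>)) \<le> 1 / radius * \<zeta>"
    using sol_asymptotics(2)[OF in_param_domain] \<zeta>(1) unfolding of_real_sol by simp
  hence 2: "\<bar>x + \<kappa>\<bar> \<le> 1 / radius * \<zeta>" by (simp only: norm_of_real)
  have eq: "c - 1/2 * (1 - \<kappa>) = (c - (x + 1) / 2) + (x + \<kappa>) / 2" by (simp add: field_simps)
  have "\<bar>c - 1/2 * (1 - \<kappa>)\<bar> \<le> \<bar>c - (x + 1) / 2\<bar> + \<bar>x + \<kappa>\<bar>"
    unfolding eq by (rule order_trans[OF abs_triangle_ineq]) simp
  also have "\<dots> \<le> 10 / radius * \<zeta> + 1 / radius * \<zeta>" using 1 2 by linarith
  also have "\<dots> = 11 / radius * \<zeta>" by (simp flip: distrib_right add_divide_distrib)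
  finally show ?thesis .
qed

lemma asymptotics_block:
  assumes y: "\<bar>y\<bar> \<le> 2" and "\<zeta> \<le> 1"
  shows "\<bar>logistic (w * (x + y)) - (1/2 - \<zeta> * \<kappa> + \<zeta> * y)\<bar> \<le> (167 + 51 / radius) * \<zeta>\<^sup>2"
proof -
  define P where "P = w * (x + y)"
  have "cmod (of_real (w - 2 * \<zeta>)) \<le> 25 / radius * \<zeta>\<^sup>2"
    using sol_asymptotics(1)[OF in_param_domain] \<zeta>(1) unfolding of_real_sol by simp
  hence 1: "\<bar>w - 2 * \<zeta>\<bar> \<le> 25 / radius * \<zeta>\<^sup>2" by (simp only: norm_of_real)
  have "cmod (of_real (x + \<kappa>)) \<le> 1 / radius * \<zeta>"
    using sol_asymptotics(2)[OF in_param_domain] \<zeta>(1) unfolding of_real_sol by simp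
  hence 2: "\<bar>x + \<kappa>\<bar> \<le> 1 / radius * \<zeta>" by (simp only: norm_of_real)
  have xy: "\<bar>x + y\<bar> \<le> 4" using small(3) y by linarith
  have P: "\<bar>P\<bar> \<le> 10 * \<zeta>"
  proof -
    have "\<bar>P\<bar> \<le> (5/2 * \<zeta>) * 4" unfolding P_def abs_mult using w_pos w_le xy by (intro mult_mono) auto
    thus ?thesis by simp
  qed
  have 3: "\<bar>tanh P - P\<bar> \<le> 1000 / 3 * \<zeta>\<^sup>2"
  proof -
    have "\<bar>tanh P - P\<bar> \<le> \<bar>P\<bar> ^ 3 / 3" by (rule tanh_minus_self)
    also have "\<dots> \<le> (10 * \<zeta>) ^ 3 / 3" using P by (intro divide_right_mono power_mono) auto
    also have "\<dots> = 1000 / 3 * \<zeta>\<^sup>2 * \<zeta>" by (simp add: power3_eq_cube power2_eq_square)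
    also have "\<dots> \<le> 1000 / 3 * \<zeta>\<^sup>2 * 1" using assms(2) by (intro mult_left_mono) auto
    finally show ?thesis by simp
  qed
  have 4: "\<bar>(w - 2 * \<zeta>) * (x + y)\<bar> \<le> 25 / radius * \<zeta>\<^sup>2 * 4"
    unfolding abs_mult using 1 xy radius(1) by (intro mult_mono) auto
  have 5: "\<bar>\<zeta> * (x + \<kappa>)\<bar> \<le> 1 / radius * \<zeta>\<^sup>2"
    using mult_left_mono[OF 2, of \<zeta>] \<zeta>(1) by (simp add: abs_mult power2_eq_square mult_ac)
  have eq: "logistic P - (1/2 - \<zeta> * \<kappa> + \<zeta> * y) = (tanh P - P) / 2 + (w - 2 * \<zeta>) * (x + y) / 2 + \<zeta> * (x + \<kappa>)"
    by (simp add: logistic_def P_def field_simps)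
  have "\<bar>logistic P - (1/2 - \<zeta> * \<kappa> + \<zeta> * y)\<bar> \<le> 1000 / 6 * \<zeta>\<^sup>2 + 50 / radius * \<zeta>\<^sup>2 + 1 / radius * \<zeta>\<^sup>2"
  proof -
    have "\<bar>A / 2 + B / 2 + C\<bar> \<le> a' / 2 + b' / 2 + c'" if "\<bar>A\<bar> \<le> a'" "\<bar>B\<bar> \<le> b'" "\<bar>C\<bar> \<le> c'" for A B C a' b' c' :: real
      using that by linarith
    from this[OF 3 4 5] show ?thesis unfolding eq by simp
  qed
  also have "\<dots> = (1000 / 6 + 51 / radius) * \<zeta>\<^sup>2" by (simp add: distrib_right flip: add_divide_distrib)
  also have "\<dots> \<le> (167 + 51 / radius) * \<zeta>\<^sup>2" by (intro mult_right_mono) auto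
  finally show ?thesis by (simp add: P_def)
qed

end


section \<open>Achievable densities\<close>

lemma reduced_density_nonneg:
  assumes "has_densities g e t"
  shows "0 \<le> t"
proof -
  have g: "graphon g" using assms by (simp add: has_densities_def)
  have I: "integrable unit_measure (degree_fun g)" "integrable unit_measure (\<lambda>x. (degree_fun g x)\<^sup>2)"
  proof -
    have b: "\<bar>degree_fun g x\<bar> \<le> 1" if "x \<in> space unit_measure" for x using graphon_degree(2,3)[OF g] that by auto
    show "integrable unit_measure (degree_fun g)"
      using U.integrable_continuous_bounded[OF graphon_degree(1)[OF g] b, of "\<lambda>x. x"] by simp
    show "integrable unit_measure (\<lambda>x. (degree_fun g x)\<^sup>2)"
      by (rule U.integrable_continuous_bounded[OF graphon_degree(1)[OF g] b, of "\<lambda>x. x\<^sup>2"]) (auto intro!: continuous_intros)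
  qed
  have e: "(LINT x|unit_measure. degree_fun g x) = e" 
    using assms by (simp add: has_densities_def edge_density_def degree_fun_def)
  have "0 \<le> (LINT x|unit_measure. (degree_fun g x - e)\<^sup>2)" by (intro integral_nonneg_AE) auto
  also have "\<dots> = (LINT x|unit_measure. (degree_fun g x)\<^sup>2 - 2 * e * degree_fun g x + e\<^sup>2)"
    by (intro Bochner_Integration.integral_cong) (auto simp: power2_eq_square algebra_simps)
  also have "\<dots> = two_star_density g - e\<^sup>2"
    using I e by (simp add: two_star_density_def power2_eq_square)
  finally show ?thesis using assms by (auto simp: has_densities_def reduced_two_star_density_def)
qed

lemma achievable_nonneg: "(e, t) \<in> achievable \<Longrightarrow> 0 \<le> t"
  using reduced_density_nonneg by (auto simp: achievable_def)

lemma zeta_sq: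
  assumes "(e, t) \<in> achievable"
  shows "(zeta (e, t))\<^sup>2 = (e - 1/2)\<^sup>2 + t" "0 \<le> zeta (e, t)"
  using achievable_nonneg[OF assms] by (simp_all add: zeta_def)

lemma zeta_eq_0:
  assumes "(e, t) \<in> achievable" "zeta (e, t) = 0"
  shows "e = 1/2" "t = 0"
proof -
  have "(e - 1/2)\<^sup>2 + t = 0" using zeta_sq(1)[OF assms(1)] assms(2) by simp
  moreover have "0 \<le> (e - 1/2)\<^sup>2" "0 \<le> t" using achievable_nonneg[OF assms(1)] by auto
  ultimately show "e = 1/2" "t = 0" by (auto simp: add_nonneg_eq_0_iff)
qed

text \<open>At the singular point \<open>(1/2, 0)\<close> the second component is \<open>0\<close> by the convention for division; the parameters computed from
it still describe the constant graphon \<open>1/2\<close>.\<close>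

definition sol_at :: "real \<times> real \<Rightarrow> complex \<times> complex" where
  "sol_at p = (of_real (zeta p), of_real ((fst p - 1/2) / zeta p))"

definition block_value :: "complex \<Rightarrow> complex \<Rightarrow> complex \<Rightarrow> complex" where
  "block_value y w x = (1 + tanh (w * (x + y))) / 2"

definition param_a :: "real \<times> real \<Rightarrow> real" where
  "param_a p = Re (block_value (-2) (sol_w (sol_at p)) (sol_x (sol_at p)))"

definition param_b :: "real \<times> real \<Rightarrow> real" where
  "param_b p = Re (block_value 2 (sol_w (sol_at p)) (sol_x (sol_at p)))"

definition param_d :: "real \<times> real \<Rightarrow> real" where
  "param_d p = Re (block_value 0 (sol_w (sol_at p)) (sol_x (sol_at p)))"

definition param_c :: "real \<times> real \<Rightarrow> real" where
  "param_c p = Re (block_weight (sol_w (sol_at p)) (sol_x (sol_at p)))"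

text \<open>Since \<open>w \<le> 5/2 * \<zeta>\<close> and \<open>\<bar>x \<plusminus> 2\<bar> \<le> 15/4\<close>, the second bound keeps the atoms below \<open>1/100000\<close>.\<close>

definition zeta_max :: real where "zeta_max = min (radius / 64) (1/1000000)"

lemma zeta_max_pos: "0 < zeta_max" using radius(1) by (simp add: zeta_max_def)

lemma real_solution_at:
  assumes p: "(e, t) \<in> achievable" and z: "0 < zeta (e, t)" "zeta (e, t) < zeta_max"
  shows "real_solution (zeta (e, t)) ((e - 1/2) / zeta (e, t)) (Re (sol_w (sol_at (e, t)))) (Re (sol_x (sol_at (e, t)))) (param_c (e, t))"
proof
  show "0 < zeta (e, t)" "zeta (e, t) < radius / 64" using z by (auto simp: zeta_max_def)
  have "(e - 1/2)\<^sup>2 \<le> (zeta (e, t))\<^sup>2" using zeta_sq(1)[OF p] achievable_nonneg[OF p] by simp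
  hence "\<bar>e - 1/2\<bar> \<le> zeta (e, t)" using z(1) by (metis abs_le_square_iff abs_of_pos)
  thus "\<bar>(e - 1/2) / zeta (e, t)\<bar> \<le> 1" using z(1) by (simp add: abs_divide)
qed (simp_all add: sol_at_def param_c_def)

lemma (in real_solution) block_value_real:
  "Re (block_value (of_real y) (of_real w) (of_real x)) = logistic (w * (x + y))"
proof -
  have "block_value (of_real y) (of_real w) (of_real x) = of_real (logistic (w * (x + y)))"
    unfolding block_value_def logistic_def of_real_add[symmetric] of_real_mult[symmetric] hyperbolic_of_real by simp
  thus ?thesis by simp
qed

lemma params_at:
  assumes p: "(e, t) \<in> achievable" and z: "0 < zeta (e, t)" "zeta (e, t) < zeta_max"
  defines "w \<equiv> Re (sol_w (sol_at (e, t)))" and "x \<equiv> Re (sol_x (sol_at (e, t)))"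
  shows "param_a (e, t) = logistic (w * (x - 2))" "param_b (e, t) = logistic (w * (x + 2))" "param_d (e, t) = logistic (w * x)"
proof -
  interpret S: real_solution "zeta (e, t)" "(e - 1/2) / zeta (e, t)" w x "param_c (e, t)"
    unfolding w_def x_def by (rule real_solution_at[OF p z])
  have at: "sol_at (e, t) = (of_real (zeta (e, t)), of_real ((e - 1/2) / zeta (e, t)))" by (simp add: sol_at_def)
  show "param_a (e, t) = logistic (w * (x - 2))" "param_b (e, t) = logistic (w * (x + 2))" "param_d (e, t) = logistic (w * x)"
    unfolding param_a_def param_b_def param_d_def at S.of_real_sol
    using S.block_value_real[of "-2"] S.block_value_real[of 2] S.block_value_real[of 0] by simp_all
qed

lemma certificate_at:
  assumes p: "(e, t) \<in> achievable" and z: "0 < zeta (e, t)" "zeta (e, t) < zeta_max"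
  shows "\<exists>q1 q2 s1 s2. two_point_certificate (param_c (e, t)) q1 q2 s1 s2 (param_a (e, t)) (param_b (e, t)) (param_d (e, t)) e t"
proof -
  define w x where "w = Re (sol_w (sol_at (e, t)))" and "x = Re (sol_x (sol_at (e, t)))"
  interpret S: real_solution "zeta (e, t)" "(e - 1/2) / zeta (e, t)" w x "param_c (e, t)"
    unfolding w_def x_def by (rule real_solution_at[OF p z])
  have "two_point_certificate (param_c (e, t)) (w * (x - 2) / 2) (w * (x + 2) / 2) S.s1 S.s2
     (logistic (w * (x - 2))) (logistic (w * (x + 2))) (logistic (w * x)) e t"
    using z zeta_sq(1)[OF p] by (intro S.certificate) (auto simp: zeta_max_def)
  thus ?thesis unfolding params_at[OF p z, folded w_def x_def] by blast
qed

lemma param_asymptotics: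
  assumes p: "(e, t) \<in> achievable" and z: "0 < zeta (e, t)" "zeta (e, t) < zeta_max"
  shows "\<bar>param_a (e, t) - (1 - e - 2 * zeta (e, t))\<bar> \<le> (167 + 51 / radius) * (zeta (e, t))\<^sup>2"
    and "\<bar>param_b (e, t) - (1 - e + 2 * zeta (e, t))\<bar> \<le> (167 + 51 / radius) * (zeta (e, t))\<^sup>2"
    and "\<bar>param_d (e, t) - (1 - e)\<bar> \<le> (167 + 51 / radius) * (zeta (e, t))\<^sup>2"
    and "\<bar>param_c (e, t) - 1/2 * (1 - (e - 1/2) / zeta (e, t))\<bar> \<le> 11 / radius * zeta (e, t)"
proof -
  define w x where "w = Re (sol_w (sol_at (e, t)))" and "x = Re (sol_x (sol_at (e, t)))"
  interpret S: real_solution "zeta (e, t)" "(e - 1/2) / zeta (e, t)" w x "param_c (e, t)"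
    unfolding w_def x_def by (rule real_solution_at[OF p z])
  have z1: "zeta (e, t) \<le> 1" using z by (simp add: zeta_max_def)
  have e: "1/2 - zeta (e, t) * ((e - 1/2) / zeta (e, t)) + zeta (e, t) * y = 1 - e + y * zeta (e, t)" for y
    using z(1) by (simp add: field_simps)
  note eqs = params_at[OF p z, folded w_def x_def]
  show "\<bar>param_a (e, t) - (1 - e - 2 * zeta (e, t))\<bar> \<le> (167 + 51 / radius) * (zeta (e, t))\<^sup>2"
    using S.asymptotics_block[of "-2", OF _ z1] unfolding e eqs by simp
  show "\<bar>param_b (e, t) - (1 - e + 2 * zeta (e, t))\<bar> \<le> (167 + 51 / radius) * (zeta (e, t))\<^sup>2"
    using S.asymptotics_block[of 2, OF _ z1] unfolding e eqs by simp
  show "\<bar>param_d (e, t) - (1 - e)\<bar> \<le> (167 + 51 / radius) * (zeta (e, t))\<^sup>2"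
    using S.asymptotics_block[of 0, OF _ z1] unfolding e eqs by simp
  show "\<bar>param_c (e, t) - 1/2 * (1 - (e - 1/2) / zeta (e, t))\<bar> \<le> 11 / radius * zeta (e, t)"
    by (rule S.asymptotics_c)
qed

section \<open>Optimality and uniqueness\<close>

lemma maximizer_of_certificate:
  assumes cert: "two_point_certificate c q1 q2 s1 s2 a b d e t"
  shows "a \<in> {0..1}" "b \<in> {0..1}" "c \<in> {0..1}" "d \<in> {0..1}"
    and "entropy_maximizer (bipodal a b c d) e t"
    and "entropy_maximizer g e t \<Longrightarrow> cut_distance g (bipodal a b c d) = 0"
proof -
  interpret two_point_certificate c q1 q2 s1 s2 a b d e t by (rule cert)
  show abd01: "a \<in> {0..1}" "b \<in> {0..1}" "d \<in> {0..1}" 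
    using logistic_bounds by (auto simp: abd intro: less_imp_le)
  show "c \<in> {0..1}" using c by simp
  show max: "entropy_maximizer (bipodal a b c d) e t"
    unfolding entropy_maximizer_def using bipodal_has_densities entropy_bound(1) by blast
  assume g: "entropy_maximizer g e t"
  hence hg: "has_densities g e t" by (simp add: entropy_maximizer_def)
  have "shannon_entropy g = shannon_entropy (bipodal a b c d)"
    using g max entropy_bound(1)[OF hg] bipodal_has_densities by (intro antisym) (auto simp: entropy_maximizer_def)
  from entropy_bound(2)[OF hg this] obtain A where "A \<in> sets unit_measure" "measure unit_measure A = c"
    "AE (x, y) in unit_square.
          g x y = (if x \<in> A then if y \<in> A then a else d else if y \<in> A then d else b)" by blast
  moreover have "graphon g" using hg by (simp add: has_densities_def)
  ultimately show "cut_distance g (bipodal a b c d) = 0"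
    using abd01 c by (intro cut_distance_two_block)
qed

text \<open>At the singular point both atoms coincide and there is no certificate, but \<open>H\<close> itself has its unique maximum at
\<open>1/2\<close>.\<close>

lemma maximizer_at_half:
  shows "entropy_maximizer (bipodal (1/2) (1/2) (1/2) (1/2)) (1/2) 0"
    and "entropy_maximizer g (1/2) 0 \<Longrightarrow> cut_distance g (bipodal (1/2) (1/2) (1/2) (1/2)) = 0"
proof -
  let ?h = "bipodal (1/2) (1/2) (1/2) (1/2)"
  have dens: "has_densities ?h (1/2) 0"
    unfolding has_densities_def reduced_two_star_density_def
    by (simp add: graphon_bipodal bipodal_densities power2_eq_square)
  have half: "entropy_density (1/2) = ln 2 / 2"
    using entropy_density_dual(2)[of "1/2" 0] by (simp add: logistic_def lncosh_def)
  have Sh: "shannon_entropy ?h = ln 2 / 2" by (simp add: bipodal_densities half)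
  have I: "integrable unit_square (\<lambda>(x, y). entropy_density (g x y))" and bd: "\<And>x y. x \<in> {0..1} \<Longrightarrow> y \<in> {0..1} \<Longrightarrow> g x y \<in> {0..1}"
    if g: "graphon g" for g
  proof -
    show b: "\<And>x y. x \<in> {0..1} \<Longrightarrow> y \<in> {0..1} \<Longrightarrow> g x y \<in> {0..1}" using g by (simp add: graphon_def)
    have m: "(\<lambda>z. g (fst z) (snd z)) \<in> borel_measurable unit_square" using g by (simp add: graphon_def case_prod_beta')
    have "(\<lambda>(x, y). entropy_density (g x y)) \<in> borel_measurable unit_square"
      unfolding case_prod_beta' by (rule measurable_compose[OF m entropy_density_measurable])
    thus "integrable unit_square (\<lambda>(x, y). entropy_density (g x y))"
      by (rule UU_integrable_bounded[of _ "ln 2 / 2"]) (use b entropy_density_bounds in auto)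
  qed
  have S: "shannon_entropy g = (LINT z|unit_square. (case z of (x, y) \<Rightarrow> entropy_density (g x y)))" if "graphon g" for g
    unfolding shannon_entropy_def by (rule UU_iterated(1)[OF I[OF that]])
  have le: "shannon_entropy g \<le> ln 2 / 2" if g: "graphon g" for g
  proof -
    have "shannon_entropy g \<le> (LINT z|unit_square. ln 2 / 2)"
      unfolding S[OF g] using I[OF g] bd[OF g] entropy_density_bounds(2)
      by (intro integral_mono) (auto simp: space_pair_measure)
    thus ?thesis by (simp add: UU.P.prob_space)
  qed
  show max: "entropy_maximizer ?h (1/2) 0"
    unfolding entropy_maximizer_def Sh using dens le by (auto simp: has_densities_def)
  assume gm: "entropy_maximizer g (1/2) 0"
  hence g: "graphon g" by (simp add: entropy_maximizer_def has_densities_def)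
  have "shannon_entropy g = ln 2 / 2"
    using gm dens le[OF g] Sh by (intro antisym) (auto simp: entropy_maximizer_def)
  hence "(LINT z|unit_square. ln 2 / 2 - (case z of (x, y) \<Rightarrow> entropy_density (g x y))) = 0"
    using I[OF g] S[OF g] by (simp add: UU.P.prob_space)
  moreover have "integrable unit_square (\<lambda>z. ln 2 / 2 - (case z of (x, y) \<Rightarrow> entropy_density (g x y)))"
    using I[OF g] by auto
  moreover have "AE z in unit_square. 0 \<le> ln 2 / 2 - (case z of (x, y) \<Rightarrow> entropy_density (g x y))"
    using bd[OF g] entropy_density_bounds(2) by (intro AE_I2) (auto simp: space_pair_measure)
  ultimately have "AE z in unit_square. ln 2 / 2 - (case z of (x, y) \<Rightarrow> entropy_density (g x y)) = 0"
    using integral_nonneg_eq_0_iff_AE by blast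
  hence "AE (x, y) in unit_square. g x y = 1/2"
  proof (rule AE_mp, intro AE_I2 impI)
    fix z assume z: "z \<in> space unit_square" "ln 2 / 2 - (case z of (x, y) \<Rightarrow> entropy_density (g x y)) = 0"
    obtain x y where [simp]: "z = (x, y)" by fastforce
    have "g x y \<in> {0..1}" using z(1) by (intro bd[OF g]) (auto simp: space_pair_measure)
    thus "case z of (x, y) \<Rightarrow> g x y = 1/2"
      using z(2) entropy_density_dual(2)[of "g x y" 0] by (auto simp: logistic_def lncosh_def)
  qed
  moreover have A: "{0..<1/2::real} \<in> sets unit_measure" by (auto simp: sets_unit_measure_iff)
  moreover have "measure unit_measure {0..<1/2::real} = 1/2" by (simp add: measure_unit_measure_eq[OF A])
  ultimately show "cut_distance g ?h = 0"
    by (intro cut_distance_two_block[OF g, where A = "{0..<1/2}"]) auto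
qed

lemma params_at_half:
  "param_a (1/2, 0) = 1/2" "param_b (1/2, 0) = 1/2" "param_c (1/2, 0) = 1/2" "param_d (1/2, 0) = 1/2"
proof -
  have at: "sol_at (1/2, 0) = (0, 0)" by (simp add: sol_at_def zeta_def)
  have p: "(0, 0) \<in> param_domain" using radius(1) by (simp add: param_domain_def)
  have W: "sol_w (0, 0) = 0" using sol_fixed_point(1)[OF p] by simp
  have X: "sol_x (0, 0) = 0" using sol_fixed_point(2)[OF p] by (simp add: W at_w_0)
  show "param_a (1/2, 0) = 1/2" "param_b (1/2, 0) = 1/2" "param_c (1/2, 0) = 1/2" "param_d (1/2, 0) = 1/2"
    by (simp_all add: param_a_def param_b_def param_c_def param_d_def at W X block_value_def at_w_0)
qed

section \<open>Analyticity\<close>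

text \<open>Near a point of the region, \<open>\<zeta>\<close> and \<open>\<kappa>\<close> extend to complex \<open>(e, t)\<close> through the principal square root, since
\<open>(e - 1/2)\<^sup>2 + t\<close> stays in the right half plane. The extension ignores the sign of \<open>t\<close>, so that boundary points with \<open>t = 0\<close> are
treated like interior ones.\<close>

lemma analytic_of_sol:
  fixes G :: "complex \<Rightarrow> complex \<Rightarrow> complex"
  assumes hol: "\<And>U w x. w holomorphic_on U \<Longrightarrow> x holomorphic_on U \<Longrightarrow> (\<And>s. s \<in> U \<Longrightarrow> cmod (w s) < radius \<and> cmod (x s) < 4)
      \<Longrightarrow> (\<lambda>s. G (w s) (x s)) holomorphic_on U"
    and bd: "\<And>w x. cmod w < radius \<Longrightarrow> cmod x < 4 \<Longrightarrow> cmod (G w x) \<le> B"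
    and h: "\<And>p. h p = Re (G (sol_w (sol_at p)) (sol_x (sol_at p)))"
  shows "real_analytic2_on h ({p \<in> achievable. zeta p < zeta_max} - {(1 / 2, 0)})"
proof (rule real_analytic2_onI)
  fix x0 y0 :: real
  assume xy: "(x0, y0) \<in> {p \<in> achievable. zeta p < zeta_max} - {(1 / 2, 0)}"
  hence ach: "(x0, y0) \<in> achievable" and z_lt: "zeta (x0, y0) < zeta_max" and ne: "(x0, y0) \<noteq> (1/2, 0)" by auto
  have z_pos: "0 < zeta (x0, y0)"
    using zeta_sq(2)[OF ach] zeta_eq_0[OF ach] ne by (auto simp: less_le)
  interpret S: real_solution "zeta (x0, y0)" "(x0 - 1/2) / zeta (x0, y0)" "Re (sol_w (sol_at (x0, y0)))" "Re (sol_x (sol_at (x0, y0)))" "param_c (x0, y0)"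
    by (rule real_solution_at[OF ach z_pos z_lt])
  define Q where "Q p = (of_real x0 + fst p - 1/2)\<^sup>2 + of_real y0 + snd p" for p :: "complex \<times> complex"
  define Z where "Z p = csqrt (Q p)" for p
  define K where "K p = (of_real x0 + fst p - 1/2) / Z p" for p
  have Q_real: "Q (of_real (x - x0), of_real (y - y0)) = of_real ((x - 1/2)\<^sup>2 + y)" for x y
    by (simp add: Q_def)
  have Z_real: "(Z (of_real (x - x0), of_real (y - y0)), K (of_real (x - x0), of_real (y - y0))) = sol_at (x, y)" 
    if "0 \<le> (x - 1/2)\<^sup>2 + y" for x y
  proof -
    have "Z (of_real (x - x0), of_real (y - y0)) = of_real (zeta (x, y))"
      unfolding Z_def Q_real zeta_def prod.case using that by (subst csqrt_of_real_nonneg) simp_all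
    thus ?thesis by (simp add: K_def sol_at_def)
  qed
  have Q0: "Q (0, 0) = of_real ((zeta (x0, y0))\<^sup>2)" using Q_real[of x0 y0] zeta_sq(1)[OF ach] by simp
  have Q0_pos: "0 < Re (Q (0, 0))" unfolding Q0 using z_pos by simp
  have Z0: "(Z (0, 0), K (0, 0)) = sol_at (x0, y0)"
    using Z_real[of x0 y0] zeta_sq(1)[OF ach] zero_le_power2[of "zeta (x0, y0)"] by simp
  have "isCont Q (0, 0)" unfolding Q_def by (intro continuous_intros)
  hence Q_lim: "(Q \<longlongrightarrow> Q (0, 0)) (nhds (0, 0))" by (simp add: isCont_def tendsto_at_iff_tendsto_nhds)
  have Z_lim: "(Z \<longlongrightarrow> Z (0, 0)) (nhds (0, 0))"
    unfolding Z_def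
  proof (rule isCont_tendsto_compose[OF _ Q_lim])
    show "isCont csqrt (Q (0, 0))" by (rule continuous_at_csqrt) (use Q0_pos in \<open>auto simp: complex_nonpos_Reals_iff\<close>)
  qed
  have "Z (0, 0) \<noteq> 0" using Z0 z_pos by (simp add: sol_at_def)
  moreover have "((\<lambda>p. fst p) \<longlongrightarrow> fst (0::complex, 0::complex)) (nhds (0::complex, 0::complex))" by (rule tendsto_fst[OF filterlim_ident])
  ultimately have K_lim: "(K \<longlongrightarrow> K (0, 0)) (nhds (0, 0))"
    unfolding K_def by (intro tendsto_intros Z_lim filterlim_ident) auto
  have "0 < Re (Q (0, 0)) \<and> cmod (Z (0, 0)) < radius / 64 \<and> cmod (K (0, 0)) < 3/2"
    using Q0_pos S.in_param_domain Z0 by (simp add: param_domain_def sol_at_def)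
  hence "\<forall>\<^sub>F p in nhds (0, 0). 0 < Re (Q p) \<and> cmod (Z p) < radius / 64 \<and> cmod (K p) < 3/2"
    using order_tendstoD(1)[OF tendsto_Re[OF Q_lim], of 0] order_tendstoD(2)[OF tendsto_norm[OF Z_lim], of "radius / 64"]
      order_tendstoD(2)[OF tendsto_norm[OF K_lim], of "3/2"] by (auto intro: eventually_conj)
  then obtain r where r: "r > 0" "\<And>p. dist p (0, 0) < r \<Longrightarrow> 0 < Re (Q p) \<and> cmod (Z p) < radius / 64 \<and> cmod (K p) < 3/2"
    unfolding eventually_nhds_metric by blast
  define R where "R = r / 2"
  have R: "0 < R" using r by (simp add: R_def)
  have good: "0 < Re (Q (u, v))" "(Z (u, v), K (u, v)) \<in> param_domain" if "cmod u < R" "cmod v < R" for u v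
  proof -
    have "dist (u, v) (0, 0) \<le> cmod u + cmod v" using norm_Pair_le[of u v] by (simp add: dist_norm)
    hence "dist (u, v) (0, 0) < r" using that by (simp add: R_def)
    from r(2)[OF this] show "0 < Re (Q (u, v))" "(Z (u, v), K (u, v)) \<in> param_domain" by (auto simp: param_domain_def)
  qed
  have Z_nz: "Z (u, v) \<noteq> 0" "Q (u, v) \<notin> \<real>\<^sub>\<le>\<^sub>0" if "cmod u < R" "cmod v < R" for u v
    using good(1)[OF that] by (auto simp: Z_def complex_nonpos_Reals_iff)
  define f where "f u v = G (sol_w (Z (u, v), K (u, v))) (sol_x (Z (u, v), K (u, v)))" for u v
  have curve: "(\<lambda>s. f (u s) (v s)) holomorphic_on ball 0 R"
    if uv: "u holomorphic_on ball 0 R" "v holomorphic_on ball 0 R" and "\<And>s. s \<in> ball 0 R \<Longrightarrow> cmod (u s) < R \<and> cmod (v s) < R" for u v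
  proof -
    have Qh: "(\<lambda>s. Q (u s, v s)) holomorphic_on ball 0 R"
      unfolding Q_def fst_conv snd_conv by (intro holomorphic_intros uv)
    have Zh: "(\<lambda>s. Z (u s, v s)) holomorphic_on ball 0 R"
      unfolding Z_def using Z_nz(2) that(3) by (intro holomorphic_on_csqrt' Qh) auto
    have Kh: "(\<lambda>s. K (u s, v s)) holomorphic_on ball 0 R"
      unfolding K_def fst_conv using Z_nz(1) that(3) by (intro holomorphic_intros uv Zh) auto
    have par: "(Z (u s, v s), K (u s, v s)) \<in> param_domain" if "s \<in> ball 0 R" for s
      using good(2) \<open>\<And>s. s \<in> ball 0 R \<Longrightarrow> cmod (u s) < R \<and> cmod (v s) < R\<close>[OF that] by blast
    show ?thesis
      unfolding f_def
    proof (rule hol)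
      show "(\<lambda>s. sol_w (Z (u s, v s), K (u s, v s))) holomorphic_on ball 0 R"
        "(\<lambda>s. sol_x (Z (u s, v s), K (u s, v s))) holomorphic_on ball 0 R"
        by (rule sol_holomorphic[OF open_ball Zh Kh par]; assumption)+
      show "cmod (sol_w (Z (u s, v s), K (u s, v s))) < radius \<and> cmod (sol_x (Z (u s, v s), K (u s, v s))) < 4" if "s \<in> ball 0 R" for s
        using picard_domain_small(5,6)[OF sol_in_domain[OF par[OF that]]] by simp
    qed
  qed
  have "sep_holomorphic f R B"
    unfolding sep_holomorphic_def
  proof (intro conjI ballI)
    show "(\<lambda>u. f u v) holomorphic_on ball 0 R" if "v \<in> ball 0 R" for v
      using that by (intro curve) (auto intro!: holomorphic_intros)
    show "(\<lambda>v. f u v) holomorphic_on ball 0 R" if "u \<in> ball 0 R" for u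
      using that by (intro curve[of "\<lambda>_. u"]) (auto intro!: holomorphic_intros)
    fix u v :: complex assume "u \<in> ball 0 R" "v \<in> ball 0 R"
    hence "(Z (u, v), K (u, v)) \<in> param_domain" by (intro good) auto
    from picard_domain_small(5,6)[OF sol_in_domain[OF this]] show "cmod (f u v) \<le> B" unfolding f_def by (intro bd) simp_all
  qed
  moreover have "h (x, y) = Re (f (of_real (x - x0)) (of_real (y - y0)))"
    if "(x, y) \<in> {p \<in> achievable. zeta p < zeta_max} - {(1 / 2, 0)}" for x y
  proof -
    have "0 \<le> (x - 1/2)\<^sup>2 + y" using that achievable_nonneg[of x y] by simp
    note Z = Z_real[OF this]
    show ?thesis unfolding f_def Z h ..
  qed
  ultimately show "\<exists>R>0. \<exists>B f. sep_holomorphic f R B \<and>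
     (\<forall>x y. (x, y) \<in> {p \<in> achievable. zeta p < zeta_max} - {(1 / 2, 0)} \<longrightarrow> \<bar>x - x0\<bar> < R \<longrightarrow> \<bar>y - y0\<bar> < R \<longrightarrow> h (x, y) = Re (f (of_real (x - x0)) (of_real (y - y0))))"
    using R by blast
qed

lemma block_value_holomorphic:
  assumes "w holomorphic_on U" "x holomorphic_on U" "\<And>s. s \<in> U \<Longrightarrow> cmod (w s) < radius \<and> cmod (x s) < 4" and y: "y \<in> {-2, 0, 2}"
  shows "(\<lambda>s. block_value y (w s) (x s)) holomorphic_on U"
proof -
  have "cmod (w s * (x s + y)) < 3/4" if "s \<in> U" for s
    using arg_small[of "w s" "x s"] assms(3)[OF that] radius y by auto
  hence "(\<lambda>s. tanh (w s * (x s + y))) holomorphic_on U"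
    using assms(1,2) by (intro holomorphic_on_compose_gen[OF _ tanh_holomorphic, unfolded o_def] holomorphic_intros) auto
  thus ?thesis unfolding block_value_def by (intro holomorphic_intros) auto
qed

lemma block_value_bounded:
  assumes y: "y \<in> {-2, 0, 2}"
  shows "\<exists>B. \<forall>w x. cmod w < radius \<longrightarrow> cmod x < 4 \<longrightarrow> cmod (block_value y w x) \<le> B"
proof -
  obtain B where B: "\<And>z. z \<in> ball 0 (3/4) \<Longrightarrow> cmod (tanh_tower 0 z) \<le> B" using tanh_tower_bounded[of 0] by blast
  have "cmod (block_value y w x) \<le> (1 + B) / 2" if "cmod w < radius" "cmod x < 4" for w x
  proof -
    have "cmod (w * (x + y)) < 3/4" using arg_small[of w x] that radius y by auto
    hence "cmod (tanh (w * (x + y))) \<le> B" using B[of "w * (x + y)"] by (simp add: tanh_tower_def)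
    hence "cmod (1 + tanh (w * (x + y))) \<le> 1 + B" using norm_triangle_ineq[of 1 "tanh (w * (x + y))"] by simp
    thus ?thesis by (simp add: block_value_def norm_divide)
  qed
  thus ?thesis by blast
qed

lemma params_analytic:
  assumes "f \<in> {param_a, param_b, param_c, param_d}"
  shows "real_analytic2_on f ({p \<in> achievable. zeta p < zeta_max} - {(1 / 2, 0)})"
proof -
  let ?S = "{p \<in> achievable. zeta p < zeta_max} - {(1 / 2, 0)}"
  have block: "real_analytic2_on h ?S" if y: "y \<in> {-2, 0, 2}" and h: "\<And>p. h p = Re (block_value y (sol_w (sol_at p)) (sol_x (sol_at p)))" for y h
  proof -
    obtain B where B: "\<And>w x. cmod w < radius \<Longrightarrow> cmod x < 4 \<Longrightarrow> cmod (block_value y w x) \<le> B"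
      using block_value_bounded[OF y] by blast
    show ?thesis by (rule analytic_of_sol[of "block_value y", OF block_value_holomorphic[OF _ _ _ y] B h]) blast+
  qed
  have block_weight: "real_analytic2_on param_c ?S"
  proof (rule analytic_of_sol[of block_weight])
    show "cmod (block_weight w x) \<le> 4" if "cmod w < radius" "cmod x < 4" for w x
    proof -
      have "cmod (block_weight w x - (x + 1) / 2) \<le> 1" by (rule radius_bounds(5)) (use that in auto)
      moreover have "cmod ((x + 1) / 2) \<le> 5/2" using norm_triangle_ineq[of x 1] that by (simp add: norm_divide)
      ultimately show ?thesis using norm_triangle_ineq[of "block_weight w x - (x + 1) / 2" "(x + 1) / 2"] by simp
    qed
  qed ((rule curve_holomorphic(3); blast), simp add: param_c_def)
  show ?thesis
    using assms block_weight block[of "-2" param_a] block[of 2 param_b] block[of 0 param_d]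
    by (auto simp: param_a_def param_b_def param_d_def)
qed

lemma eventually_zeta_to_0:
  "\<forall>\<^sub>F p in zeta_to_0. p \<in> achievable \<and> 0 < zeta p \<and> zeta p < zeta_max"
proof -
  have "\<forall>\<^sub>F z in at_right (0::real). 0 < z \<and> z < zeta_max"
    using eventually_at_right_real[OF zeta_max_pos] by eventually_elim auto
  hence "\<forall>\<^sub>F p in filtercomap zeta (at_right 0). 0 < zeta p \<and> zeta p < zeta_max"
    by (rule eventually_filtercomapI)
  thus ?thesis unfolding zeta_to_0_def eventually_inf_principal by eventually_elim auto
qed

theorem theorem2:
  "\<exists>\<zeta>0 > 0. \<exists>a b c d :: real \<times> real \<Rightarrow> real.
     (\<forall>(e, t) \<in> achievable. zeta (e, t) < \<zeta>0 \<longrightarrow>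
        a (e, t) \<in> {0..1} \<and> b (e, t) \<in> {0..1} \<and> c (e, t) \<in> {0..1} \<and> d (e, t) \<in> {0..1} \<and>
        entropy_maximizer (bipodal (a (e, t)) (b (e, t)) (c (e, t)) (d (e, t))) e t \<and>
        (\<forall>g. entropy_maximizer g e t \<longrightarrow>
           cut_distance g (bipodal (a (e, t)) (b (e, t)) (c (e, t)) (d (e, t))) = 0)) \<and>
     (\<lambda>(e, t). a (e, t) - (1 - e - 2 * zeta (e, t))) \<in> O[zeta_to_0](\<lambda>p. (zeta p)\<^sup>2) \<and>
     (\<lambda>(e, t). b (e, t) - (1 - e + 2 * zeta (e, t))) \<in> O[zeta_to_0](\<lambda>p. (zeta p)\<^sup>2) \<and>
     (\<lambda>(e, t). d (e, t) - (1 - e)) \<in> O[zeta_to_0](\<lambda>p. (zeta p)\<^sup>2) \<and>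
     (\<lambda>(e, t). c (e, t) - 1 / 2 * (1 - (e - 1 / 2) / zeta (e, t))) \<in> O[zeta_to_0](zeta) \<and>
     (\<forall>f \<in> {a, b, c, d}.
        real_analytic2_on f ({p \<in> achievable. zeta p < \<zeta>0} - {(1 / 2, 0)}))"
proof (rule exI[of _ zeta_max], rule conjI[OF zeta_max_pos], rule exI[of _ param_a], rule exI[of _ param_b],
    rule exI[of _ param_c], rule exI[of _ param_d], intro conjI)
  show "\<forall>(e, t) \<in> achievable. zeta (e, t) < zeta_max \<longrightarrow>
        param_a (e, t) \<in> {0..1} \<and> param_b (e, t) \<in> {0..1} \<and> param_c (e, t) \<in> {0..1} \<and> param_d (e, t) \<in> {0..1} \<and>
        entropy_maximizer (bipodal (param_a (e, t)) (param_b (e, t)) (param_c (e, t)) (param_d (e, t))) e t \<and>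
        (\<forall>g. entropy_maximizer g e t \<longrightarrow>
           cut_distance g (bipodal (param_a (e, t)) (param_b (e, t)) (param_c (e, t)) (param_d (e, t))) = 0)"
  proof (clarify)
    fix e t assume p: "(e, t) \<in> achievable" and lt: "zeta (e, t) < zeta_max"
    show "param_a (e, t) \<in> {0..1} \<and> param_b (e, t) \<in> {0..1} \<and> param_c (e, t) \<in> {0..1} \<and> param_d (e, t) \<in> {0..1} \<and>
        entropy_maximizer (bipodal (param_a (e, t)) (param_b (e, t)) (param_c (e, t)) (param_d (e, t))) e t \<and>
        (\<forall>g. entropy_maximizer g e t \<longrightarrow>
           cut_distance g (bipodal (param_a (e, t)) (param_b (e, t)) (param_c (e, t)) (param_d (e, t))) = 0)"
    proof (cases "zeta (e, t) = 0")
      case True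
      show ?thesis unfolding zeta_eq_0[OF p True] params_at_half using maximizer_at_half by auto
    next
      case False
      hence "0 < zeta (e, t)" using zeta_sq(2)[OF p] by simp
      then obtain q1 q2 s1 s2 where "two_point_certificate (param_c (e, t)) q1 q2 s1 s2 (param_a (e, t)) (param_b (e, t)) (param_d (e, t)) e t"
        using certificate_at[OF p _ lt] by blast
      from maximizer_of_certificate[OF this] show ?thesis by blast
    qed
  qed
  show "(\<lambda>(e, t). param_a (e, t) - (1 - e - 2 * zeta (e, t))) \<in> O[zeta_to_0](\<lambda>p. (zeta p)\<^sup>2)"
    by (rule bigoI[of _ "167 + 51 / radius"], rule eventually_mono[OF eventually_zeta_to_0]) (use param_asymptotics(1) in auto)
  show "(\<lambda>(e, t). param_b (e, t) - (1 - e + 2 * zeta (e, t))) \<in> O[zeta_to_0](\<lambda>p. (zeta p)\<^sup>2)"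
    by (rule bigoI[of _ "167 + 51 / radius"], rule eventually_mono[OF eventually_zeta_to_0]) (use param_asymptotics(2) in auto)
  show "(\<lambda>(e, t). param_d (e, t) - (1 - e)) \<in> O[zeta_to_0](\<lambda>p. (zeta p)\<^sup>2)"
    by (rule bigoI[of _ "167 + 51 / radius"], rule eventually_mono[OF eventually_zeta_to_0]) (use param_asymptotics(3) in auto)
  show "(\<lambda>(e, t). param_c (e, t) - 1 / 2 * (1 - (e - 1 / 2) / zeta (e, t))) \<in> O[zeta_to_0](zeta)"
    by (rule bigoI[of _ "11 / radius"], rule eventually_mono[OF eventually_zeta_to_0]) (use param_asymptotics(4) in auto)
  show "\<forall>f \<in> {param_a, param_b, param_c, param_d}.
        real_analytic2_on f ({p \<in> achievable. zeta p < zeta_max} - {(1 / 2, 0)})"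
    using params_analytic by blast
qed

end
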